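(* Let $r > 1/\sqrt{2}$, let $S^3_r$ be a three-dimensional sphere of radius $r$ in $\mathbb{R}^4$, and let $X \subset S^3_r$ be a finite set of Euclidean diameter $1$ with $|X| = n$. Let $G = G(X)$ be the diameter graph of $X$. Then: 1. $G$ has at most $2n-2$ edges. 2. $\chi(G) \le 4$, where $\chi(G)$ is the chromatic number of $G$. 3. Any two odd cycles in $G$ have a common vertex.
   Context: $S^3_r$ denotes the sphere $\{p\in\mathbb{R}^4 : \|p-c\| = r\}$ of radius $r$ (with some centre $c$). Distances and diameter are Euclidean (not geodesic). For a finite set $X$ of diameter $1$, the diameter graph $G(X)$ has vertex set $X$, and two points of $X$ are joined by an edge if and only if their Euclidean distance equals $1$. *)

theory Defs
  imports "HOL-Analysis.Analysis"
begin

text \<open>An undirected graph is a pair of a vertex set and a set of edges, an edge being the set of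
  its two endpoints.\<close>

type_synonym 'a graph = "'a set \<times> 'a set set"

abbreviation verts :: "'a graph \<Rightarrow> 'a set" where
  "verts G \<equiv> fst G"

abbreviation edges :: "'a graph \<Rightarrow> 'a set set" where
  "edges G \<equiv> snd G"

text \<open>There are no loops, since \<open>dist x x = 0\<close>.\<close>

definition diameter_graph :: "'a::metric_space set \<Rightarrow> 'a graph" where
  "diameter_graph X = (X, {{x, y} | x y. x \<in> X \<and> y \<in> X \<and> dist x y = 1})"

definition proper_colouring :: "'a graph \<Rightarrow> nat \<Rightarrow> ('a \<Rightarrow> nat) \<Rightarrow> bool" where
  "proper_colouring G k f \<longleftrightarrow>
     f ` verts G \<subseteq> {..<k} \<and> (\<forall>x y. {x, y} \<in> edges G \<longrightarrow> f x \<noteq> f y)"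

text \<open>The least element is attained for every finite graph without loops, in particular for
  diameter graphs of finite sets; see \<open>ex_proper_colouring_diameter_graph\<close> below.\<close>

definition chromatic_number :: "'a graph \<Rightarrow> nat" where
  "chromatic_number G = (LEAST k. \<exists>f. proper_colouring G k f)"

text \<open>A cycle is given by the list of its pairwise distinct vertices in cyclic order; the last
  vertex is adjacent to the first one.\<close>

definition is_cycle :: "'a graph \<Rightarrow> 'a list \<Rightarrow> bool" where
  "is_cycle G p \<longleftrightarrow>
     length p \<ge> 3 \<and> distinct p \<and> set p \<subseteq> verts G \<and>
     (\<forall>i < length p. {p ! i, p ! (Suc i mod length p)} \<in> edges G)"

definition is_odd_cycle :: "'a graph \<Rightarrow> 'a list \<Rightarrow> bool" where
  "is_odd_cycle G p \<longleftrightarrow> is_cycle G p \<and> odd (length p)"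

lemma edge_diameter_graph_iff:
  "{x, y} \<in> edges (diameter_graph X) \<longleftrightarrow> x \<in> X \<and> y \<in> X \<and> dist x y = 1"
  by (auto simp: diameter_graph_def doubleton_eq_iff dist_commute)

lemma ex_proper_colouring_diameter_graph:
  assumes "finite X"
  shows "\<exists>f. proper_colouring (diameter_graph X) (card X) f"
proof -
  obtain f :: "'a \<Rightarrow> nat" where f: "bij_betw f X {0..<card X}"
    using ex_bij_betw_finite_nat[OF assms] by blast
  have "f ` verts (diameter_graph X) \<subseteq> {..<card X}"
    using f by (auto simp: diameter_graph_def bij_betw_def)
  moreover have "f x \<noteq> f y" if "{x, y} \<in> edges (diameter_graph X)" for x y
  proof -
    have "x \<in> X" "y \<in> X" "x \<noteq> y"
      using that unfolding edge_diameter_graph_iff by auto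
    then show ?thesis
      using f by (auto simp: bij_betw_def inj_on_def)
  qed
  ultimately show ?thesis
    unfolding proper_colouring_def by blast
qed

end

theory Submission
  imports Defs
begin

text \<open>After a translation and a scaling, \<open>X\<close> becomes a finite set \<open>Y\<close> of unit vectors of \<open>\<real>\<^sup>4\<close> with
  \<open>x \<bullet> y \<ge> t\<close> for all \<open>x, y\<close>, where \<open>t = 1 - 1 / (2 * r\<^sup>2)\<close>, and two points are adjacent exactly
  when \<open>x \<bullet> y = t\<close>. The hypothesis \<open>r > 1 / sqrt 2\<close> says that \<open>t > 0\<close>. Hence \<open>Y\<close> lies in an open
  hemisphere with pole \<open>p \<in> Y\<close>, and each adjacent pair has a direction, the vector
  \<open>(p \<bullet> x) y - (p \<bullet> y) x\<close>: the point in which the great circle from \<open>x\<close> through \<open>y\<close> leaves the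
  hemisphere. These directions live in the hyperplane orthogonal to \<open>p\<close>, that is in \<open>\<real>\<^sup>3\<close>, or on
  the sphere of its rays.

  For each \<open>x\<close> let the red cell of \<open>x\<close> be the convex cone spanned by the directions from \<open>x\<close> to
  its neighbours, and let the blue cell be its negative. Two metric facts carry the proof. A
  neighbour that has a second neighbour of its own is an extreme ray of the cell
  (\<open>neighbour_extreme\<close>). Two different cells have only the origin in common, unless one is red,
  the other is blue and they belong to adjacent points; then they share just the ray of that edge
  (\<open>cells_touch_only_at_contacts\<close>, from \<open>hulls_disjoint\<close> and \<open>crossing_quadrilateral\<close>: the
  diagonals of a quadrilateral have a greater sum than two opposite sides). So the bipartite
  double cover of the diameter graph is drawn on the sphere without crossings, its vertices being
  convex polygons and its edges being their contact points, and the antipodal map exchanges the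
  colours.

  To bound the number of edges, points with at most two neighbours are removed by induction.
  Otherwise all cells are proper polygons, and Euler's formula for a bipartite plane graph with
  \<open>2n\<close> vertices gives at most \<open>4n - 4\<close> edges of the double cover, twice as many as the graph has.
  Since this holds for every subset, there is always a point with at most three neighbours, so
  four colours suffice greedily. Finally, an odd cycle lifts to a closed curve on the sphere that
  is its own antipode; disjoint odd cycles lift to disjoint curves, and two centrally symmetric
  closed curves cannot be disjoint.

  The topology in the last two arguments is replaced by a parity. Fix a generic point \<open>g\<close> of the
  sphere. For a closed chain of arcs, the parity of the number of arcs crossed by the arc from \<open>q\<close>
  to \<open>g\<close> does not change when \<open>q\<close> moves along an arc disjoint from the chain, and changes when \<open>q\<close>
  crosses the chain once (\<open>winding_parity_eq\<close>, \<open>winding_parity_jump\<close>); this follows from a sign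
  analysis for one arc and one triangle (\<open>triangle_parity\<close>). For a closed curve symmetric under
  the antipodal map it differs at \<open>q\<close> and \<open>- q\<close> (\<open>antipodal_winding_parity\<close>), which settles the
  odd cycles. For Euler's inequality, the parity turns every even subgraph of the double cover
  into a function that is constant on faces and determines the subgraph. There are at least
  \<open>2 ^ (|K| - |V| + 1)\<close> even subgraphs, so the number of faces is at least \<open>|K| - |V| + 2\<close>, while
  it is at most \<open>|K| / 2\<close> because every face has at least four corners (\<open>euler_bound\<close>).\<close>

section \<open>Parity of crossings of an arc with a triangle\<close>

text \<open>Points of the sphere are represented by nonzero vectors up to positive factors, and the sign
  of \<open>det3 a b c\<close> tells on which side of the great circle through \<open>b\<close> and \<open>c\<close> the point \<open>a\<close> lies.\<close>

definition det3 :: "real^3 \<Rightarrow> real^3 \<Rightarrow> real^3 \<Rightarrow> real" where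
  "det3 a b c = a \<bullet> cross3 b c"

lemma det3_expand:
  "det3 a b c = a$1 * (b$2 * c$3 - b$3 * c$2) + a$2 * (b$3 * c$1 - b$1 * c$3) + a$3 * (b$1 * c$2 - b$2 * c$1)"
  by (simp add: det3_def cross3_simps)

lemma det3_linear:
  "det3 (a + a') b c = det3 a b c + det3 a' b c"
  "det3 a (b + b') c = det3 a b c + det3 a b' c"
  "det3 a b (c + c') = det3 a b c + det3 a b c'"
  "det3 (s *\<^sub>R a) b c = s * det3 a b c"
  "det3 a (s *\<^sub>R b) c = s * det3 a b c"
  "det3 a b (s *\<^sub>R c) = s * det3 a b c"
  by (simp_all add: det3_expand algebra_simps)

lemma det3_repeat [simp]: "det3 a a b = 0" "det3 a b a = 0" "det3 b a a = 0"
  by (simp_all add: det3_expand algebra_simps)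

lemma det3_zero [simp]: "det3 0 a b = 0" "det3 a 0 b = 0" "det3 a b 0 = 0"
  by (simp_all add: det3_expand)

lemma det3_minus [simp]:
  "det3 (- a) b c = - det3 a b c" "det3 a (- b) c = - det3 a b c" "det3 a b (- c) = - det3 a b c"
  by (simp_all add: det3_expand algebra_simps)

lemma det3_sum:
  "det3 a b (\<Sum>i\<in>I. f i) = (\<Sum>i\<in>I. det3 a b (f i))"
  by (induction I rule: infinite_finite_induct) (simp_all add: det3_linear)

lemma det3_swap: "det3 b a c = - det3 a b c" "det3 a c b = - det3 a b c" "det3 c b a = - det3 a b c"
  by (simp_all add: det3_expand algebra_simps)

lemma cramer3:
  "det3 q q' g *\<^sub>R a = det3 a q' g *\<^sub>R q + det3 q a g *\<^sub>R q' + det3 q q' a *\<^sub>R g"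
  by (simp add: vec_eq_iff forall_3 det3_expand algebra_simps)

lemma coordinates_unique:
  assumes "det3 q q' g \<noteq> 0"
    and "x *\<^sub>R q + y *\<^sub>R q' + z *\<^sub>R g = x' *\<^sub>R q + y' *\<^sub>R q' + z' *\<^sub>R g"
  shows "x = x' \<and> y = y' \<and> z = z'"
proof -
  have "det3 (x *\<^sub>R q + y *\<^sub>R q' + z *\<^sub>R g) q' g = det3 (x' *\<^sub>R q + y' *\<^sub>R q' + z' *\<^sub>R g) q' g"
    "det3 q (x *\<^sub>R q + y *\<^sub>R q' + z *\<^sub>R g) g = det3 q (x' *\<^sub>R q + y' *\<^sub>R q' + z' *\<^sub>R g) g"
    "det3 q q' (x *\<^sub>R q + y *\<^sub>R q' + z *\<^sub>R g) = det3 q q' (x' *\<^sub>R q + y' *\<^sub>R q' + z' *\<^sub>R g)"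
    using assms(2) by simp_all
  then show ?thesis using assms(1) by (simp add: det3_linear)
qed

text \<open>The arc from \<open>q\<close> to \<open>g\<close> crosses the arc from \<open>a\<close> to \<open>b\<close> at an interior point of both. The
  coefficient of \<open>q\<close> is normalised to \<open>1\<close>.\<close>

definition crosses :: "real^3 \<Rightarrow> real^3 \<Rightarrow> real^3 \<Rightarrow> real^3 \<Rightarrow> bool" where
  "crosses g q a b \<longleftrightarrow>
     (\<exists>\<alpha>>0. \<exists>\<beta>>0. \<exists>\<gamma>>0. \<alpha> *\<^sub>R a + \<beta> *\<^sub>R b = q + \<gamma> *\<^sub>R g)"

text \<open>The closed arcs \<open>qq'\<close> and \<open>ab\<close> have a common point. The condition on \<open>\<alpha> + \<beta>\<close> excludes the
  common origin of the two cones over the arcs, as long as \<open>a\<close> and \<open>b\<close> are not opposite.\<close>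

definition arcs_meet :: "real^3 \<Rightarrow> real^3 \<Rightarrow> real^3 \<Rightarrow> real^3 \<Rightarrow> bool" where
  "arcs_meet q q' a b \<longleftrightarrow>
     (\<exists>\<alpha>\<ge>0. \<exists>\<beta>\<ge>0. \<exists>l\<ge>0. \<exists>m\<ge>0. \<alpha> + \<beta> > 0 \<and> \<alpha> *\<^sub>R a + \<beta> *\<^sub>R b = l *\<^sub>R q + m *\<^sub>R q')"

definition in_triangle :: "real^3 \<Rightarrow> real^3 \<Rightarrow> real^3 \<Rightarrow> real^3 \<Rightarrow> bool" where
  "in_triangle q q' g a \<longleftrightarrow> (\<exists>x>0. \<exists>y>0. \<exists>z>0. a = x *\<^sub>R q + y *\<^sub>R q' + z *\<^sub>R g)"

lemma planar_crossing_iff: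
  fixes a1 a2 b1 b2 :: real
  assumes "a2 \<noteq> 0" "b2 \<noteq> 0"
  shows "(\<exists>\<alpha>>0. \<exists>\<beta>>0. \<alpha> * a2 + \<beta> * b2 = 0 \<and> \<alpha> * a1 + \<beta> * b1 > 0) \<longleftrightarrow>
    (a2 > 0 \<and> b2 < 0 \<and> a2 * b1 > a1 * b2) \<or> (a2 < 0 \<and> b2 > 0 \<and> a2 * b1 < a1 * b2)"
    (is "?L \<longleftrightarrow> ?R")
proof
  assume ?L
  then obtain \<alpha> \<beta> where ab: "\<alpha> > 0" "\<beta> > 0" "\<alpha> * a2 + \<beta> * b2 = 0" "\<alpha> * a1 + \<beta> * b1 > 0"
    by blast
  have b: "\<beta> * b2 = - (\<alpha> * a2)" using ab by linarith
  have id: "\<beta> * (a2 * b1 - a1 * b2) = a2 * (\<alpha> * a1 + \<beta> * b1)"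
  proof -
    have "\<beta> * (a2 * b1 - a1 * b2) = a2 * (\<beta> * b1) - a1 * (\<beta> * b2)" by (simp add: algebra_simps)
    also have "\<dots> = a2 * (\<alpha> * a1 + \<beta> * b1)" unfolding b by (simp add: algebra_simps)
    finally show ?thesis .
  qed
  consider "a2 > 0" | "a2 < 0" using assms by linarith
  then show ?R
  proof cases
    case 1
    have "\<beta> * b2 < 0" using mult_pos_pos[OF ab(1) 1] b by linarith
    then have "b2 < 0" using ab by (simp add: mult_less_0_iff)
    moreover have "\<beta> * (a2 * b1 - a1 * b2) > 0" unfolding id using 1 ab by simp
    then have "a2 * b1 - a1 * b2 > 0" using ab by (simp add: zero_less_mult_iff)
    ultimately show ?thesis using 1 by simp
  next
    case 2
    have "\<alpha> * a2 < 0" using ab 2 by (simp add: mult_pos_neg)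
    then have "\<beta> * b2 > 0" using b by linarith
    then have "b2 > 0" using ab by (simp add: zero_less_mult_iff)
    moreover have "\<beta> * (a2 * b1 - a1 * b2) < 0" unfolding id using 2 ab by (simp add: mult_neg_pos)
    then have "a2 * b1 - a1 * b2 < 0" using ab by (simp add: mult_less_0_iff)
    ultimately show ?thesis using 2 by simp
  qed
next
  assume ?R
  then show ?L
  proof
    assume h: "a2 > 0 \<and> b2 < 0 \<and> a2 * b1 > a1 * b2"
    then show ?L by (intro exI[of _ "- b2"] conjI exI[of _ a2]) (auto simp: algebra_simps)
  next
    assume h: "a2 < 0 \<and> b2 > 0 \<and> a2 * b1 < a1 * b2"
    then show ?L by (intro exI[of _ "b2"] conjI exI[of _ "- a2"]) (auto simp: algebra_simps)
  qed
qed

text \<open>The part of a segment inside a convex set is an interval, each of whose ends is either an end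
  point of the segment or a point where it crosses the boundary. Here the convex set is the open
  positive quadrant, and the two existential formulas are the crossings with the half axes that
  bound it.\<close>

lemma planar_parity:
  fixes a1 a2 b1 b2 :: real
  assumes "a1 \<noteq> 0" "a2 \<noteq> 0" "b1 \<noteq> 0" "b2 \<noteq> 0" "a1 * b2 \<noteq> a2 * b1"
  shows "((\<exists>\<alpha>>0. \<exists>\<beta>>0. \<alpha> * a2 + \<beta> * b2 = 0 \<and> \<alpha> * a1 + \<beta> * b1 > 0) \<noteq>
          (\<exists>\<alpha>>0. \<exists>\<beta>>0. \<alpha> * a1 + \<beta> * b1 = 0 \<and> \<alpha> * a2 + \<beta> * b2 > 0)) \<longleftrightarrow>
         ((a1 > 0 \<and> a2 > 0) \<noteq> (b1 > 0 \<and> b2 > 0))"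
proof -
  have neg: "x < 0 \<longleftrightarrow> \<not> 0 < x" if "x \<noteq> 0" for x :: real using that by linarith
  have pos: "0 < x * y \<longleftrightarrow> (0 < x \<longleftrightarrow> 0 < y)" if "x \<noteq> 0" "y \<noteq> 0" for x y :: real
    using that by (auto simp: zero_less_mult_iff)
  define u where "u = a1 * b2"
  define v where "v = a2 * b1"
  have u: "0 < u \<longleftrightarrow> (0 < a1 \<longleftrightarrow> 0 < b2)" and v: "0 < v \<longleftrightarrow> (0 < a2 \<longleftrightarrow> 0 < b1)"
    using pos assms unfolding u_def v_def by blast+
  have uv: "v < u \<longleftrightarrow> \<not> u < v" using assms(5) unfolding u_def v_def by linarith
  have 1: "\<not> u < v" if "0 < u" "\<not> 0 < v" using that by linarith
  have 2: "u < v" if "\<not> 0 < u" "0 < v" using that by linarith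
  show ?thesis
    unfolding planar_crossing_iff[OF assms(2,4)] planar_crossing_iff[OF assms(1,3)]
      u_def[symmetric] v_def[symmetric] neg[OF assms(1)] neg[OF assms(2)] neg[OF assms(3)] neg[OF assms(4)] uv
    using 1 2 unfolding u v by argo
qed

text \<open>The points of the segment over the closed quadrant form an interval. On it the third
  coordinate never vanishes, so it has constant sign there; either nothing in the statement
  happens, or the third coordinate can be dropped.\<close>

lemma coordinate_parity:
  fixes a1 a2 a3 b1 b2 b3 :: real
  assumes nz: "a1 \<noteq> 0" "a2 \<noteq> 0" "b1 \<noteq> 0" "b2 \<noteq> 0" "a1 * b2 \<noteq> a2 * b1"
    and no: "\<And>\<alpha> \<beta>. \<alpha> \<ge> 0 \<Longrightarrow> \<beta> \<ge> 0 \<Longrightarrow> \<alpha> + \<beta> > 0 \<Longrightarrow> \<alpha> * a3 + \<beta> * b3 = 0 \<Longrightarrow>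
       \<alpha> * a1 + \<beta> * b1 \<ge> 0 \<Longrightarrow> \<alpha> * a2 + \<beta> * b2 \<ge> 0 \<Longrightarrow> False"
  shows "((\<exists>\<alpha>>0. \<exists>\<beta>>0. \<alpha> * a2 + \<beta> * b2 = 0 \<and> \<alpha> * a1 + \<beta> * b1 > 0 \<and> \<alpha> * a3 + \<beta> * b3 > 0) \<noteq>
          (\<exists>\<alpha>>0. \<exists>\<beta>>0. \<alpha> * a1 + \<beta> * b1 = 0 \<and> \<alpha> * a2 + \<beta> * b2 > 0 \<and> \<alpha> * a3 + \<beta> * b3 > 0)) \<longleftrightarrow>
         ((a1 > 0 \<and> a2 > 0 \<and> a3 > 0) \<noteq> (b1 > 0 \<and> b2 > 0 \<and> b3 > 0))"
proof -
  define good where "good \<alpha> \<beta> \<longleftrightarrow> \<alpha> \<ge> 0 \<and> \<beta> \<ge> 0 \<and> \<alpha> + \<beta> > 0 \<and> \<alpha> * a1 + \<beta> * b1 \<ge> 0 \<and> \<alpha> * a2 + \<beta> * b2 \<ge> 0"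
    for \<alpha> \<beta>
  have sign: "\<alpha>' * a3 + \<beta>' * b3 > 0"
    if G: "good \<alpha> \<beta>" "good \<alpha>' \<beta>'" and p: "\<alpha> * a3 + \<beta> * b3 > 0" for \<alpha> \<beta> \<alpha>' \<beta>'
  proof (rule ccontr)
    assume n: "\<not> ?thesis"
    define s where "s = \<alpha> * a3 + \<beta> * b3"
    define t where "t = - (\<alpha>' * a3 + \<beta>' * b3)"
    have s: "s > 0" and t: "t \<ge> 0" using p n by (auto simp: s_def t_def)
    show False
    proof (rule no[of "t * \<alpha> + s * \<alpha>'" "t * \<beta> + s * \<beta>'"])
      show "t * \<alpha> + s * \<alpha>' \<ge> 0" "t * \<beta> + s * \<beta>' \<ge> 0" using G s t by (auto simp: good_def)
      have "t * (\<alpha> + \<beta>) \<ge> 0" using G t by (simp add: good_def)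
      moreover have "s * (\<alpha>' + \<beta>') > 0" using G s by (intro mult_pos_pos) (simp_all add: good_def)
      ultimately have "t * (\<alpha> + \<beta>) + s * (\<alpha>' + \<beta>') > 0" by linarith
      then show "t * \<alpha> + s * \<alpha>' + (t * \<beta> + s * \<beta>') > 0" by (simp add: algebra_simps)
      have "(t * \<alpha> + s * \<alpha>') * a3 + (t * \<beta> + s * \<beta>') * b3 = t * s + s * (- t)"
        by (simp add: s_def t_def algebra_simps)
      then show "(t * \<alpha> + s * \<alpha>') * a3 + (t * \<beta> + s * \<beta>') * b3 = 0" by simp
      have "(t * \<alpha> + s * \<alpha>') * a1 + (t * \<beta> + s * \<beta>') * b1 = t * (\<alpha> * a1 + \<beta> * b1) + s * (\<alpha>' * a1 + \<beta>' * b1)"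
        "(t * \<alpha> + s * \<alpha>') * a2 + (t * \<beta> + s * \<beta>') * b2 = t * (\<alpha> * a2 + \<beta> * b2) + s * (\<alpha>' * a2 + \<beta>' * b2)"
        by (simp_all add: algebra_simps)
      then show "(t * \<alpha> + s * \<alpha>') * a1 + (t * \<beta> + s * \<beta>') * b1 \<ge> 0"
        "(t * \<alpha> + s * \<alpha>') * a2 + (t * \<beta> + s * \<beta>') * b2 \<ge> 0"
        using G s t by (auto simp: good_def)
    qed
  qed
  have ga: "good 1 0" if "a1 > 0" "a2 > 0" using that by (simp add: good_def)
  have gb: "good 0 1" if "b1 > 0" "b2 > 0" using that by (simp add: good_def)
  show ?thesis
  proof (cases "\<exists>\<alpha> \<beta>. good \<alpha> \<beta> \<and> \<alpha> * a3 + \<beta> * b3 > 0")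
    case True
    then have all: "\<alpha> * a3 + \<beta> * b3 > 0" if "good \<alpha> \<beta>" for \<alpha> \<beta> using that sign by blast
    have drop: "(\<exists>\<alpha>>0. \<exists>\<beta>>0. \<alpha> * x + \<beta> * y = 0 \<and> \<alpha> * x' + \<beta> * y' > 0 \<and> \<alpha> * a3 + \<beta> * b3 > 0)
      \<longleftrightarrow> (\<exists>\<alpha>>0. \<exists>\<beta>>0. \<alpha> * x + \<beta> * y = 0 \<and> \<alpha> * x' + \<beta> * y' > 0)" (is "?l \<longleftrightarrow> ?r")
      if "{(x, y), (x', y')} = {(a1, b1), (a2, b2)}" for x y x' y'
    proof
      assume ?r
      then obtain \<alpha> \<beta> where *: "\<alpha> > 0" "\<beta> > 0" "\<alpha> * x + \<beta> * y = 0" "\<alpha> * x' + \<beta> * y' > 0" by blast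
      have "good \<alpha> \<beta>" using * that by (auto simp: good_def doubleton_eq_iff)
      with * all show ?l by blast
    qed blast
    have 1: "{(a2, b2), (a1, b1)} = {(a1, b1), (a2, b2)}" by blast
    have "(a1 > 0 \<and> a2 > 0 \<and> a3 > 0) \<longleftrightarrow> (a1 > 0 \<and> a2 > 0)" using ga all[of 1 0] by auto
    moreover have "(b1 > 0 \<and> b2 > 0 \<and> b3 > 0) \<longleftrightarrow> (b1 > 0 \<and> b2 > 0)" using gb all[of 0 1] by auto
    ultimately show ?thesis unfolding drop[OF 1] drop[OF refl] using planar_parity[OF nz] by simp
  next
    case False
    then have n: "\<not> \<alpha> * a3 + \<beta> * b3 > 0" if "good \<alpha> \<beta>" for \<alpha> \<beta> using that by blast
    have "\<not> (a1 > 0 \<and> a2 > 0 \<and> a3 > 0)" using ga n[of 1 0] by auto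
    moreover have "\<not> (b1 > 0 \<and> b2 > 0 \<and> b3 > 0)" using gb n[of 0 1] by auto
    moreover have "\<not> (\<exists>\<alpha>>0. \<exists>\<beta>>0. \<alpha> * a2 + \<beta> * b2 = 0 \<and> \<alpha> * a1 + \<beta> * b1 > 0 \<and> \<alpha> * a3 + \<beta> * b3 > 0)"
      using n by (force simp: good_def)
    moreover have "\<not> (\<exists>\<alpha>>0. \<exists>\<beta>>0. \<alpha> * a1 + \<beta> * b1 = 0 \<and> \<alpha> * a2 + \<beta> * b2 > 0 \<and> \<alpha> * a3 + \<beta> * b3 > 0)"
      using n by (force simp: good_def)
    ultimately show ?thesis by blast
  qed
qed

text \<open>Here the segment passes through the face spanned by the first two axes. Only its part on the
  side of \<open>a\<close> counts, and that part ends at a point over the open quadrant.\<close>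

lemma coordinate_parity_crossing:
  fixes a1 a2 a3 b1 b2 b3 :: real
  assumes nz: "a1 \<noteq> 0" "a2 \<noteq> 0" "b1 \<noteq> 0" "b2 \<noteq> 0" "a1 * b2 \<noteq> a2 * b1"
    and a3: "a3 > 0" and s: "s > 0" and t: "t > 0" and st: "s * a3 + t * b3 = 0"
    and p: "s * a1 + t * b1 > 0" "s * a2 + t * b2 > 0"
  shows "((\<exists>\<alpha>>0. \<exists>\<beta>>0. \<alpha> * a2 + \<beta> * b2 = 0 \<and> \<alpha> * a1 + \<beta> * b1 > 0 \<and> \<alpha> * a3 + \<beta> * b3 > 0) \<noteq>
          (\<exists>\<alpha>>0. \<exists>\<beta>>0. \<alpha> * a1 + \<beta> * b1 = 0 \<and> \<alpha> * a2 + \<beta> * b2 > 0 \<and> \<alpha> * a3 + \<beta> * b3 > 0)) \<longleftrightarrow>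
         ((a1 > 0 \<and> a2 > 0 \<and> a3 > 0) = (b1 > 0 \<and> b2 > 0 \<and> b3 > 0))"
proof -
  define m1 where "m1 = s * a1 + t * b1"
  define m2 where "m2 = s * a2 + t * b2"
  have m: "m1 > 0" "m2 > 0" using p by (auto simp: m1_def m2_def)
  have b3: "b3 < 0"
  proof -
    have "s * a3 > 0" using a3 s by simp
    then have "t * b3 < 0" using st by linarith
    then show ?thesis using t by (simp add: mult_less_0_iff)
  qed
  have nm: "a1 * m2 \<noteq> a2 * m1"
  proof
    assume "a1 * m2 = a2 * m1"
    then have "t * (a1 * b2 - a2 * b1) = 0" by (simp add: m1_def m2_def algebra_simps)
    then show False using t nz by simp
  qed
  \<comment> \<open>the part of the arc with positive third coordinate runs from the first end point to the crossing point\<close>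
  have key: "(\<exists>\<alpha>>0. \<exists>\<beta>>0. \<alpha> * x + \<beta> * y = 0 \<and> \<alpha> * x' + \<beta> * y' > 0 \<and> \<alpha> * a3 + \<beta> * b3 > 0) \<longleftrightarrow>
     (\<exists>\<alpha>>0. \<exists>\<beta>>0. \<alpha> * x + \<beta> * (s * x + t * y) = 0 \<and> \<alpha> * x' + \<beta> * (s * x' + t * y') > 0)"
     (is "?l \<longleftrightarrow> ?r") for x y x' y'
  proof
    assume ?l
    then obtain \<alpha> \<beta> where *: "\<alpha> > 0" "\<beta> > 0" "\<alpha> * x + \<beta> * y = 0" "\<alpha> * x' + \<beta> * y' > 0" "\<alpha> * a3 + \<beta> * b3 > 0"
      by blast
    define \<mu> where "\<mu> = \<alpha> - \<beta> / t * s"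
    have "b3 = - (s * a3) / t" using st t by (simp add: field_simps)
    then have "\<mu> * a3 = \<alpha> * a3 + \<beta> * b3" using t by (simp add: \<mu>_def field_simps)
    then have "\<mu> > 0" using * a3 by (metis zero_less_mult_pos2)
    moreover have "\<beta> / t > 0" using * t by simp
    moreover have "\<mu> * z + \<beta> / t * (s * z + t * w) = \<alpha> * z + \<beta> * w" for z w
      using t by (simp add: \<mu>_def field_simps)
    ultimately show ?r using * by metis
  next
    assume ?r
    then obtain \<alpha> \<beta> where *: "\<alpha> > 0" "\<beta> > 0" "\<alpha> * x + \<beta> * (s * x + t * y) = 0" "\<alpha> * x' + \<beta> * (s * x' + t * y') > 0"
      by blast
    have "\<alpha> + \<beta> * s > 0" "\<beta> * t > 0" using * s t by (simp_all add: add_pos_pos)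
    moreover have "(\<alpha> + \<beta> * s) * z + (\<beta> * t) * w = \<alpha> * z + \<beta> * (s * z + t * w)" for z w
      by (simp add: algebra_simps)
    moreover have "\<alpha> * a3 + \<beta> * (s * a3 + t * b3) > 0" using st * a3 by simp
    ultimately show ?l using * by metis
  qed
  have m12: "m1 \<noteq> 0" "m2 \<noteq> 0" using m by auto
  have logic: "(A \<noteq> B) \<longleftrightarrow> (R = S)" if "(A \<noteq> B) \<longleftrightarrow> (R' \<noteq> M)" "R \<longleftrightarrow> R'" "M" "\<not> S" for A B R R' S M :: bool
    using that by blast
  show ?thesis
    unfolding key[of a2 b2 a1 b1] key[of a1 b1 a2 b2] m1_def[symmetric] m2_def[symmetric]
    by (rule logic[OF planar_parity[OF nz(1,2) m12 nm]]) (use a3 b3 m in auto)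
qed

lemma crosses_coordinates:
  assumes D: "det3 q q' g \<noteq> 0"
    and a: "a = a1 *\<^sub>R q + a2 *\<^sub>R q' + a3 *\<^sub>R g" and b: "b = b1 *\<^sub>R q + b2 *\<^sub>R q' + b3 *\<^sub>R g"
  shows "crosses g q a b \<longleftrightarrow>
     (\<exists>\<alpha>>0. \<exists>\<beta>>0. \<alpha> * a2 + \<beta> * b2 = 0 \<and> \<alpha> * a1 + \<beta> * b1 > 0 \<and> \<alpha> * a3 + \<beta> * b3 > 0)" (is "_ \<longleftrightarrow> ?r")
proof
  have ab: "\<alpha> *\<^sub>R a + \<beta> *\<^sub>R b = (\<alpha> * a1 + \<beta> * b1) *\<^sub>R q + (\<alpha> * a2 + \<beta> * b2) *\<^sub>R q' + (\<alpha> * a3 + \<beta> * b3) *\<^sub>R g" for \<alpha> \<beta>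
    unfolding a b by (simp add: algebra_simps)
  {
    assume "crosses g q a b"
    then obtain \<alpha> \<beta> \<gamma> where *: "\<alpha> > 0" "\<beta> > 0" "\<gamma> > 0" "\<alpha> *\<^sub>R a + \<beta> *\<^sub>R b = q + \<gamma> *\<^sub>R g"
      by (auto simp: crosses_def)
    then have "(\<alpha> * a1 + \<beta> * b1) *\<^sub>R q + (\<alpha> * a2 + \<beta> * b2) *\<^sub>R q' + (\<alpha> * a3 + \<beta> * b3) *\<^sub>R g
      = 1 *\<^sub>R q + 0 *\<^sub>R q' + \<gamma> *\<^sub>R g" using ab by simp
    from coordinates_unique[OF D this] * show ?r by (metis zero_less_one)
  next
    assume ?r
    then obtain \<alpha> \<beta> where *: "\<alpha> > 0" "\<beta> > 0" "\<alpha> * a2 + \<beta> * b2 = 0" "\<alpha> * a1 + \<beta> * b1 > 0" "\<alpha> * a3 + \<beta> * b3 > 0"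
      by blast
    define k where "k = \<alpha> * a1 + \<beta> * b1"
    have k: "k > 0" using * by (simp add: k_def)
    have "(\<alpha> / k) *\<^sub>R a + (\<beta> / k) *\<^sub>R b = (1 / k) *\<^sub>R (\<alpha> *\<^sub>R a + \<beta> *\<^sub>R b)"
      by (simp add: algebra_simps)
    also have "\<dots> = q + ((\<alpha> * a3 + \<beta> * b3) / k) *\<^sub>R g"
      unfolding ab using k * by (simp add: scaleR_add_right k_def[symmetric])
    finally show "crosses g q a b" unfolding crosses_def
      using * k by (metis divide_pos_pos)
  }
qed

lemma in_triangle_coordinates:
  assumes D: "det3 q q' g \<noteq> 0" and a: "a = a1 *\<^sub>R q + a2 *\<^sub>R q' + a3 *\<^sub>R g"
  shows "in_triangle q q' g a \<longleftrightarrow> a1 > 0 \<and> a2 > 0 \<and> a3 > 0"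
  using coordinates_unique[OF D] unfolding in_triangle_def a by metis

lemma coordinates_exist:
  assumes D: "det3 q q' g \<noteq> 0"
  obtains a1 a2 a3 where "a = a1 *\<^sub>R q + a2 *\<^sub>R q' + a3 *\<^sub>R g"
    "a1 = det3 a q' g / det3 q q' g" "a2 = - det3 a q g / det3 q q' g" "a3 = det3 q q' a / det3 q q' g"
proof -
  have "a = (1 / det3 q q' g) *\<^sub>R (det3 q q' g *\<^sub>R a)" using D by simp
  also have "\<dots> = (det3 a q' g / det3 q q' g) *\<^sub>R q + (- det3 a q g / det3 q q' g) *\<^sub>R q' + (det3 q q' a / det3 q q' g) *\<^sub>R g"
    unfolding cramer3[of q q' g a] by (simp add: algebra_simps det3_swap(1)[of q a])
  finally show ?thesis using that by blast
qed

lemma det3_in_coordinates: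
  assumes "a = a1 *\<^sub>R q + a2 *\<^sub>R q' + a3 *\<^sub>R g" "b = b1 *\<^sub>R q + b2 *\<^sub>R q' + b3 *\<^sub>R g"
  shows "det3 a b g = (a1 * b2 - a2 * b1) * det3 q q' g"
  unfolding assms by (simp add: det3_linear det3_swap(1)[of q' q] algebra_simps)

text \<open>An arc enters and leaves the triangle \<open>qq'g\<close> alternately. As \<open>ab\<close> misses the side \<open>qq'\<close>, it
  can do so only through the other two sides.\<close>

lemma triangle_parity:
  assumes D: "det3 q q' g \<noteq> 0"
    and nz: "det3 a q g \<noteq> 0" "det3 a q' g \<noteq> 0" "det3 b q g \<noteq> 0" "det3 b q' g \<noteq> 0" "det3 a b g \<noteq> 0"
    and no: "\<not> arcs_meet q q' a b"
  shows "(crosses g q a b \<noteq> crosses g q' a b) \<longleftrightarrow> (in_triangle q q' g a \<noteq> in_triangle q q' g b)"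
proof -
  obtain a1 a2 a3 where a: "a = a1 *\<^sub>R q + a2 *\<^sub>R q' + a3 *\<^sub>R g"
    and a': "a1 = det3 a q' g / det3 q q' g" "a2 = - det3 a q g / det3 q q' g"
    using coordinates_exist[OF D] by metis
  obtain b1 b2 b3 where b: "b = b1 *\<^sub>R q + b2 *\<^sub>R q' + b3 *\<^sub>R g"
    and b': "b1 = det3 b q' g / det3 q q' g" "b2 = - det3 b q g / det3 q q' g"
    using coordinates_exist[OF D] by metis
  have nz': "a1 \<noteq> 0" "a2 \<noteq> 0" "b1 \<noteq> 0" "b2 \<noteq> 0" using nz D unfolding a' b' by auto
  have nz5: "a1 * b2 \<noteq> a2 * b1" using det3_in_coordinates[OF a b] nz(5) by auto
  have D': "det3 q' q g \<noteq> 0" using D det3_swap(1)[of q' q g] by simp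
  have sw: "a = a2 *\<^sub>R q' + a1 *\<^sub>R q + a3 *\<^sub>R g" "b = b2 *\<^sub>R q' + b1 *\<^sub>R q + b3 *\<^sub>R g"
    using a b by (simp_all add: algebra_simps)
  show ?thesis
    unfolding crosses_coordinates[OF D a b] crosses_coordinates[OF D' sw]
      in_triangle_coordinates[OF D a] in_triangle_coordinates[OF D b]
  proof (rule coordinate_parity[OF nz' nz5])
    fix \<alpha> \<beta> :: real
    assume *: "\<alpha> \<ge> 0" "\<beta> \<ge> 0" "\<alpha> + \<beta> > 0" "\<alpha> * a3 + \<beta> * b3 = 0" "\<alpha> * a1 + \<beta> * b1 \<ge> 0" "\<alpha> * a2 + \<beta> * b2 \<ge> 0"
    have "\<alpha> *\<^sub>R a + \<beta> *\<^sub>R b = (\<alpha> * a1 + \<beta> * b1) *\<^sub>R q + (\<alpha> * a2 + \<beta> * b2) *\<^sub>R q' + (\<alpha> * a3 + \<beta> * b3) *\<^sub>R g"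
      unfolding a b by (simp add: algebra_simps)
    then have "\<alpha> *\<^sub>R a + \<beta> *\<^sub>R b = (\<alpha> * a1 + \<beta> * b1) *\<^sub>R q + (\<alpha> * a2 + \<beta> * b2) *\<^sub>R q'"
      using *(4) by simp
    then have "arcs_meet q q' a b" unfolding arcs_meet_def using * by blast
    then show False using no by blast
  qed
qed

text \<open>Now the arc passes once through the side \<open>qq'\<close>, which reverses the parity of its crossings
  with the other two.\<close>

lemma triangle_parity_crossing:
  assumes D: "det3 q q' g \<noteq> 0"
    and nz: "det3 a q g \<noteq> 0" "det3 a q' g \<noteq> 0" "det3 b q g \<noteq> 0" "det3 b q' g \<noteq> 0" "det3 a b g \<noteq> 0"
    and a0: "det3 q q' a \<noteq> 0"
    and st: "s > 0" "t > 0" "l > 0" "m > 0" "s *\<^sub>R a + t *\<^sub>R b = l *\<^sub>R q + m *\<^sub>R q'"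
  shows "(crosses g q a b \<noteq> crosses g q' a b) \<longleftrightarrow> (in_triangle q q' g a = in_triangle q q' g b)"
proof -
  obtain a1 a2 a3 where a: "a = a1 *\<^sub>R q + a2 *\<^sub>R q' + a3 *\<^sub>R g"
    and a': "a1 = det3 a q' g / det3 q q' g" "a2 = - det3 a q g / det3 q q' g" "a3 = det3 q q' a / det3 q q' g"
    using coordinates_exist[OF D] by metis
  obtain b1 b2 b3 where b: "b = b1 *\<^sub>R q + b2 *\<^sub>R q' + b3 *\<^sub>R g"
    and b': "b1 = det3 b q' g / det3 q q' g" "b2 = - det3 b q g / det3 q q' g"
    using coordinates_exist[OF D] by metis
  have nz': "a1 \<noteq> 0" "a2 \<noteq> 0" "b1 \<noteq> 0" "b2 \<noteq> 0" using nz D unfolding a' b' by auto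
  have nz5: "a1 * b2 \<noteq> a2 * b1" using det3_in_coordinates[OF a b] nz(5) by auto
  have D': "det3 q' q g \<noteq> 0" using D det3_swap(1)[of q' q g] by simp
  have sw: "a = a2 *\<^sub>R q' + a1 *\<^sub>R q + a3 *\<^sub>R g" "b = b2 *\<^sub>R q' + b1 *\<^sub>R q + b3 *\<^sub>R g"
    using a b by (simp_all add: algebra_simps)
  have "s *\<^sub>R a + t *\<^sub>R b = (s * a1 + t * b1) *\<^sub>R q + (s * a2 + t * b2) *\<^sub>R q' + (s * a3 + t * b3) *\<^sub>R g"
    unfolding a b by (simp add: algebra_simps)
  then have "(s * a1 + t * b1) *\<^sub>R q + (s * a2 + t * b2) *\<^sub>R q' + (s * a3 + t * b3) *\<^sub>R g = l *\<^sub>R q + m *\<^sub>R q' + 0 *\<^sub>R g"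
    using st by simp
  from coordinates_unique[OF D this]
  have c: "s * a1 + t * b1 > 0" "s * a2 + t * b2 > 0" "s * a3 + t * b3 = 0" using st by auto
  have "a3 \<noteq> 0" using a0 D by (simp add: a')
  then consider "a3 > 0" | "b3 > 0"
  proof -
    have "b3 > 0" if "a3 < 0"
    proof -
      have "s * a3 < 0" using that st by (simp add: mult_pos_neg)
      then have "t * b3 > 0" using c by linarith
      then show ?thesis using st by (simp add: zero_less_mult_iff)
    qed
    then show ?thesis using \<open>a3 \<noteq> 0\<close> that by linarith
  qed
  then show ?thesis
  proof cases
    case 1
    show ?thesis
      unfolding crosses_coordinates[OF D a b] crosses_coordinates[OF D' sw]
        in_triangle_coordinates[OF D a] in_triangle_coordinates[OF D b]
      by (rule coordinate_parity_crossing[OF nz' nz5 1 st(1,2) c(3) c(1,2)])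
  next
    case 2
    have com: "crosses g p a b \<longleftrightarrow> crosses g p b a" for p
      unfolding crosses_def by (metis add.commute)
    have c': "t * b1 + s * a1 > 0" "t * b2 + s * a2 > 0" "t * b3 + s * a3 = 0"
      using c by (simp_all add: add.commute)
    have nz5': "b1 * a2 \<noteq> b2 * a1" using nz5 by (simp add: mult.commute)
    have sym: "(X \<noteq> Y) \<longleftrightarrow> (R = S)" if "(X \<noteq> Y) \<longleftrightarrow> (S = R)" for X Y R S :: bool
      using that by blast
    show ?thesis
      unfolding com crosses_coordinates[OF D b a] crosses_coordinates[OF D' sw(2) sw(1)]
        in_triangle_coordinates[OF D a] in_triangle_coordinates[OF D b]
      by (rule sym[OF coordinate_parity_crossing[OF nz'(3,4,1,2) nz5' 2 st(2,1) c'(3) c'(1,2)]])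
  qed
qed

section \<open>Winding parity of closed chains on the sphere\<close>

text \<open>Every point is an end point of an even number of arcs of the chain, counted over all
  predicates \<open>P\<close> at once so that coinciding end points need no separate treatment. The arcs are
  indexed and come in no particular order.\<close>

definition closed_chain :: "'j set \<Rightarrow> ('j \<Rightarrow> real^3) \<Rightarrow> ('j \<Rightarrow> real^3) \<Rightarrow> bool" where
  "closed_chain J a b \<longleftrightarrow> finite J \<and> (\<forall>P. even (\<Sum>j\<in>J. of_bool (P (a j)) + of_bool (P (b j)) :: nat))"

definition winding_parity :: "real^3 \<Rightarrow> 'j set \<Rightarrow> ('j \<Rightarrow> real^3) \<Rightarrow> ('j \<Rightarrow> real^3) \<Rightarrow> real^3 \<Rightarrow> bool" where
  "winding_parity g J a b q \<longleftrightarrow> odd (\<Sum>j\<in>J. of_bool (crosses g q (a j) (b j)) :: nat)"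

text \<open>No two points of \<open>S\<close> lie on a common great circle with \<open>g\<close> unless they are equal or opposite,
  so that all crossings with arcs ending in \<open>g\<close> are proper.\<close>

definition generic :: "real^3 \<Rightarrow> (real^3) set \<Rightarrow> bool" where
  "generic g S \<longleftrightarrow> (\<forall>s\<in>S. \<forall>t\<in>S. cross3 s t \<noteq> 0 \<longrightarrow> det3 s t g \<noteq> 0)"

text \<open>Finitely many planes do not cover the space.\<close>

lemma ex_generic:
  assumes "finite S"
  obtains g where "generic g S"
proof -
  define F where "F = (\<lambda>(s, t). {g. cross3 s t \<bullet> g = 0}) ` {p \<in> S \<times> S. cross3 (fst p) (snd p) \<noteq> 0}"
  have "negligible (\<Union>F)"
  proof (rule negligible_Union)
    show "finite F" unfolding F_def using assms by auto
    show "negligible T" if "T \<in> F" for T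
      using that unfolding F_def by (auto intro!: negligible_hyperplane)
  qed
  then have "\<Union>F \<noteq> UNIV" using non_negligible_UNIV by metis
  then obtain g where g: "g \<notin> \<Union>F" by blast
  have "generic g S" unfolding generic_def
  proof (intro ballI impI)
    fix s t assume *: "s \<in> S" "t \<in> S" "cross3 s t \<noteq> 0"
    then have "{g. cross3 s t \<bullet> g = 0} \<in> F" unfolding F_def by force
    then have "cross3 s t \<bullet> g \<noteq> 0" using g by blast
    then show "det3 s t g \<noteq> 0" by (simp add: det3_def cross3_simps)
  qed
  then show ?thesis using that by blast
qed

text \<open>Summing the triangle parity over the chain, the contributions of the end points cancel
  because the chain is closed.\<close>

lemma winding_parity_change:
  assumes J: "closed_chain J a b"
    and j: "\<And>j. j \<in> J \<Longrightarrow> (crosses g q (a j) (b j) \<noteq> crosses g q' (a j) (b j)) \<longleftrightarrow>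
      ((in_triangle q q' g (a j) \<noteq> in_triangle q q' g (b j)) \<noteq> (j \<in> K))"
  shows "(winding_parity g J a b q \<noteq> winding_parity g J a b q') \<longleftrightarrow> odd (card (J \<inter> K))"
proof -
  have fin: "finite J" using J by (simp add: closed_chain_def)
  define P where "P = in_triangle q q' g"
  have "even (\<Sum>j\<in>J. (of_bool (crosses g q (a j) (b j)) + of_bool (crosses g q' (a j) (b j))
      + (of_bool (P (a j)) + of_bool (P (b j))) + of_bool (j \<in> K)) :: nat)"
  proof (rule dvd_sum)
    fix i assume "i \<in> J"
    from j[OF this, folded P_def]
    show "even (of_bool (crosses g q (a i) (b i)) + of_bool (crosses g q' (a i) (b i))
      + (of_bool (P (a i)) + of_bool (P (b i))) + of_bool (i \<in> K) :: nat)"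
      by (cases "crosses g q (a i) (b i)"; cases "crosses g q' (a i) (b i)"; cases "P (a i)"; cases "P (b i)"; simp)
  qed
  moreover have "even (\<Sum>j\<in>J. of_bool (P (a j)) + of_bool (P (b j)) :: nat)"
    using J unfolding closed_chain_def by blast
  moreover have "(\<Sum>j\<in>J. of_bool (j \<in> K) :: nat) = card (J \<inter> K)"
    using fin by (simp add: sum.If_cases of_bool_def)
  ultimately show ?thesis
    unfolding winding_parity_def by (simp add: sum.distrib)
qed

lemma winding_parity_eq:
  assumes J: "closed_chain J a b"
    and g: "generic g S" "q \<in> S" "q' \<in> S" "\<And>j. j \<in> J \<Longrightarrow> a j \<in> S \<and> b j \<in> S"
    and q: "cross3 q q' \<noteq> 0"
    and ab: "\<And>j. j \<in> J \<Longrightarrow> cross3 (a j) (b j) \<noteq> 0"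
    and aq: "\<And>j. j \<in> J \<Longrightarrow> cross3 (a j) q \<noteq> 0" "\<And>j. j \<in> J \<Longrightarrow> cross3 (a j) q' \<noteq> 0"
    and bq: "\<And>j. j \<in> J \<Longrightarrow> cross3 (b j) q \<noteq> 0" "\<And>j. j \<in> J \<Longrightarrow> cross3 (b j) q' \<noteq> 0"
    and no: "\<And>j. j \<in> J \<Longrightarrow> \<not> arcs_meet q q' (a j) (b j)"
  shows "winding_parity g J a b q = winding_parity g J a b q'"
proof -
  have "(winding_parity g J a b q \<noteq> winding_parity g J a b q') \<longleftrightarrow> odd (card (J \<inter> {}))"
  proof (rule winding_parity_change[OF J])
    fix j assume j: "j \<in> J"
    have "(crosses g q (a j) (b j) \<noteq> crosses g q' (a j) (b j)) \<longleftrightarrow>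
        (in_triangle q q' g (a j) \<noteq> in_triangle q q' g (b j))"
      using g j q ab aq bq no unfolding generic_def by (intro triangle_parity) auto
    then show "(crosses g q (a j) (b j) \<noteq> crosses g q' (a j) (b j)) \<longleftrightarrow>
        ((in_triangle q q' g (a j) \<noteq> in_triangle q q' g (b j)) \<noteq> (j \<in> {}))" by simp
  qed
  then show ?thesis by simp
qed

lemma winding_parity_jump:
  assumes J: "closed_chain J a b"
    and g: "generic g S" "q \<in> S" "q' \<in> S" "\<And>j. j \<in> J \<Longrightarrow> a j \<in> S \<and> b j \<in> S"
    and q: "cross3 q q' \<noteq> 0"
    and ab: "\<And>j. j \<in> J \<Longrightarrow> cross3 (a j) (b j) \<noteq> 0"
    and aq: "\<And>j. j \<in> J \<Longrightarrow> cross3 (a j) q \<noteq> 0" "\<And>j. j \<in> J \<Longrightarrow> cross3 (a j) q' \<noteq> 0"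
    and bq: "\<And>j. j \<in> J \<Longrightarrow> cross3 (b j) q \<noteq> 0" "\<And>j. j \<in> J \<Longrightarrow> cross3 (b j) q' \<noteq> 0"
    and no: "\<And>j. j \<in> J \<Longrightarrow> j \<noteq> i \<Longrightarrow> \<not> arcs_meet q q' (a j) (b j)"
    and i: "det3 q q' (a i) \<noteq> 0" "s > 0" "t > 0" "l > 0" "m > 0" "s *\<^sub>R a i + t *\<^sub>R b i = l *\<^sub>R q + m *\<^sub>R q'"
  shows "(winding_parity g J a b q \<noteq> winding_parity g J a b q') \<longleftrightarrow> i \<in> J"
proof -
  have "(winding_parity g J a b q \<noteq> winding_parity g J a b q') \<longleftrightarrow> odd (card (J \<inter> {i}))"
  proof (rule winding_parity_change[OF J])
    fix j assume j: "j \<in> J"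
    show "(crosses g q (a j) (b j) \<noteq> crosses g q' (a j) (b j)) \<longleftrightarrow>
        ((in_triangle q q' g (a j) \<noteq> in_triangle q q' g (b j)) \<noteq> (j \<in> {i}))"
    proof (cases "j = i")
      case True
      have "(crosses g q (a i) (b i) \<noteq> crosses g q' (a i) (b i)) \<longleftrightarrow>
          (in_triangle q q' g (a i) = in_triangle q q' g (b i))"
        using g j q ab aq bq unfolding generic_def True
        by (intro triangle_parity_crossing[OF _ _ _ _ _ _ i]) auto
      then show ?thesis using True by simp
    next
      case False
      have "(crosses g q (a j) (b j) \<noteq> crosses g q' (a j) (b j)) \<longleftrightarrow>
          (in_triangle q q' g (a j) \<noteq> in_triangle q q' g (b j))"
        using g j q ab aq bq no False unfolding generic_def by (intro triangle_parity) auto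
      then show ?thesis using False by simp
    qed
  qed
  then show ?thesis by (cases "i \<in> J") auto
qed

text \<open>A plane separates \<open>u\<close> from the closed cone over the arc \<open>ab\<close>, and points close to \<open>u\<close> stay on
  the side of \<open>u\<close>.\<close>

lemma eventually_arcs_disjoint:
  assumes no: "\<And>\<alpha> \<beta>. \<alpha> \<ge> 0 \<Longrightarrow> \<beta> \<ge> 0 \<Longrightarrow> \<alpha> *\<^sub>R a + \<beta> *\<^sub>R b \<noteq> u"
    and pt: "\<And>\<alpha> \<beta>. \<alpha> \<ge> 0 \<Longrightarrow> \<beta> \<ge> 0 \<Longrightarrow> \<alpha> + \<beta> > 0 \<Longrightarrow> \<alpha> *\<^sub>R a + \<beta> *\<^sub>R b \<noteq> 0"
  shows "\<forall>\<^sub>F \<epsilon> in at_right 0. \<not> arcs_meet (u + \<epsilon> *\<^sub>R s) (u + \<epsilon> *\<^sub>R t) a b"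
proof -
  let ?C = "convex_cone hull {a, b}"
  define D where "D = {\<alpha> *\<^sub>R a + \<beta> *\<^sub>R b | \<alpha> \<beta>. \<alpha> \<ge> 0 \<and> \<beta> \<ge> 0}"
  have "convex_cone D" unfolding convex_cone_iff
  proof (intro conjI ballI allI impI)
    show "0 \<in> D" unfolding D_def by (auto intro!: exI[of _ 0])
    fix x y assume "x \<in> D" "y \<in> D"
    then obtain \<alpha> \<beta> \<alpha>' \<beta>' where "\<alpha> \<ge> 0" "\<beta> \<ge> 0" "\<alpha>' \<ge> 0" "\<beta>' \<ge> 0"
      "x = \<alpha> *\<^sub>R a + \<beta> *\<^sub>R b" "y = \<alpha>' *\<^sub>R a + \<beta>' *\<^sub>R b" unfolding D_def by blast
    then have "x + y = (\<alpha> + \<alpha>') *\<^sub>R a + (\<beta> + \<beta>') *\<^sub>R b \<and> \<alpha> + \<alpha>' \<ge> 0 \<and> \<beta> + \<beta>' \<ge> 0"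
      by (simp add: algebra_simps)
    then show "x + y \<in> D" unfolding D_def by blast
  next
    fix x and c :: real assume "x \<in> D" "c \<ge> 0"
    then obtain \<alpha> \<beta> where "\<alpha> \<ge> 0" "\<beta> \<ge> 0" "x = \<alpha> *\<^sub>R a + \<beta> *\<^sub>R b" unfolding D_def by blast
    then have "c *\<^sub>R x = (c * \<alpha>) *\<^sub>R a + (c * \<beta>) *\<^sub>R b \<and> c * \<alpha> \<ge> 0 \<and> c * \<beta> \<ge> 0"
      using \<open>c \<ge> 0\<close> by (simp add: algebra_simps)
    then show "c *\<^sub>R x \<in> D" unfolding D_def by blast
  qed
  moreover have "a \<in> D" unfolding D_def by (rule CollectI, rule exI[of _ 1], rule exI[of _ 0]) simp
  moreover have "b \<in> D" unfolding D_def by (rule CollectI, rule exI[of _ 0], rule exI[of _ 1]) simp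
  ultimately have "?C \<subseteq> D" by (simp add: hull_minimal)
  then have u: "u \<notin> ?C" using no unfolding D_def by blast
  obtain k c where k: "k \<bullet> u < c" "\<And>x. x \<in> ?C \<Longrightarrow> k \<bullet> x > c"
    using separating_hyperplane_closed_point[OF convex_convex_cone_hull closed_convex_cone_hull u] by auto
  have "c < 0" using k(2)[OF convex_cone_hull_contains_0] by simp
  then have ku: "k \<bullet> u < 0" using k by simp
  have kC: "k \<bullet> x \<ge> 0" if x: "x \<in> {a, b}" for x
  proof (rule ccontr)
    assume n: "\<not> ?thesis"
    define r where "r = c / (k \<bullet> x)"
    have "r \<ge> 0" using n \<open>c < 0\<close> by (simp add: r_def divide_nonpos_nonpos)
    then have "r *\<^sub>R x \<in> ?C" using x by (intro convex_cone_hull_mul) (auto intro: hull_inc)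
    then have "k \<bullet> (r *\<^sub>R x) > c" using k by blast
    then show False using n by (simp add: r_def)
  qed
  have lim: "((\<lambda>\<epsilon>. k \<bullet> (u + \<epsilon> *\<^sub>R v)) \<longlongrightarrow> k \<bullet> (u + 0 *\<^sub>R v)) (at_right 0)" for v
    by (intro tendsto_intros)
  have ev: "\<forall>\<^sub>F \<epsilon> in at_right 0. k \<bullet> (u + \<epsilon> *\<^sub>R v) < 0" for v
    using order_tendstoD(2)[OF lim[of v], of 0] ku by simp
  from ev[of s] ev[of t] show ?thesis
  proof eventually_elim
    case (elim \<epsilon>)
    show ?case
    proof
      assume "arcs_meet (u + \<epsilon> *\<^sub>R s) (u + \<epsilon> *\<^sub>R t) a b"
      then obtain \<alpha> \<beta> l m where *: "\<alpha> \<ge> 0" "\<beta> \<ge> 0" "l \<ge> 0" "m \<ge> 0" "\<alpha> + \<beta> > 0"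
        "\<alpha> *\<^sub>R a + \<beta> *\<^sub>R b = l *\<^sub>R (u + \<epsilon> *\<^sub>R s) + m *\<^sub>R (u + \<epsilon> *\<^sub>R t)"
        unfolding arcs_meet_def by blast
      have "k \<bullet> (\<alpha> *\<^sub>R a + \<beta> *\<^sub>R b) \<ge> 0"
        using *(1,2) kC[of a] kC[of b] by (simp add: inner_add_right)
      then have ge: "l * (k \<bullet> (u + \<epsilon> *\<^sub>R s)) + m * (k \<bullet> (u + \<epsilon> *\<^sub>R t)) \<ge> 0"
        unfolding *(6) by (simp only: inner_add_right[of k "l *\<^sub>R _"] inner_scaleR_right)
      have l: "l * (k \<bullet> (u + \<epsilon> *\<^sub>R s)) \<le> 0" and m: "m * (k \<bullet> (u + \<epsilon> *\<^sub>R t)) \<le> 0"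
        using elim * by (simp_all add: mult_nonneg_nonpos)
      have "l * (k \<bullet> (u + \<epsilon> *\<^sub>R s)) = 0" "m * (k \<bullet> (u + \<epsilon> *\<^sub>R t)) = 0"
        using ge l m by linarith+
      then have "l = 0" "m = 0" using elim by auto
      then show False using pt[of \<alpha> \<beta>] * by simp
    qed
  qed
qed

lemma eventually_not_parallel:
  assumes "cross3 u v \<noteq> 0" "s \<noteq> 0"
  shows "\<forall>\<^sub>F \<epsilon> in at_right 0. cross3 s (u + \<epsilon> *\<^sub>R v) \<noteq> 0"
proof -
  have eq: "cross3 s (u + \<epsilon> *\<^sub>R v) = cross3 s u + \<epsilon> *\<^sub>R cross3 s v" for \<epsilon>
    by (simp add: cross_add_right cross_mult_right)
  show ?thesis
  proof (cases "cross3 s u = 0")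
    case True
    have "cross3 s v \<noteq> 0"
    proof
      assume "cross3 s v = 0"
      with True have "cross3 s (cross3 u v) = 0 \<and> s \<bullet> cross3 u v = 0"
        using Jacobi[of s u v] cross_triple[of s u v] by (simp add: cross_skew[of v s] inner_commute)
      then have "norm (cross3 s (cross3 u v)) ^ 2 + (s \<bullet> cross3 u v)\<^sup>2 = 0" by simp
      then have "norm s * norm (cross3 u v) = 0" unfolding norm_cross_dot by simp
      then show False using assms by simp
    qed
    then have "cross3 s u + \<epsilon> *\<^sub>R cross3 s v \<noteq> 0" if "0 < \<epsilon>" for \<epsilon> using that True by simp
    then show ?thesis unfolding eq by (rule eventually_mono[OF eventually_at_right_less])
  next
    case False
    have "((\<lambda>\<epsilon>. cross3 s u + \<epsilon> *\<^sub>R cross3 s v) \<longlongrightarrow> cross3 s u + 0 *\<^sub>R cross3 s v) (at_right 0)"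
      by (intro tendsto_intros)
    then have "((\<lambda>\<epsilon>. cross3 s u + \<epsilon> *\<^sub>R cross3 s v) \<longlongrightarrow> cross3 s u) (at_right 0)" by simp
    then show ?thesis unfolding eq using False by (rule tendsto_imp_eventually_ne)
  qed
qed

lemma sum_lessThan_shift:
  fixes f :: "nat \<Rightarrow> nat"
  shows "(\<Sum>k<m + n. f k) = (\<Sum>k<m. f k) + (\<Sum>k<n. f (k + m))"
  by (induction n) (simp_all add: add.commute add.left_commute)

lemma odd_sum_changes:
  fixes p :: "nat \<Rightarrow> bool"
  shows "odd (\<Sum>k<n. of_bool (p k \<noteq> p (Suc k)) :: nat) \<longleftrightarrow> p 0 \<noteq> p n"
proof (induction n)
  case (Suc n)
  have *: "odd (k + of_bool c :: nat) \<longleftrightarrow> (odd k \<noteq> c)" for k :: nat and c by (cases c) simp_all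
  show ?case unfolding sum.lessThan_Suc * Suc.IH by auto
qed simp

text \<open>Turning the crossings seen from \<open>- q\<close> by the antipodal map, the two parities together count
  the arcs met by the half great circle from \<open>g\<close> through \<open>q\<close> to \<open>- g\<close>. The arcs \<open>k\<close> and \<open>k + m\<close>
  are opposite, so this is the number of arcs in the first half of the chain that meet the whole
  great circle through \<open>q\<close> and \<open>g\<close>. It is odd, because the first half leads from \<open>u 0\<close> to its
  antipode.\<close>

lemma antipodal_winding_parity:
  fixes u :: "nat \<Rightarrow> real^3"
  assumes u: "\<And>k. u (k + m) = - u k"
    and g: "\<And>k. det3 q (u k) g \<noteq> 0" "\<And>k. det3 (u k) (u (Suc k)) g \<noteq> 0"
    and no: "\<And>k \<alpha> \<beta>. \<alpha> \<ge> 0 \<Longrightarrow> \<beta> \<ge> 0 \<Longrightarrow> \<alpha> *\<^sub>R u k + \<beta> *\<^sub>R u (Suc k) \<noteq> q"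
  shows "winding_parity g {..<2 * m} u (\<lambda>k. u (Suc k)) q \<noteq> winding_parity g {..<2 * m} u (\<lambda>k. u (Suc k)) (- q)"
proof -
  define thr where "thr p a b \<longleftrightarrow> (\<exists>\<alpha>>0. \<exists>\<beta>>0. \<exists>\<gamma>. \<alpha> *\<^sub>R a + \<beta> *\<^sub>R b = p + \<gamma> *\<^sub>R g)" for p a b
  have thr_iff: "thr p a b \<longleftrightarrow> (det3 a b g > 0 \<and> det3 p b g > 0 \<and> det3 p a g < 0)
      \<or> (det3 a b g < 0 \<and> det3 p b g < 0 \<and> det3 p a g > 0)" (is "_ \<longleftrightarrow> ?r")
    if D: "det3 a b g \<noteq> 0" for p a b
  proof
    assume "thr p a b"
    then obtain \<alpha> \<beta> \<gamma> where *: "\<alpha> > 0" "\<beta> > 0" "\<alpha> *\<^sub>R a + \<beta> *\<^sub>R b = p + \<gamma> *\<^sub>R g" unfolding thr_def by blast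
    then have p: "p = \<alpha> *\<^sub>R a + \<beta> *\<^sub>R b - \<gamma> *\<^sub>R g" by (simp add: algebra_simps)
    then have p: "p = \<alpha> *\<^sub>R a + \<beta> *\<^sub>R b + (-\<gamma>) *\<^sub>R g" by simp
    have "det3 p b g = \<alpha> * det3 a b g" "det3 p a g = - (\<beta> * det3 a b g)"
      unfolding p by (simp_all add: det3_linear det3_swap(1)[of a b] del: scaleR_minus_left)
    then show ?r using * D by (auto simp: zero_less_mult_iff mult_less_0_iff)
  next
    assume r: ?r
    obtain x y z where p: "p = x *\<^sub>R a + y *\<^sub>R b + z *\<^sub>R g"
      and xyz: "x = det3 p b g / det3 a b g" "y = - det3 p a g / det3 a b g"
      using coordinates_exist[OF D] by metis
    have "x > 0" "y > 0" using r unfolding xyz by (auto simp: divide_pos_pos divide_neg_neg divide_neg_pos divide_pos_neg)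
    moreover have "x *\<^sub>R a + y *\<^sub>R b = p + (- z) *\<^sub>R g" unfolding p by simp
    ultimately show "thr p a b" unfolding thr_def by blast
  qed
  define p where "p k \<longleftrightarrow> det3 q (u k) g > 0" for k
  define X where "X k = (of_bool (crosses g q (u k) (u (Suc k))) :: nat)" for k
  define Y where "Y k = (of_bool (crosses (-g) q (u k) (u (Suc k))) :: nat)" for k
  define T where "T k = (of_bool (thr q (u k) (u (Suc k))) :: nat)" for k
  \<comment> \<open>as \<open>q\<close> is not on the arc, the arc meets exactly one of the two quarters, if any\<close>
  have XY: "X k + Y k = T k" for k
  proof -
    have 1: "\<not> (crosses g q (u k) (u (Suc k)) \<and> crosses (-g) q (u k) (u (Suc k)))"
    proof
      assume "crosses g q (u k) (u (Suc k)) \<and> crosses (-g) q (u k) (u (Suc k))"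
      then obtain \<alpha> \<beta> \<gamma> \<alpha>' \<beta>' \<gamma>' where *: "\<gamma> > 0" "\<gamma>' > 0"
        "\<alpha> *\<^sub>R u k + \<beta> *\<^sub>R u (Suc k) = q + \<gamma> *\<^sub>R g" "\<alpha>' *\<^sub>R u k + \<beta>' *\<^sub>R u (Suc k) = q + \<gamma>' *\<^sub>R (- g)"
        unfolding crosses_def by blast
      have "q = \<alpha> *\<^sub>R u k + \<beta> *\<^sub>R u (Suc k) + (- \<gamma>) *\<^sub>R g" "q = \<alpha>' *\<^sub>R u k + \<beta>' *\<^sub>R u (Suc k) + \<gamma>' *\<^sub>R g"
        using *(3,4) by (simp_all add: algebra_simps)
      then have "\<alpha> *\<^sub>R u k + \<beta> *\<^sub>R u (Suc k) + (- \<gamma>) *\<^sub>R g = \<alpha>' *\<^sub>R u k + \<beta>' *\<^sub>R u (Suc k) + \<gamma>' *\<^sub>R g" by metis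
      from coordinates_unique[OF g(2) this] * show False by auto
    qed
    have 2: "thr q (u k) (u (Suc k)) \<longleftrightarrow> crosses g q (u k) (u (Suc k)) \<or> crosses (-g) q (u k) (u (Suc k))"
    proof
      assume "thr q (u k) (u (Suc k))"
      then obtain \<alpha> \<beta> \<gamma> where *: "\<alpha> > 0" "\<beta> > 0" "\<alpha> *\<^sub>R u k + \<beta> *\<^sub>R u (Suc k) = q + \<gamma> *\<^sub>R g" unfolding thr_def by blast
      have "\<gamma> \<noteq> 0" using no[of \<alpha> \<beta> k] * by auto
      then consider "\<gamma> > 0" | "- \<gamma> > 0" by linarith
      then show "crosses g q (u k) (u (Suc k)) \<or> crosses (-g) q (u k) (u (Suc k))"
      proof cases
        case 1
        then show ?thesis using * unfolding crosses_def by blast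
      next
        case 2
        have "\<alpha> *\<^sub>R u k + \<beta> *\<^sub>R u (Suc k) = q + (- \<gamma>) *\<^sub>R (- g)" using * by simp
        then show ?thesis using * 2 unfolding crosses_def by blast
      qed
    next
      assume "crosses g q (u k) (u (Suc k)) \<or> crosses (-g) q (u k) (u (Suc k))"
      then show "thr q (u k) (u (Suc k))" unfolding crosses_def thr_def
        by (metis scaleR_minus_left scaleR_minus_right)
    qed
    show ?thesis using 1 2 by (auto simp: X_def Y_def T_def)
  qed
  have per: "u (Suc (k + m)) = - u (Suc k)" for k using u[of "Suc k"] by simp
  \<comment> \<open>the view from \<open>- q\<close> is the antipode of the view from \<open>q\<close>, shifted by half a period\<close>
  have Yshift: "(of_bool (crosses g (- q) (u k) (u (Suc k))) :: nat) = Y (k + m)" for k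
  proof -
    have "crosses g (- q) a b \<longleftrightarrow> crosses (- g) q (- a) (- b)" for a b
    proof -
      have "\<alpha> *\<^sub>R a + \<beta> *\<^sub>R b = - q + \<gamma> *\<^sub>R g \<longleftrightarrow> \<alpha> *\<^sub>R (- a) + \<beta> *\<^sub>R (- b) = q + \<gamma> *\<^sub>R (- g)" for \<alpha> \<beta> \<gamma>
      proof -
        have "\<alpha> *\<^sub>R (- a) + \<beta> *\<^sub>R (- b) = q + \<gamma> *\<^sub>R (- g) \<longleftrightarrow> - (\<alpha> *\<^sub>R a + \<beta> *\<^sub>R b) = - (- q + \<gamma> *\<^sub>R g)"
          by simp
        then show ?thesis using neg_equal_iff_equal by blast
      qed
      then show ?thesis unfolding crosses_def by simp
    qed
    then show ?thesis unfolding Y_def using u per by simp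
  qed
  have Yper: "Y (k + m + m) = Y k" for k unfolding Y_def using u[of "k + m"] u[of k] per[of "k + m"] per[of k] by simp
  have "(\<Sum>k<m+m. Y (k + m)) = (\<Sum>k<m. Y (k + m)) + (\<Sum>k<m. Y k)"
    unfolding sum_lessThan_shift by (simp add: Yper)
  then have YS: "(\<Sum>k<m+m. Y (k + m)) = (\<Sum>k<m+m. Y k)" unfolding sum_lessThan_shift by simp
  have pair: "even (T k + T (k + m) + of_bool (p k \<noteq> p (Suc k)))" for k
  proof -
    have "thr q (- a) (- b) \<longleftrightarrow> thr (- q) a b" if "det3 a b g \<noteq> 0" for a b
      using that by (simp add: thr_iff)
    then have Tm: "T (k + m) = of_bool (thr (- q) (u k) (u (Suc k)))" unfolding T_def u per using g(2) by simp
    have par: "even (of_bool A + of_bool B + of_bool C :: nat) \<longleftrightarrow> (A \<noteq> B) = C" for A B C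
      by (cases A; cases B; cases C; simp)
    have neg: "x < 0 \<longleftrightarrow> \<not> 0 < x" if "x \<noteq> 0" for x :: real using that by linarith
    show ?thesis
      unfolding Tm unfolding T_def[of k] par thr_iff[OF g(2)] p_def det3_minus neg_less_0_iff_less neg_0_less_iff_less
        neg[OF g(1)] neg[OF g(2)] by argo
  qed
  have "even (\<Sum>k<m. T k + T (k + m) + of_bool (p k \<noteq> p (Suc k)))" by (rule dvd_sum) (rule pair)
  then have "even ((\<Sum>k<m+m. T k) + (\<Sum>k<m. of_bool (p k \<noteq> p (Suc k))))"
    unfolding sum_lessThan_shift by (simp add: sum.distrib)
  moreover have "p 0 \<noteq> p m" unfolding p_def using u[of 0] g(1)[of 0] by auto
  ultimately have "odd (\<Sum>k<m+m. T k)" using odd_sum_changes[where p = p and n = m] by simp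
  then have "odd ((\<Sum>k<m+m. X k) + (\<Sum>k<m+m. Y k))" by (simp add: XY[symmetric] sum.distrib)
  then show ?thesis unfolding winding_parity_def Yshift YS mult_2 X_def[symmetric] by simp
qed

section \<open>Euler's inequality from the cycle space\<close>

lemma card_fibres_le:
  assumes "finite A" "finite B" "f ` A \<subseteq> B" "\<And>b. b \<in> B \<Longrightarrow> card {a \<in> A. f a = b} \<le> m"
  shows "card A \<le> card B * m"
proof -
  have "A = (\<Union>b\<in>B. {a \<in> A. f a = b})" using assms(3) by auto
  then have "card A \<le> (\<Sum>b\<in>B. card {a \<in> A. f a = b})" using card_UN_le[OF assms(2)] by metis
  also have "\<dots> \<le> card B * m" using sum_bounded_above[of B "\<lambda>b. card {a \<in> A. f a = b}" m] assms(4) by simp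
  finally show ?thesis .
qed

lemma even_card_sym_diff:
  assumes "finite A" "finite B"
  shows "even (card (A - B \<union> (B - A))) \<longleftrightarrow> (even (card A) = even (card B))"
proof -
  have 1: "card (A - B \<union> (B - A)) = card (A - B) + card (B - A)"
    using assms by (intro card_Un_disjoint) auto
  have 2: "card A = card (A - B) + card (A \<inter> B)" "card B = card (B - A) + card (A \<inter> B)"
    using assms by (metis add.commute card_Int_Diff Int_commute)+
  show ?thesis unfolding 1 2 by auto
qed

text \<open>The cycle space of the graph over the field with two elements.\<close>

definition even_subgraphs :: "'v set \<Rightarrow> 'e set \<Rightarrow> ('e \<Rightarrow> 'v set) \<Rightarrow> 'e set set" where
  "even_subgraphs V K ends = {z. z \<subseteq> K \<and> (\<forall>v\<in>V. even (card {e \<in> z. v \<in> ends e}))}"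

lemma sum_over_ends:
  fixes f :: "'v \<Rightarrow> nat"
  assumes "finite V" "finite z" "\<And>e. e \<in> z \<Longrightarrow> ends e \<subseteq> V"
  shows "(\<Sum>e\<in>z. \<Sum>v\<in>ends e. f v) = (\<Sum>v\<in>V. card {e \<in> z. v \<in> ends e} * f v)"
proof -
  have "(\<Sum>e\<in>z. \<Sum>v\<in>ends e. f v) = (\<Sum>e\<in>z. \<Sum>v\<in>{v\<in>V. v \<in> ends e}. f v)"
    using assms(3) by (intro sum.cong refl) auto
  also have "\<dots> = (\<Sum>v\<in>V. \<Sum>e\<in>{e\<in>z. v \<in> ends e}. f v)"
    by (rule sum.swap_restrict[OF assms(2,1)])
  finally show ?thesis by simp
qed

text \<open>Assign to every set of edges its set of vertices of odd degree. By the handshake lemma one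
  vertex can be left out of account, so there are at most \<open>2 ^ (card V - 1)\<close> values, and sets with
  equal values differ by an even subgraph.\<close>

lemma card_even_subgraphs_ge:
  assumes V: "finite V" "V \<noteq> {}" and K: "finite K"
    and ends: "\<And>e. e \<in> K \<Longrightarrow> ends e \<subseteq> V \<and> card (ends e) = 2"
  shows "2 ^ card K \<le> 2 ^ (card V - 1) * card (even_subgraphs V K ends)"
proof -
  define deg where "deg z v = card {e \<in> z. v \<in> ends e}" for z v
  obtain v0 where v0: "v0 \<in> V" using V by blast
  define f where "f z = {v \<in> V - {v0}. odd (deg z v)}" for z
  have fin: "finite z" if "z \<subseteq> K" for z using that K finite_subset by blast
  have handshake: "even (\<Sum>v\<in>V. deg z v)" if z: "z \<subseteq> K" for z
  proof -
    have "ends e \<subseteq> V" if "e \<in> z" for e using that z ends by blast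
    then have "(\<Sum>v\<in>V. deg z v) = (\<Sum>e\<in>z. \<Sum>v\<in>ends e. 1)"
      using sum_over_ends[OF V(1) fin[OF z], of ends "\<lambda>_. 1"] by (simp add: deg_def)
    also have "\<dots> = (\<Sum>e\<in>z. 2)" using ends z by (intro sum.cong) auto
    finally show ?thesis by simp
  qed
  have parity: "deg z v0 + (\<Sum>v\<in>V - {v0}. deg z v) = (\<Sum>v\<in>V. deg z v)" for z
    using V v0 by (simp add: sum.remove[of V v0])
  have sd: "even (deg (z - y \<union> (y - z)) v) \<longleftrightarrow> (even (deg z v) = even (deg y v))" if "z \<subseteq> K" "y \<subseteq> K" for z y v
  proof -
    have "{e \<in> z - y \<union> (y - z). v \<in> ends e} = {e \<in> z. v \<in> ends e} - {e \<in> y. v \<in> ends e} \<union> ({e \<in> y. v \<in> ends e} - {e \<in> z. v \<in> ends e})"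
      by auto
    then show ?thesis unfolding deg_def using even_card_sym_diff fin that by (metis (no_types, lifting) finite_subset mem_Collect_eq subsetI)
  qed
  have "card (Pow K) \<le> card (Pow (V - {v0})) * card (even_subgraphs V K ends)"
  proof (rule card_fibres_le[where f = f])
    show "f ` Pow K \<subseteq> Pow (V - {v0})" unfolding f_def by auto
    fix B
    show "card {z \<in> Pow K. f z = B} \<le> card (even_subgraphs V K ends)"
    proof (cases "{z \<in> Pow K. f z = B} = {}")
      case False
      then obtain y where y: "y \<subseteq> K" "f y = B" by auto
      show ?thesis
      proof (rule card_inj_on_le[where f = "\<lambda>z. z - y \<union> (y - z)"])
        show "inj_on (\<lambda>z. z - y \<union> (y - z)) {z \<in> Pow K. f z = B}"
          by (rule inj_onI) blast
        show "finite (even_subgraphs V K ends)"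
          using K by (auto simp: even_subgraphs_def intro: finite_subset[of _ "Pow K"])
        show "(\<lambda>z. z - y \<union> (y - z)) ` {z \<in> Pow K. f z = B} \<subseteq> even_subgraphs V K ends"
        proof clarify
          fix z assume z: "z \<subseteq> K" "B = f z"
          define x where "x = z - y \<union> (y - z)"
          have x: "x \<subseteq> K" using z y by (auto simp: x_def)
          have ev: "even (deg x v)" if "v \<in> V - {v0}" for v
          proof -
            have "v \<in> f z \<longleftrightarrow> v \<in> f y" using y z by simp
            then have "even (deg z v) = even (deg y v)" using that unfolding f_def by simp
            then show ?thesis unfolding x_def sd[OF z(1) y(1)] .
          qed
          have "even (\<Sum>v\<in>V - {v0}. deg x v)" using ev by (intro dvd_sum) auto
          then have "even (deg x v0)" using handshake[OF x] parity[of x] by (metis even_add)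
          then have "\<forall>v\<in>V. even (deg x v)" using ev by blast
          then show "z - y \<union> (y - z) \<in> even_subgraphs V K ends"
            using x unfolding even_subgraphs_def deg_def x_def by blast
        qed
      qed
    next
      case True
      show ?thesis unfolding True by simp
    qed
  qed (use V K in auto)
  then show ?thesis using V v0 K by (simp add: card_Pow)
qed

text \<open>A slot \<open>(v, e, b)\<close> stands for the corner \<open>e\<close> of the polygon \<open>v\<close> together with one of its two
  sides, seen from outside the polygon, and \<open>val z\<close> is the winding parity of the even subgraph \<open>z\<close>
  there. Slots with the same values for all \<open>z\<close> make up the faces: moving along a side of a
  polygon (\<open>side\<close>) or stepping over to the other polygon at a contact (\<open>across\<close>) stays in the
  face, and \<open>jump\<close> recovers \<open>z\<close> from its values.

  Each class has at least eight slots, namely two at each of four distinct contacts; this is where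
  the graph being bipartite excludes triangular faces. Since there are \<open>4 * card K\<close> slots, there
  are at most \<open>card K / 2\<close> classes. An even subgraph and a Boolean (the value at infinity) give
  different sets of classes, whence \<open>2 * card Z \<le> 2 ^ card Q\<close>.\<close>

lemma euler_bound:
  fixes val :: "'e set \<Rightarrow> 'v \<times> 'e \<times> bool \<Rightarrow> bool" and ends :: "'e \<Rightarrow> 'v set"
  assumes V: "finite V" and K: "finite K" "K \<noteq> {}"
    and ends: "\<And>e. e \<in> K \<Longrightarrow> ends e \<subseteq> V \<and> card (ends e) = 2"
    and simple: "\<And>e e' u v. e \<in> K \<Longrightarrow> e' \<in> K \<Longrightarrow> u \<noteq> v \<Longrightarrow> u \<in> ends e \<Longrightarrow> v \<in> ends e \<Longrightarrow> u \<in> ends e' \<Longrightarrow> v \<in> ends e' \<Longrightarrow> e = e'"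
    and bip: "\<And>e u v. e \<in> K \<Longrightarrow> u \<noteq> v \<Longrightarrow> u \<in> ends e \<Longrightarrow> v \<in> ends e \<Longrightarrow> col u \<noteq> (col v :: bool)"
    and side: "\<And>v e b. e \<in> K \<Longrightarrow> v \<in> ends e \<Longrightarrow>
      \<exists>e'\<in>K. v \<in> ends e' \<and> e' \<noteq> e \<and> (\<forall>z\<in>even_subgraphs V K ends. val z (v, e, b) = val z (v, e', \<not> b))"
    and across: "\<And>u v e b z. e \<in> K \<Longrightarrow> u \<noteq> v \<Longrightarrow> u \<in> ends e \<Longrightarrow> v \<in> ends e \<Longrightarrow> z \<in> even_subgraphs V K ends \<Longrightarrow>
      val z (v, e, b) = val z (u, e, \<not> b)"
    and jump: "\<And>v e z. e \<in> K \<Longrightarrow> v \<in> ends e \<Longrightarrow> z \<in> even_subgraphs V K ends \<Longrightarrow>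
      val z (v, e, True) \<noteq> val z (v, e, False) \<longleftrightarrow> e \<in> z"
  shows "card K + 4 \<le> 2 * card V"
proof -
  define Z where "Z = even_subgraphs V K ends"
  define S where "S = {(v, e, b :: bool). e \<in> K \<and> v \<in> ends e}"
  have finE: "finite (ends e)" if "e \<in> K" for e using ends[OF that] V finite_subset by blast
  have S_eq: "S = (\<lambda>((e, v), b). (v, e, b)) ` ((SIGMA e:K. ends e) \<times> UNIV)" unfolding S_def by force
  have inj: "inj_on (\<lambda>((e, v), b). (v, e, b)) ((SIGMA e:K. ends e) \<times> (UNIV :: bool set))" by (auto intro!: inj_onI)
  have finS: "finite S" unfolding S_eq using K finE by auto
  have cardS: "card S = 4 * card K"
  proof -
    have "card (SIGMA e:K. ends e) = (\<Sum>e\<in>K. 2)" using K finE ends by simp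
    then show ?thesis unfolding S_eq card_image[OF inj] by (simp add: card_cartesian_product)
  qed
  define r where "r = {(s, t). s \<in> S \<and> t \<in> S \<and> (\<forall>z\<in>Z. val z s = val z t)}"
  have r: "equiv S r" unfolding r_def by (auto intro!: equivI refl_onI symI transI)
  define Q where "Q = S // r"
  have finQ: "finite Q" unfolding Q_def using finS by (rule finite_quotient) (auto simp: r_def)
  have class_ge: "card c \<ge> 8" if c: "c \<in> Q" for c
  proof -
    obtain s where s: "s \<in> S" "c = r `` {s}" using c unfolding Q_def by (rule quotientE)
    obtain v e b where veb: "s = (v, e, b)" "e \<in> K" "v \<in> ends e" using s unfolding S_def by blast
    have other: "\<exists>u. u \<noteq> v \<and> u \<in> ends e" if "e \<in> K" "v \<in> ends e" for v e
    proof -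
      have "ends e \<noteq> {v}" using ends[OF that(1)] by auto
      then show ?thesis using that by blast
    qed
    obtain u where u: "u \<noteq> v" "u \<in> ends e" using other veb by blast
    obtain e' where e': "e' \<in> K" "v \<in> ends e'" "e' \<noteq> e" "\<forall>z\<in>Z. val z (v, e, b) = val z (v, e', \<not> b)"
      using side[OF veb(2,3)] unfolding Z_def by blast
    obtain v1 where v1: "v1 \<noteq> v" "v1 \<in> ends e'" using other e' by blast
    obtain e2 where e2: "e2 \<in> K" "u \<in> ends e2" "e2 \<noteq> e" "\<forall>z\<in>Z. val z (u, e, \<not> b) = val z (u, e2, b)"
      using side[OF veb(2) u(2), of "\<not> b"] unfolding Z_def by auto
    obtain v2 where v2: "v2 \<noteq> u" "v2 \<in> ends e2" using other e2 by blast
    obtain e3 where e3: "e3 \<in> K" "v1 \<in> ends e3" "e3 \<noteq> e'" "\<forall>z\<in>Z. val z (v1, e', b) = val z (v1, e3, \<not> b)"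
      using side[OF e'(1) v1(2), of b] unfolding Z_def by auto
    obtain v3 where v3: "v3 \<noteq> v1" "v3 \<in> ends e3" using other e3 by blast
    have a0: "\<forall>z\<in>Z. val z (v, e, b) = val z (u, e, \<not> b)"
      using across[OF veb(2) u(1) u(2) veb(3)] unfolding Z_def by blast
    have a1: "\<forall>z\<in>Z. val z (v, e', \<not> b) = val z (v1, e', b)"
      using across[OF e'(1) v1(1) v1(2) e'(2), of _ "\<not> b"] unfolding Z_def by simp
    have a2: "\<forall>z\<in>Z. val z (u, e2, b) = val z (v2, e2, \<not> b)"
      using across[OF e2(1) v2(1) v2(2) e2(2), of _ b] unfolding Z_def by simp
    have a3: "\<forall>z\<in>Z. val z (v1, e3, \<not> b) = val z (v3, e3, b)"
      using across[OF e3(1) v3(1) v3(2) e3(2), of _ "\<not> b"] unfolding Z_def by simp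
    have col: "col u \<noteq> col v" "col v1 \<noteq> col v"
      using bip[OF veb(2) u(1) u(2) veb(3)] bip[OF e'(1) v1(1) v1(2) e'(2)] by auto
    have uv1: "u \<noteq> v1"
      using simple[OF veb(2) e'(1) u(1) u(2) veb(3) _ e'(2)] v1 e'(3) by auto
    have d1: "e' \<noteq> e2" using simple[OF veb(2) e'(1) u(1) u(2) veb(3) _ e'(2)] e2 e'(3) by blast
    have d2: "e3 \<noteq> e"
    proof
      assume "e3 = e"
      then have "v1 \<in> ends e" using e3 by simp
      then show False using simple[OF veb(2) e'(1) v1(1) _ veb(3) v1(2) e'(2)] e'(3) by blast
    qed
    have d3: "e3 \<noteq> e2"
    proof
      assume "e3 = e2"
      then have "v1 \<in> ends e2" using e3 by simp
      then have "col u \<noteq> col v1" using bip[OF e2(1) uv1 e2(2)] by blast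
      then show False using col by blast
    qed
    \<comment> \<open>two slots at each of the four contacts \<open>e\<close>, \<open>e'\<close>, \<open>e2\<close>, \<open>e3\<close> met along the face\<close>
    let ?A = "{(v, e, b), (u, e, \<not> b), (v, e', \<not> b), (v1, e', b), (u, e2, b), (v2, e2, \<not> b), (v1, e3, \<not> b), (v3, e3, b)}"
    have "card ?A = 8"
      using u(1) v1(1) v2(1) v3(1) e'(3) e2(3) e3(3) d1 d2 d3 by simp
    moreover have "?A \<subseteq> c"
      unfolding s veb r_def S_def
      using veb u e' v1 e2 v2 e3 v3 a0 a1 a2 a3 by auto
    moreover have "finite c" using c finS unfolding Q_def by (metis Q_def equiv_type finite_equiv_class r)
    ultimately show ?thesis by (metis card_mono)
  qed
  have "8 * card Q \<le> (\<Sum>c\<in>Q. card c)"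
    using sum_bounded_below[of Q 8 card] class_ge by simp
  also have "\<dots> = card (\<Union>Q)"
    unfolding Q_def using quotient_disj[OF r] finite_equiv_class[OF finS equiv_type[OF r]]
    by (intro card_Union_disjoint[symmetric]) (auto simp: pairwise_def disjnt_def)
  also have "\<Union>Q = S" unfolding Q_def using Union_quotient[OF r] .
  finally have Q: "2 * card Q \<le> card K" unfolding cardS by simp
  have "card (Z \<times> (UNIV :: bool set)) \<le> card (Pow Q)"
  proof (rule card_inj_on_le[where f = "\<lambda>(z, b). {c \<in> Q. \<forall>s\<in>c. val z s = b}"])
    show "inj_on (\<lambda>(z, b). {c \<in> Q. \<forall>s\<in>c. val z s = b}) (Z \<times> (UNIV :: bool set))"
    proof (rule inj_onI, clarify)
      fix z b z' b'
      assume z: "z \<in> Z" "z' \<in> Z" and eq: "{c \<in> Q. \<forall>s\<in>c. val z s = b} = {c \<in> Q. \<forall>s\<in>c. val z' s = b'}"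
      have cl: "(\<forall>t\<in>r `` {s}. val y t = d) \<longleftrightarrow> val y s = d" if "s \<in> S" "y \<in> Z" for s y d
      proof -
        have "s \<in> r `` {s}" using that unfolding r_def by blast
        moreover have "val y t = val y s" if "t \<in> r `` {s}" for t using that \<open>y \<in> Z\<close> unfolding r_def by blast
        ultimately show ?thesis by blast
      qed
      have v: "val z s = b \<longleftrightarrow> val z' s = b'" if s: "s \<in> S" for s
      proof -
        have "r `` {s} \<in> Q" unfolding Q_def using s by (rule quotientI)
        moreover have "r `` {s} \<in> {c \<in> Q. \<forall>s\<in>c. val z s = b} \<longleftrightarrow> r `` {s} \<in> {c \<in> Q. \<forall>s\<in>c. val z' s = b'}"
          unfolding eq ..
        ultimately show ?thesis unfolding mem_Collect_eq cl[OF s z(1)] cl[OF s z(2)] by argo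
      qed
      have mem: "e \<in> z \<longleftrightarrow> e \<in> z'" if e: "e \<in> K" for e
      proof -
        have "ends e \<noteq> {}" using ends[OF e] by auto
        then obtain v where ve: "v \<in> ends e" by blast
        have "(v, e, True) \<in> S" "(v, e, False) \<in> S" using e ve by (auto simp: S_def)
        from this[THEN v] jump[OF e ve z(1)[unfolded Z_def]] jump[OF e ve z(2)[unfolded Z_def]]
        show ?thesis by blast
      qed
      have "z \<subseteq> K" "z' \<subseteq> K" using z unfolding Z_def even_subgraphs_def by auto
      then have zz: "z = z'" using mem by blast
      obtain e where e: "e \<in> K" using K by blast
      have "ends e \<noteq> {}" using ends[OF e] by auto
      then obtain u where "u \<in> ends e" by blast
      then have "(u, e, True) \<in> S" using e by (auto simp: S_def)
      from v[OF this] zz have "b = b'" by blast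
      with zz show "z = z' \<and> b = b'" by simp
    qed
  qed (use finQ in auto)
  then have c2: "2 * card Z \<le> 2 ^ card Q" using finQ by (simp add: card_cartesian_product card_Pow mult.commute)
  obtain e where "e \<in> K" using K by blast
  then have "card (ends e) = 2" "ends e \<subseteq> V" using ends by auto
  then have "V \<noteq> {}" and V1: "card V \<ge> 1" using V card_mono[of V "ends e"] by auto
  have "2 ^ card K * 2 \<le> 2 ^ (card V - 1) * card Z * (2::nat)"
    using card_even_subgraphs_ge[OF V \<open>V \<noteq> {}\<close> K(1) ends] unfolding Z_def by simp
  also have "\<dots> \<le> 2 ^ (card V - 1) * 2 ^ card Q" using c2 by simp
  finally have "2 ^ (card K + 1) \<le> (2 :: nat) ^ (card V - 1 + card Q)" by (simp add: power_add mult.commute)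
  from power_le_imp_le_exp[OF _ this] have "card K + 1 \<le> card V - 1 + card Q" by simp
  then show ?thesis using Q V1 by linarith
qed

section \<open>Convex polygons touching in corners\<close>

text \<open>Applied to the angular order of the other corners of a polygon as seen from one corner.\<close>

lemma finite_has_first:
  assumes "finite M" "M \<noteq> {}"
    and total: "\<And>a b. a \<in> M \<Longrightarrow> b \<in> M \<Longrightarrow> a \<noteq> b \<Longrightarrow> R a b \<or> R b a"
    and trans: "\<And>a b c. a \<in> M \<Longrightarrow> b \<in> M \<Longrightarrow> c \<in> M \<Longrightarrow> a \<noteq> c \<Longrightarrow> R a b \<Longrightarrow> R b c \<Longrightarrow> R a c"
  shows "\<exists>a\<in>M. \<forall>b\<in>M. b \<noteq> a \<longrightarrow> R a b"
  using assms(1,2) total trans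
proof (induction M rule: finite_ne_induct)
  case (singleton x)
  show ?case by simp
next
  case (insert x F)
  have "\<exists>a\<in>F. \<forall>b\<in>F. b \<noteq> a \<longrightarrow> R a b"
  proof (rule insert.IH)
    show "R a b \<or> R b a" if "a \<in> F" "b \<in> F" "a \<noteq> b" for a b
      by (rule insert.prems(1)) (use that in auto)
    show "R a c" if "a \<in> F" "b \<in> F" "c \<in> F" "a \<noteq> c" "R a b" "R b c" for a b c
      by (rule insert.prems(2)[of a b c]) (use that in auto)
  qed
  then obtain a where a: "a \<in> F" "\<forall>b\<in>F. b \<noteq> a \<longrightarrow> R a b" by blast
  have xa: "x \<noteq> a" using a insert by blast
  show ?case
  proof (cases "R x a")
    case True
    have "R x b" if "b \<in> F" for b
    proof (cases "b = a")
      case False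
      then show ?thesis using insert.prems(2)[of x a b] True a that insert.hyps by auto
    qed (use True in simp)
    then show ?thesis by blast
  next
    case False
    then have "R a x" using insert.prems(1)[of x a] a xa by auto
    then show ?thesis using a by blast
  qed
qed

text \<open>Convex polygons on the sphere, possibly degenerate to arcs, given by their corners, the
  contacts. Each contact is a corner of exactly two polygons; corners are extreme (\<open>extreme\<close>,
  which for \<open>l = 0\<close> also says that the cell contains no line), and polygons meet only in common
  corners. The polygons are the vertices of a plane graph whose edges are the contacts.\<close>
locale touching_cells =
  fixes V :: "'v set" and K :: "'e set" and ends :: "'e \<Rightarrow> 'v set" and w :: "'e \<Rightarrow> real^3"
  assumes finite_V: "finite V" and finite_K: "finite K"
    and ends: "e \<in> K \<Longrightarrow> ends e \<subseteq> V \<and> card (ends e) = 2"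
    and simple: "e \<in> K \<Longrightarrow> e' \<in> K \<Longrightarrow> u \<noteq> v \<Longrightarrow> u \<in> ends e \<Longrightarrow> v \<in> ends e \<Longrightarrow> u \<in> ends e' \<Longrightarrow> v \<in> ends e' \<Longrightarrow> e = e'"
    and nonzero: "e \<in> K \<Longrightarrow> w e \<noteq> 0"
    and extreme: "e \<in> K \<Longrightarrow> v \<in> ends e \<Longrightarrow> (\<And>f. c f \<ge> (0 :: real)) \<Longrightarrow>
      (\<Sum>f\<in>{f \<in> K. v \<in> ends f}. c f *\<^sub>R w f) = l *\<^sub>R w e \<Longrightarrow> f \<in> K \<Longrightarrow> v \<in> ends f \<Longrightarrow> f \<noteq> e \<Longrightarrow> c f = 0"
    and touching: "u \<in> V \<Longrightarrow> v \<in> V \<Longrightarrow> u \<noteq> v \<Longrightarrow> (\<And>f. c f \<ge> (0 :: real)) \<Longrightarrow> (\<And>f. d f \<ge> (0 :: real)) \<Longrightarrow>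
      (\<Sum>f\<in>{f \<in> K. u \<in> ends f}. c f *\<^sub>R w f) = p \<Longrightarrow> (\<Sum>f\<in>{f \<in> K. v \<in> ends f}. d f *\<^sub>R w f) = p \<Longrightarrow> p \<noteq> 0 \<Longrightarrow>
      \<exists>e\<in>K. u \<in> ends e \<and> v \<in> ends e \<and> (\<exists>l. p = l *\<^sub>R w e)"
begin

definition star :: "'v \<Rightarrow> 'e set" where
  "star v = {e \<in> K. v \<in> ends e}"

definition cell :: "'v \<Rightarrow> (real^3) set" where
  "cell v = {\<Sum>e\<in>star v. c e *\<^sub>R w e | c. \<forall>e. c e \<ge> 0}"

lemma star_iff: "e \<in> star v \<longleftrightarrow> e \<in> K \<and> v \<in> ends e"
  by (simp add: star_def)

lemma finite_star [simp]: "finite (star v)"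
  using finite_K by (simp add: star_def)

lemma star_in_V: "e \<in> star v \<Longrightarrow> v \<in> V"
  using ends by (auto simp: star_iff)

lemma cellI: "(\<And>e. c e \<ge> 0) \<Longrightarrow> (\<Sum>e\<in>star v. c e *\<^sub>R w e) \<in> cell v"
  unfolding cell_def by blast

lemma zero_in_cell [simp]: "0 \<in> cell v"
  using cellI[of "\<lambda>_. 0" v] by simp

lemma cell_add:
  assumes "x \<in> cell v" "y \<in> cell v"
  shows "x + y \<in> cell v"
proof -
  obtain c d where "\<forall>e. c e \<ge> 0" "\<forall>e. d e \<ge> 0" "x = (\<Sum>e\<in>star v. c e *\<^sub>R w e)" "y = (\<Sum>e\<in>star v. d e *\<^sub>R w e)"
    using assms unfolding cell_def by blast
  then have "x + y = (\<Sum>e\<in>star v. (c e + d e) *\<^sub>R w e)" "\<And>e. c e + d e \<ge> 0"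
    by (simp_all add: scaleR_add_left sum.distrib)
  then show ?thesis using cellI by metis
qed

lemma cell_scale:
  assumes "x \<in> cell v" "k \<ge> 0"
  shows "k *\<^sub>R x \<in> cell v"
proof -
  obtain c where "\<forall>e. c e \<ge> 0" "x = (\<Sum>e\<in>star v. c e *\<^sub>R w e)"
    using assms unfolding cell_def by blast
  then have "k *\<^sub>R x = (\<Sum>e\<in>star v. (k * c e) *\<^sub>R w e)" "\<And>e. k * c e \<ge> 0"
    using assms by (simp_all add: scaleR_sum_right)
  then show ?thesis using cellI by metis
qed

lemma contact_in_cell:
  assumes "e \<in> star v"
  shows "w e \<in> cell v"
proof -
  have "(\<Sum>f\<in>star v. (if f = e then 1 else 0) *\<^sub>R w f) = (\<Sum>f\<in>star v. if f = e then w f else 0)"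
    by (intro sum.cong) auto
  then have "(\<Sum>f\<in>star v. (if f = e then 1 else 0) *\<^sub>R w f) = w e"
    using assms by simp
  then show ?thesis using cellI[of "\<lambda>f. if f = e then 1 else 0" v] by simp
qed

text \<open>The form in which extremality is used: a point of the cell with a positive share of another
  generator is on no extreme ray, not even on its negative.\<close>

lemma not_on_ray:
  assumes e: "e \<in> star v" and f: "f \<in> star v" "f \<noteq> e" and x: "x \<in> cell v" and k: "k > 0"
  shows "x + k *\<^sub>R w f \<noteq> l *\<^sub>R w e"
proof
  assume eq: "x + k *\<^sub>R w f = l *\<^sub>R w e"
  obtain c where c: "\<forall>e. c e \<ge> 0" "x = (\<Sum>e\<in>star v. c e *\<^sub>R w e)" using x unfolding cell_def by blast
  define d where "d i = c i + (if i = f then k else 0)" for i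
  have "(\<Sum>i\<in>star v. (if i = f then k else 0) *\<^sub>R w i) = (\<Sum>i\<in>star v. if i = f then k *\<^sub>R w i else 0)"
    by (intro sum.cong) auto
  then have "(\<Sum>i\<in>star v. (if i = f then k else 0) *\<^sub>R w i) = k *\<^sub>R w f" using f by simp
  then have "(\<Sum>i\<in>star v. d i *\<^sub>R w i) = l *\<^sub>R w e"
    unfolding eq[symmetric] c(2) d_def by (simp add: scaleR_add_left sum.distrib)
  moreover have d0: "d i \<ge> 0" for i using c k by (simp add: d_def)
  ultimately have "d f = 0"
    using extreme[of e v d l f] e f unfolding star_def by auto
  then show False using c(1) k by (simp add: d_def add_nonneg_eq_0_iff)
qed

lemma cells_touch:
  assumes "p \<in> cell u" "p \<in> cell v" "u \<in> V" "v \<in> V" "u \<noteq> v" "p \<noteq> 0"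
  obtains e l where "e \<in> star u" "e \<in> star v" "p = l *\<^sub>R w e"
proof -
  obtain c d where "\<forall>e. c e \<ge> 0" "\<forall>e. d e \<ge> 0" "p = (\<Sum>e\<in>star u. c e *\<^sub>R w e)" "p = (\<Sum>e\<in>star v. d e *\<^sub>R w e)"
    using assms unfolding cell_def by blast
  then show ?thesis using touching[OF assms(3-5), of c d p] assms(6) that by (auto simp: star_def)
qed

text \<open>Parallel generators would put one of them on the ray, or the opposite ray, of the other.\<close>

lemma star_not_parallel:
  assumes "e \<in> star v" "f \<in> star v" "f \<noteq> e"
  shows "cross3 (w e) (w f) \<noteq> 0"
proof
  assume z: "cross3 (w e) (w f) = 0"
  have "cross3 (w e) (cross3 (w e) (w f)) = (w e \<bullet> w f) *\<^sub>R w e - (w e \<bullet> w e) *\<^sub>R w f" by (rule Lagrange)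
  then have "0 + (w e \<bullet> w e) *\<^sub>R w f = (w e \<bullet> w f) *\<^sub>R w e" unfolding z by (simp add: algebra_simps)
  then show False using not_on_ray[OF assms zero_in_cell, of "w e \<bullet> w e"] nonzero assms by (auto simp: star_iff)
qed

text \<open>A linear dependence among three generators, with its terms sorted by sign, puts a combination
  with a positive share of one of them on the line of another.\<close>

lemma star_independent:
  assumes abc: "a \<in> star v" "b \<in> star v" "c \<in> star v" "a \<noteq> b" "b \<noteq> c" "a \<noteq> c"
  shows "det3 (w a) (w b) (w c) \<noteq> 0"
proof
  assume z: "det3 (w a) (w b) (w c) = 0"
  define n where "n = cross3 (w a) (w b)"
  define A where "A = cross3 (w c) (w b) \<bullet> n"
  define B where "B = cross3 (w a) (w c) \<bullet> n"
  have "n \<noteq> 0" unfolding n_def using star_not_parallel abc by blast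
  then have N: "n \<bullet> n > 0" by simp
  \<comment> \<open>the coordinates of \<open>w c\<close> with respect to \<open>w a\<close>, \<open>w b\<close> and their normal vector \<open>n\<close>\<close>
  have "(n \<bullet> n) *\<^sub>R w c = A *\<^sub>R w a + B *\<^sub>R w b + det3 (w a) (w b) (w c) *\<^sub>R n"
    unfolding A_def B_def n_def
    by (simp add: vec_eq_iff forall_3 det3_expand inner_vec_def sum_3 cross_components algebra_simps)
  then have eq: "(n \<bullet> n) *\<^sub>R w c = A *\<^sub>R w a + B *\<^sub>R w b" using z by simp
  note ca = contact_in_cell[OF abc(1)] and cb = contact_in_cell[OF abc(2)] and cc = contact_in_cell[OF abc(3)]
  consider "A \<le> 0" | "B \<le> 0" | "A > 0" "B > 0" by linarith
  then show False
  proof cases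
    case 1
    then have "(- A) *\<^sub>R w a \<in> cell v" by (intro cell_scale ca) simp
    from not_on_ray[OF abc(2,3) abc(5)[symmetric] this N, of B] show False using eq by simp
  next
    case 2
    then have "(- B) *\<^sub>R w b \<in> cell v" by (intro cell_scale cb) simp
    from not_on_ray[OF abc(1,3) abc(6)[symmetric] this N, of A] show False using eq by simp
  next
    case 3
    then have "A *\<^sub>R w a \<in> cell v" by (intro cell_scale ca) simp
    from not_on_ray[OF abc(3,2) abc(5) this 3(2)] show False using eq by metis
  qed
qed

text \<open>Any interior point would do as the place of the vertex in the drawing; the edges of the
  drawing are the spokes from the centres of two cells to their common contact.\<close>

definition centre :: "'v \<Rightarrow> real^3" where
  "centre v = (\<Sum>e\<in>star v. w e)"

lemma centre_split:
  assumes "e \<in> star v"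
  obtains x where "x \<in> cell v" "centre v = x + 1 *\<^sub>R w e"
proof -
  have "(\<Sum>f\<in>star v - {e}. w f) = (\<Sum>f\<in>star v. (if f = e then 0 else 1) *\<^sub>R w f)"
    by (simp add: sum.remove[OF finite_star assms])
  then have "(\<Sum>f\<in>star v - {e}. w f) \<in> cell v" using cellI[of "\<lambda>f. if f = e then 0 else 1" v] by simp
  moreover have "centre v = (\<Sum>f\<in>star v - {e}. w f) + 1 *\<^sub>R w e"
    unfolding centre_def by (simp add: sum.remove[OF finite_star assms] add.commute)
  ultimately show ?thesis using that by blast
qed

lemma centre_in_cell: "centre v \<in> cell v"
  using cellI[of "\<lambda>_. 1" v] by (simp add: centre_def)

end

locale touching_cells_deg3 = touching_cells V K ends w
  for V :: "'v set" and K :: "'e set" and ends :: "'e \<Rightarrow> 'v set" and w :: "'e \<Rightarrow> real^3" +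
  assumes deg3: "v \<in> V \<Longrightarrow> card {e \<in> K. v \<in> ends e} \<ge> 3"
begin

lemma other_in_star:
  assumes "v \<in> V"
  obtains g where "g \<in> star v" "g \<noteq> e" "g \<noteq> f"
proof -
  have "\<not> star v \<subseteq> {e, f}"
  proof
    assume "star v \<subseteq> {e, f}"
    then have "card (star v) \<le> card {e, f}" by (intro card_mono) auto
    also have "\<dots> \<le> 2" by (simp add: card_insert_if)
    finally show False using deg3[OF assms] unfolding star_def by simp
  qed
  then show ?thesis using that by blast
qed

lemma spoke_on_ray:
  assumes f: "f \<in> star v" and e: "e \<in> star v" and ab: "\<alpha> \<ge> 0" "\<beta> \<ge> 0" "\<alpha> + \<beta> > 0"
    and eq: "\<alpha> *\<^sub>R centre v + \<beta> *\<^sub>R w f = l *\<^sub>R w e"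
  shows "\<alpha> = 0 \<and> f = e"
proof -
  have a0: "\<alpha> = 0"
  proof (rule ccontr)
    assume "\<alpha> \<noteq> 0"
    then have a: "\<alpha> > 0" using ab by simp
    obtain g where g: "g \<in> star v" "g \<noteq> e" using other_in_star[OF star_in_V[OF e]] by metis
    obtain x where x: "x \<in> cell v" "centre v = x + 1 *\<^sub>R w g" using centre_split[OF g(1)] by blast
    have "\<alpha> *\<^sub>R x + \<beta> *\<^sub>R w f \<in> cell v" using x f ab by (intro cell_add cell_scale contact_in_cell)
    from not_on_ray[OF e g this a, of l] show False
      using eq unfolding x by (simp add: algebra_simps)
  qed
  have "f = e"
  proof (rule ccontr)
    assume "f \<noteq> e"
    from not_on_ray[OF e f this zero_in_cell, of \<beta> l] show False using eq a0 ab by simp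
  qed
  with a0 show ?thesis by simp
qed

lemma spoke_in_cell: "f \<in> star v \<Longrightarrow> \<alpha> \<ge> 0 \<Longrightarrow> \<beta> \<ge> 0 \<Longrightarrow> \<alpha> *\<^sub>R centre v + \<beta> *\<^sub>R w f \<in> cell v"
  by (intro cell_add cell_scale contact_in_cell centre_in_cell)

lemma spoke_nonzero:
  assumes f: "f \<in> star v" and ab: "\<alpha> \<ge> 0" "\<beta> \<ge> 0" "\<alpha> + \<beta> > 0"
  shows "\<alpha> *\<^sub>R centre v + \<beta> *\<^sub>R w f \<noteq> 0"
proof
  assume z: "\<alpha> *\<^sub>R centre v + \<beta> *\<^sub>R w f = 0"
  obtain e where e: "e \<in> star v" "e \<noteq> f" using other_in_star[OF star_in_V[OF f]] by metis
  from spoke_on_ray[OF f e(1) ab, of 0] z e show False by simp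
qed

lemma centre_nonzero:
  assumes "v \<in> V"
  shows "centre v \<noteq> 0"
proof -
  obtain f where "f \<in> star v" using other_in_star[OF assms] by metis
  from spoke_nonzero[OF this, of 1 0] show ?thesis by simp
qed

text \<open>Hence a contact keeps a positive distance from all spokes other than its own two.\<close>

lemma contact_not_on_spoke:
  assumes e: "e \<in> K" and f: "f \<in> star u" "f \<noteq> e" and ab: "\<alpha> \<ge> 0" "\<beta> \<ge> 0"
  shows "\<alpha> *\<^sub>R centre u + \<beta> *\<^sub>R w f \<noteq> w e"
proof
  assume eq: "\<alpha> *\<^sub>R centre u + \<beta> *\<^sub>R w f = w e"
  have pos: "\<alpha> + \<beta> > 0"
  proof (rule ccontr)
    assume "\<not> ?thesis"
    then have "\<alpha> = 0" "\<beta> = 0" using ab by auto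
    then show False using eq nonzero[OF e] by simp
  qed
  show False
  proof (cases "u \<in> ends e")
    case True
    then show False using spoke_on_ray[OF f(1) _ ab pos, of e 1] eq e f by (simp add: star_iff)
  next
    case False
    have "ends e \<noteq> {}" using ends[OF e] by auto
    then obtain v where "v \<in> ends e" by blast
    then have v: "e \<in> star v" "v \<noteq> u" using False e by (auto simp: star_iff)
    have "w e \<in> cell u" using spoke_in_cell[OF f(1) ab] eq by simp
    from cells_touch[OF this contact_in_cell[OF v(1)] star_in_V[OF f(1)] star_in_V[OF v(1)] v(2)[symmetric] nonzero[OF e]]
    obtain i l where i: "i \<in> star u" "i \<in> star v" "w e = l *\<^sub>R w i" by blast
    have "e \<noteq> i" using i False by (auto simp: star_iff)
    from not_on_ray[OF i(2) v(1) this zero_in_cell, of 1 l] show False using i by simp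
  qed
qed

text \<open>The contacts \<open>e\<close> and \<open>e'\<close> are consecutive corners of the polygon \<open>v\<close>, which lies to the left
  of the side from \<open>e\<close> to \<open>e'\<close> for \<open>\<sigma> = 1\<close> and to its right for \<open>\<sigma> = - 1\<close>.\<close>

definition adj :: "real \<Rightarrow> 'v \<Rightarrow> 'e \<Rightarrow> 'e \<Rightarrow> bool" where
  "adj \<sigma> v e e' \<longleftrightarrow> e \<in> star v \<and> e' \<in> star v \<and> e \<noteq> e' \<and>
     (\<forall>f\<in>star v. f \<noteq> e \<longrightarrow> f \<noteq> e' \<longrightarrow> \<sigma> * det3 (w e) (w e') (w f) > 0)"

lemma adj_sym: "adj \<sigma> v e e' \<Longrightarrow> adj (- \<sigma>) v e' e"
  unfolding adj_def by (auto simp: det3_swap(1)[of "w e" "w e'"])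

lemma adj_unique:
  assumes "adj \<sigma> v e e'" "adj \<sigma> v e e''"
  shows "e' = e''"
proof (rule ccontr)
  assume "e' \<noteq> e''"
  then have "\<sigma> * det3 (w e) (w e') (w e'') > 0" "\<sigma> * det3 (w e) (w e'') (w e') > 0"
    using assms unfolding adj_def by metis+
  then show False by (simp add: det3_swap(2)[of "w e" "w e''"])
qed

lemma adj_opposite:
  assumes "adj \<sigma> v e e'" "adj (- \<sigma>) v e e''"
  shows "e' \<noteq> e''"
proof
  assume eq: "e' = e''"
  obtain g where g: "g \<in> star v" "g \<noteq> e" "g \<noteq> e'"
    using other_in_star assms(1) star_in_V unfolding adj_def by metis
  then have "\<sigma> * det3 (w e) (w e') (w g) > 0" "- \<sigma> * det3 (w e) (w e') (w g) > 0"
    using assms unfolding adj_def eq by metis+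
  then show False by simp
qed

text \<open>Around the extreme ray \<open>e\<close>, the sign of \<open>det3 (w e) a b\<close> is a strict linear order of the
  other corners; a cyclic triple would give a positive combination of the other corners on the
  line of \<open>e\<close>. The first corner in this order is the next one along the boundary.\<close>

lemma ex_adj:
  assumes e: "e \<in> star v" and \<sigma>: "\<sigma> = 1 \<or> \<sigma> = - 1"
  shows "\<exists>e'. adj \<sigma> v e e'"
proof -
  define R where "R a b \<longleftrightarrow> \<sigma> * det3 (w e) (w a) (w b) > 0" for a b
  obtain g where "g \<in> star v" "g \<noteq> e" using other_in_star[OF star_in_V[OF e]] by metis
  then have ne: "star v - {e} \<noteq> {}" by blast
  have nz: "\<sigma> * det3 (w e) (w a) (w b) \<noteq> 0" if "a \<in> star v - {e}" "b \<in> star v - {e}" "a \<noteq> b" for a b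
    using star_independent[OF e, of a b] that \<sigma> by auto
  have sw: "\<sigma> * det3 (w e) (w b) (w a) = - (\<sigma> * det3 (w e) (w a) (w b))" for a b
    by (simp add: det3_swap(2)[of "w e" "w b"])
  have total: "R a b \<or> R b a" if "a \<in> star v - {e}" "b \<in> star v - {e}" "a \<noteq> b" for a b
    using nz[OF that] sw[of a b] unfolding R_def by linarith
  have trans: "R a c" if *: "a \<in> star v - {e}" "b \<in> star v - {e}" "c \<in> star v - {e}" "a \<noteq> c" "R a b" "R b c" for a b c
  proof (rule ccontr)
    assume "\<not> R a c"
    then have neg: "- (\<sigma> * det3 (w e) (w a) (w c)) > 0" using nz[OF *(1,3,4)] unfolding R_def by linarith
    have "a \<noteq> b" "b \<noteq> c" using *(5,6) unfolding R_def by auto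
    \<comment> \<open>the linear relation between four vectors of three-dimensional space\<close>
    have "det3 (w a) (w b) (w c) *\<^sub>R w e = det3 (w e) (w b) (w c) *\<^sub>R w a + (- det3 (w e) (w a) (w c)) *\<^sub>R w b + det3 (w e) (w a) (w b) *\<^sub>R w c"
      by (simp add: vec_eq_iff forall_3 det3_expand algebra_simps)
    then have "\<sigma> *\<^sub>R (det3 (w a) (w b) (w c) *\<^sub>R w e) = \<sigma> *\<^sub>R (det3 (w e) (w b) (w c) *\<^sub>R w a + (- det3 (w e) (w a) (w c)) *\<^sub>R w b + det3 (w e) (w a) (w b) *\<^sub>R w c)"
      by simp
    then have eq: "(\<sigma> * det3 (w a) (w b) (w c)) *\<^sub>R w e =
       (\<sigma> * det3 (w e) (w b) (w c)) *\<^sub>R w a + (- (\<sigma> * det3 (w e) (w a) (w c))) *\<^sub>R w b + (\<sigma> * det3 (w e) (w a) (w b)) *\<^sub>R w c"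
      by (simp add: scaleR_add_right scaleR_diff_right)
    have "(\<sigma> * det3 (w e) (w b) (w c)) *\<^sub>R w a + (- (\<sigma> * det3 (w e) (w a) (w c))) *\<^sub>R w b \<in> cell v"
      using * neg unfolding R_def by (intro cell_add cell_scale contact_in_cell) auto
    from not_on_ray[OF e _ _ this, of c "\<sigma> * det3 (w e) (w a) (w b)" "\<sigma> * det3 (w a) (w b) (w c)"] eq * show False
      unfolding R_def by auto
  qed
  have "\<exists>a\<in>star v - {e}. \<forall>b\<in>star v - {e}. b \<noteq> a \<longrightarrow> R a b"
  proof (rule finite_has_first)
    show "finite (star v - {e})" by simp
    show "star v - {e} \<noteq> {}" by (rule ne)
    show "R a b \<or> R b a" if "a \<in> star v - {e}" "b \<in> star v - {e}" "a \<noteq> b" for a b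
      by (rule total[OF that])
    show "R a c" if "a \<in> star v - {e}" "b \<in> star v - {e}" "c \<in> star v - {e}" "a \<noteq> c" "R a b" "R b c" for a b c
      by (rule trans[OF that])
  qed
  then obtain a where a: "a \<in> star v" "a \<noteq> e" "\<And>b. b \<in> star v \<Longrightarrow> b \<noteq> e \<Longrightarrow> b \<noteq> a \<Longrightarrow> R a b" by blast
  then have "adj \<sigma> v e a" using e unfolding adj_def R_def by blast
  then show ?thesis ..
qed

lemma adj_centre:
  assumes "adj \<sigma> v e e'"
  shows "\<sigma> * det3 (w e) (w e') (centre v) > 0"
proof -
  obtain g where g: "g \<in> star v" "g \<noteq> e" "g \<noteq> e'"
    using other_in_star assms(1) star_in_V unfolding adj_def by metis
  have "\<sigma> * det3 (w e) (w e') (centre v) = (\<Sum>f\<in>star v. \<sigma> * det3 (w e) (w e') (w f))"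
    by (simp add: centre_def det3_sum sum_distrib_left)
  also have "\<dots> > 0"
  proof (rule sum_pos2[OF finite_star g(1)])
    show "\<sigma> * det3 (w e) (w e') (w g) > 0" using assms g unfolding adj_def by blast
    show "\<sigma> * det3 (w e) (w e') (w f) \<ge> 0" if "f \<in> star v" for f
      using assms that unfolding adj_def by (cases "f = e \<or> f = e'") (auto intro: less_imp_le)
  qed
  finally show ?thesis .
qed

lemma contact_centre_not_parallel:
  assumes "f \<in> star v"
  shows "cross3 (centre v) (w f) \<noteq> 0"
proof
  assume z: "cross3 (centre v) (w f) = 0"
  have "cross3 (w f) (cross3 (w f) (centre v)) = (w f \<bullet> centre v) *\<^sub>R w f - (w f \<bullet> w f) *\<^sub>R centre v" by (rule Lagrange)
  then have "(w f \<bullet> w f) *\<^sub>R centre v + 0 *\<^sub>R w f = (w f \<bullet> centre v) *\<^sub>R w f" using z by (simp add: cross_skew[of "w f"] algebra_simps)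
  moreover have "w f \<bullet> w f > 0" using nonzero assms by (auto simp: star_iff)
  ultimately show False using spoke_on_ray[OF assms assms, of "w f \<bullet> w f" 0] by simp
qed

text \<open>In the plane of directions at \<open>e\<close>, suppose that the direction of \<open>x\<close> is not on the expected
  side of \<open>centre u\<close>. Then \<open>centre u\<close> lies in the angle between \<open>centre v\<close> and \<open>x\<close>, so the cells
  \<open>u\<close> and \<open>v\<close> overlap near \<open>e\<close>.\<close>

lemma other_side:
  assumes e: "e \<in> star v" "e \<in> star u" "u \<noteq> v" and x: "x \<in> star v"
    and ax: "\<sigma> * det3 (w e) (centre v) (w x) > 0" and ab: "\<sigma> * det3 (w e) (centre v) (centre u) \<ge> 0"
  shows "\<sigma> * det3 (w e) (w x) (centre u) > 0"
proof (rule ccontr)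
  assume n: "\<not> ?thesis"
  let ?a = "centre v" and ?b = "centre u"
  define A where "A = - (\<sigma> * det3 (w e) (w x) ?b)"
  define B where "B = \<sigma> * det3 (w e) ?a ?b"
  define N where "N = \<sigma> * det3 (w e) ?a (w x)"
  define k where "k = \<sigma> * det3 ?a (w x) ?b"
  have A: "A \<ge> 0" and B: "B \<ge> 0" and N: "N > 0" using n ab ax by (auto simp: A_def B_def N_def)
  \<comment> \<open>the linear relation between four vectors; its sign at the first one is unknown, so this term is split below\<close>
  have "det3 ?a (w x) ?b *\<^sub>R w e = det3 (w e) (w x) ?b *\<^sub>R ?a + (- det3 (w e) ?a ?b) *\<^sub>R w x + det3 (w e) ?a (w x) *\<^sub>R ?b"
    by (simp add: vec_eq_iff forall_3 det3_expand algebra_simps)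
  then have "\<sigma> *\<^sub>R (det3 ?a (w x) ?b *\<^sub>R w e) = \<sigma> *\<^sub>R (det3 (w e) (w x) ?b *\<^sub>R ?a + (- det3 (w e) ?a ?b) *\<^sub>R w x + det3 (w e) ?a (w x) *\<^sub>R ?b)"
    by simp
  then have eq: "k *\<^sub>R w e + A *\<^sub>R ?a + B *\<^sub>R w x = N *\<^sub>R ?b"
    unfolding A_def B_def N_def k_def by (simp add: scaleR_add_right scaleR_diff_right)
  define k1 where "k1 = max k 0"
  define k2 where "k2 = max (- k) 0"
  define P where "P = N *\<^sub>R ?b + k2 *\<^sub>R w e"
  have k: "k1 \<ge> 0" "k2 \<ge> 0" "k = k1 - k2" by (auto simp: k1_def k2_def)
  have P: "P = k1 *\<^sub>R w e + A *\<^sub>R ?a + B *\<^sub>R w x" unfolding P_def eq[symmetric] k(3) by (simp add: algebra_simps)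
  have Pv: "P \<in> cell v" unfolding P using e x A B k by (intro cell_add cell_scale contact_in_cell centre_in_cell)
  have Pu: "P \<in> cell u" unfolding P_def using e N k by (intro spoke_in_cell) auto
  have P0: "P \<noteq> 0" unfolding P_def using e N k by (intro spoke_nonzero) auto
  obtain f l where f: "f \<in> star v" "f \<in> star u" "P = l *\<^sub>R w f"
    by (rule cells_touch[OF Pv Pu star_in_V[OF e(1)] star_in_V[OF e(2)] e(3)[symmetric] P0])
  have "f = e" using simple[of f e u v] f e by (auto simp: star_iff)
  then have "N = 0" using spoke_on_ray[OF e(2) e(2), of N k2 l] f N k unfolding P_def by auto
  then show False using N by simp
qed

end

section \<open>Euler's inequality for touching polygons\<close>

text \<open>The drawing consists of the spokes. The number \<open>\<epsilon>\<close> is so small that, close to a contact, only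
  the two spokes ending there are seen, and \<open>g\<close> is the base point of the parity.\<close>
locale drawing = touching_cells_deg3 V K ends w
  for V :: "'v set" and K :: "'e set" and ends :: "'e \<Rightarrow> 'v set" and w :: "'e \<Rightarrow> real^3" +
  fixes \<epsilon> :: real and g :: "real^3"
  assumes eps: "0 < \<epsilon>" "\<epsilon> < 1"
    and eps_parallel: "e \<in> star v \<Longrightarrow> f \<in> star v \<Longrightarrow> e \<noteq> f \<Longrightarrow> s \<in> w ` K \<union> centre ` V \<Longrightarrow>
      cross3 s (w e + \<epsilon> *\<^sub>R w f) \<noteq> 0"
    and eps_avoid: "e \<in> K \<Longrightarrow> x \<in> K \<Longrightarrow> y \<in> K \<Longrightarrow> f \<in> star u \<Longrightarrow> f \<noteq> e \<Longrightarrow>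
      \<not> arcs_meet (w e + \<epsilon> *\<^sub>R w x) (w e + \<epsilon> *\<^sub>R w y) (centre u) (w f)"
    and eps_cross: "adj 1 v e e1 \<Longrightarrow> adj (- 1) v e e2 \<Longrightarrow>
      \<exists>t>0. \<exists>l>0. \<exists>m>0. centre v + t *\<^sub>R w e = l *\<^sub>R (w e + \<epsilon> *\<^sub>R w e1) + m *\<^sub>R (w e + \<epsilon> *\<^sub>R w e2)"
    and gen: "generic g (w ` K \<union> centre ` V \<union> (\<lambda>(e, f). w e + \<epsilon> *\<^sub>R w f) ` (K \<times> K))"
begin

abbreviation all_points :: "(real^3) set" where
  "all_points \<equiv> w ` K \<union> centre ` V \<union> (\<lambda>(e, f). w e + \<epsilon> *\<^sub>R w f) ` (K \<times> K)"

text \<open>A point on the side from \<open>e\<close> to \<open>f\<close> close to \<open>e\<close> when these are consecutive corners. The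
  parity is evaluated only at such points.\<close>

definition near :: "'e \<Rightarrow> 'e \<Rightarrow> real^3" where
  "near e f = w e + \<epsilon> *\<^sub>R w f"

abbreviation spokes :: "'e set \<Rightarrow> ('e \<times> 'v) set" where
  "spokes z \<equiv> SIGMA f:z. ends f"

definition parity :: "'e set \<Rightarrow> real^3 \<Rightarrow> bool" where
  "parity z q = winding_parity g (spokes z) (\<lambda>j. centre (snd j)) (\<lambda>j. w (fst j)) q"

lemma spokes_closed:
  assumes z: "z \<in> even_subgraphs V K ends"
  shows "closed_chain (spokes z) (\<lambda>j. centre (snd j)) (\<lambda>j. w (fst j))"
  unfolding closed_chain_def
proof (intro conjI allI)
  have zK: "z \<subseteq> K" and ev: "\<And>v. v \<in> V \<Longrightarrow> even (card {e \<in> z. v \<in> ends e})" using z by (auto simp: even_subgraphs_def)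
  have fz: "finite z" using zK finite_K finite_subset by blast
  have fe: "finite (ends e)" if "e \<in> z" for e using that zK ends finite_V finite_subset by blast
  show "finite (spokes z)" using fz fe by auto
  fix P
  have "(\<Sum>e\<in>z. \<Sum>v\<in>ends e. (of_bool (P (centre v)) :: nat)) = (\<Sum>v\<in>V. card {e \<in> z. v \<in> ends e} * of_bool (P (centre v)))"
    using zK ends by (intro sum_over_ends finite_V fz) blast
  also have "even \<dots>" using ev by (intro dvd_sum) simp
  finally have 1: "even (\<Sum>e\<in>z. \<Sum>v\<in>ends e. (of_bool (P (centre v)) :: nat))" .
  have "(\<Sum>e\<in>z. \<Sum>v\<in>ends e. (of_bool (P (w e)) :: nat)) = (\<Sum>e\<in>z. 2 * of_bool (P (w e)))"
    using zK ends by (intro sum.cong refl) auto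
  also have "even \<dots>" by (intro dvd_sum) simp
  finally have 2: "even (\<Sum>e\<in>z. \<Sum>v\<in>ends e. (of_bool (P (w e)) :: nat))" .
  have "(\<Sum>j\<in>spokes z. of_bool (P (centre (snd j))) + of_bool (P (w (fst j))) :: nat)
     = (\<Sum>e\<in>z. \<Sum>v\<in>ends e. of_bool (P (centre v)) + of_bool (P (w e)))"
    using fz fe by (subst sum.Sigma) (auto intro!: sum.cong)
  also have "\<dots> = (\<Sum>e\<in>z. \<Sum>v\<in>ends e. of_bool (P (centre v))) + (\<Sum>e\<in>z. \<Sum>v\<in>ends e. of_bool (P (w e)))"
    by (simp only: sum.distrib)
  finally show "even (\<Sum>j\<in>spokes z. of_bool (P (centre (snd j))) + of_bool (P (w (fst j))) :: nat)"
    using 1 2 by simp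
qed

lemma spoke_transversal:
  assumes z: "z \<in> even_subgraphs V K ends" and j: "j \<in> spokes z"
  shows "fst j \<in> star (snd j)" "snd j \<in> V"
    and "e \<in> star v \<Longrightarrow> f \<in> star v \<Longrightarrow> e \<noteq> f \<Longrightarrow> cross3 (centre (snd j)) (near e f) \<noteq> 0"
    and "e \<in> star v \<Longrightarrow> f \<in> star v \<Longrightarrow> e \<noteq> f \<Longrightarrow> cross3 (w (fst j)) (near e f) \<noteq> 0"
    and "cross3 (centre (snd j)) (w (fst j)) \<noteq> 0"
    and "centre (snd j) \<in> all_points \<and> w (fst j) \<in> all_points"
proof -
  have "fst j \<in> K" "snd j \<in> ends (fst j)" using z j by (auto simp: even_subgraphs_def)
  then show s: "fst j \<in> star (snd j)" and V: "snd j \<in> V" using star_in_V by (auto simp: star_iff)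
  show "e \<in> star v \<Longrightarrow> f \<in> star v \<Longrightarrow> e \<noteq> f \<Longrightarrow> cross3 (centre (snd j)) (near e f) \<noteq> 0"
    using eps_parallel V unfolding near_def by blast
  show "e \<in> star v \<Longrightarrow> f \<in> star v \<Longrightarrow> e \<noteq> f \<Longrightarrow> cross3 (w (fst j)) (near e f) \<noteq> 0"
    using eps_parallel s unfolding near_def star_iff by blast
  show "cross3 (centre (snd j)) (w (fst j)) \<noteq> 0" using contact_centre_not_parallel[OF s] .
  show "centre (snd j) \<in> all_points \<and> w (fst j) \<in> all_points"
    using s V unfolding star_iff by blast
qed

lemma near_generic: "e \<in> star v \<Longrightarrow> f \<in> star v \<Longrightarrow> near e f \<in> all_points"
  unfolding near_def star_iff by force

lemma parity_eqI:
  assumes z: "z \<in> even_subgraphs V K ends"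
    and e: "e \<in> star v" "x \<in> star v" "e \<noteq> x" and e': "e' \<in> star v'" "x' \<in> star v'" "e' \<noteq> x'"
    and q: "cross3 (near e x) (near e' x') \<noteq> 0"
    and no: "\<And>f u. f \<in> star u \<Longrightarrow> \<not> arcs_meet (near e x) (near e' x') (centre u) (w f)"
  shows "parity z (near e x) = parity z (near e' x')"
  unfolding parity_def
proof (rule winding_parity_eq[OF spokes_closed[OF z] gen near_generic[OF e(1,2)] near_generic[OF e'(1,2)]])
  fix j assume j: "j \<in> spokes z"
  note tr = spoke_transversal[OF z j]
  show "cross3 (centre (snd j)) (near e x) \<noteq> 0" "cross3 (w (fst j)) (near e x) \<noteq> 0" using tr(3,4) e by blast+
  show "cross3 (centre (snd j)) (near e' x') \<noteq> 0" "cross3 (w (fst j)) (near e' x') \<noteq> 0" using tr(3,4) e' by blast+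
  show "cross3 (centre (snd j)) (w (fst j)) \<noteq> 0" by (rule tr(5))
  show "\<not> arcs_meet (near e x) (near e' x') (centre (snd j)) (w (fst j))" using no tr(1) by blast
  show "centre (snd j) \<in> all_points \<and> w (fst j) \<in> all_points" by (rule tr(6))
qed (rule q)

text \<open>The interior of a side of a polygon meets no spoke: the spokes of the polygon itself leave
  its boundary at once, and other cells touch it only in corners.\<close>

lemma parity_along_side:
  assumes z: "z \<in> even_subgraphs V K ends" and \<sigma>: "adj \<sigma> v e e'"
  shows "parity z (near e e') = parity z (near e' e)"
proof (rule parity_eqI[OF z])
  show e: "e \<in> star v" "e' \<in> star v" "e \<noteq> e'" using \<sigma> by (auto simp: adj_def)
  show "e' \<in> star v" "e \<in> star v" "e' \<noteq> e" using e by auto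
  have "cross3 (near e e') (near e' e) = (1 - \<epsilon>\<^sup>2) *\<^sub>R cross3 (w e) (w e')"
    unfolding near_def
    by (simp add: cross_add_left cross_add_right cross_mult_left cross_mult_right cross_skew[of "w e'" "w e"] algebra_simps power2_eq_square)
  moreover have "1 - \<epsilon>\<^sup>2 \<noteq> 0" using eps by (simp add: power2_eq_1_iff)
  ultimately show "cross3 (near e e') (near e' e) \<noteq> 0" using star_not_parallel[OF e(1,2)] e by simp
  fix f u assume f: "f \<in> star u"
  show "\<not> arcs_meet (near e e') (near e' e) (centre u) (w f)"
  proof
    assume "arcs_meet (near e e') (near e' e) (centre u) (w f)"
    then obtain \<alpha> \<beta> l m where *: "\<alpha> \<ge> 0" "\<beta> \<ge> 0" "l \<ge> 0" "m \<ge> 0" "\<alpha> + \<beta> > 0"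
      "\<alpha> *\<^sub>R centre u + \<beta> *\<^sub>R w f = l *\<^sub>R near e e' + m *\<^sub>R near e' e" unfolding arcs_meet_def by blast
    define P where "P = \<alpha> *\<^sub>R centre u + \<beta> *\<^sub>R w f"
    define r where "r = l + m * \<epsilon>"
    define s where "s = l * \<epsilon> + m"
    have P: "P = r *\<^sub>R w e + s *\<^sub>R w e'"
      unfolding P_def * near_def r_def s_def by (simp add: algebra_simps)
    have P0: "P \<noteq> 0" unfolding P_def using spoke_nonzero[OF f *(1,2,5)] .
    have "l > 0 \<or> m > 0" using P0 * unfolding P_def by (cases "l = 0"; cases "m = 0") auto
    then have rs: "r > 0" "s > 0" unfolding r_def s_def using * eps
      by (auto intro: add_pos_nonneg add_nonneg_pos)
    have corner: "P \<noteq> k *\<^sub>R w i" if i: "i \<in> star v" for i k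
    proof (cases "i = e'")
      case True
      have "s *\<^sub>R w e' \<in> cell v" using e rs by (intro cell_scale contact_in_cell) auto
      from not_on_ray[OF i e(1) _ this rs(1), of k] show ?thesis using True e P by (simp add: add.commute)
    next
      case False
      have "r *\<^sub>R w e \<in> cell v" using e rs by (intro cell_scale contact_in_cell) auto
      from not_on_ray[OF i e(2) _ this rs(2), of k] show ?thesis using False P by simp
    qed
    show False
    proof (cases "u = v")
      case True
      have 1: "\<sigma> * det3 (w e) (w e') (centre v) > 0" using adj_centre[OF \<sigma>] .
      have 2: "\<sigma> * det3 (w e) (w e') (w f) \<ge> 0"
        using \<sigma> f True unfolding adj_def by (cases "f = e \<or> f = e'") (auto intro: less_imp_le)
      have "det3 (w e) (w e') P = 0" unfolding P by (simp add: det3_linear)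
      then have "\<sigma> * (\<alpha> * det3 (w e) (w e') (centre v) + \<beta> * det3 (w e) (w e') (w f)) = 0"
        unfolding P_def True by (simp add: det3_linear)
      then have "\<alpha> * (\<sigma> * det3 (w e) (w e') (centre v)) + \<beta> * (\<sigma> * det3 (w e) (w e') (w f)) = 0"
        by (simp add: algebra_simps)
      moreover have "\<beta> * (\<sigma> * det3 (w e) (w e') (w f)) \<ge> 0" using 2 * by simp
      moreover have "\<alpha> * (\<sigma> * det3 (w e) (w e') (centre v)) \<ge> 0" using 1 * by simp
      ultimately have "\<alpha> * (\<sigma> * det3 (w e) (w e') (centre v)) = 0" by linarith
      then have "\<alpha> = 0" by (metis 1 less_irrefl mult_eq_0_iff)
      then have "P = \<beta> *\<^sub>R w f" by (simp add: P_def)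
      then show False using corner f True by blast
    next
      case False
      have Pu: "P \<in> cell u" unfolding P_def using f * by (intro spoke_in_cell)
      have Pv: "P \<in> cell v" unfolding P using e rs by (intro cell_add cell_scale contact_in_cell) auto
      obtain i k where "i \<in> star v" "P = k *\<^sub>R w i"
        by (rule cells_touch[OF Pu Pv star_in_V[OF f] star_in_V[OF e(1)] False P0])
      then show False using corner by blast
    qed
  qed
qed

lemma near_not_on_ray:
  assumes e: "e \<in> star v" and x: "x \<in> star v" "x \<noteq> e" "y \<in> star v" "y \<noteq> e" and lm: "l \<ge> 0" "m \<ge> 0" "l + m > 0"
  shows "l *\<^sub>R near e x + m *\<^sub>R near e y \<noteq> k *\<^sub>R w e"
proof -
  have eq: "l *\<^sub>R near e x + m *\<^sub>R near e y = ((l + m) *\<^sub>R w e + (l * \<epsilon>) *\<^sub>R w x) + (m * \<epsilon>) *\<^sub>R w y"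
    "l *\<^sub>R near e x + m *\<^sub>R near e y = ((l + m) *\<^sub>R w e + (m * \<epsilon>) *\<^sub>R w y) + (l * \<epsilon>) *\<^sub>R w x"
    unfolding near_def by (simp_all add: algebra_simps)
  consider "l > 0" | "m > 0" using lm by linarith
  then show ?thesis
  proof cases
    case 1
    have "(l + m) *\<^sub>R w e + (m * \<epsilon>) *\<^sub>R w y \<in> cell v" using e x lm eps by (intro cell_add cell_scale contact_in_cell) auto
    from not_on_ray[OF e x(1,2) this] show ?thesis unfolding eq(2) using 1 eps by simp
  next
    case 2
    have "(l + m) *\<^sub>R w e + (l * \<epsilon>) *\<^sub>R w x \<in> cell v" using e x lm eps by (intro cell_add cell_scale contact_in_cell) auto
    from not_on_ray[OF e x(3,4) this] show ?thesis unfolding eq(1) using 2 eps by simp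
  qed
qed

lemma near_in_cell: "e \<in> star v \<Longrightarrow> x \<in> star v \<Longrightarrow> near e x \<in> cell v"
  unfolding near_def using eps by (intro cell_add cell_scale contact_in_cell) auto

lemma common_contact:
  assumes "p \<in> cell u" "p \<in> cell v" "e \<in> star u" "e \<in> star v" "u \<noteq> v" "p \<noteq> 0"
  obtains l where "p = l *\<^sub>R w e"
proof -
  obtain i l where i: "i \<in> star u" "i \<in> star v" "p = l *\<^sub>R w i"
    by (rule cells_touch[OF assms(1,2) star_in_V[OF assms(3)] star_in_V[OF assms(4)] assms(5,6)])
  have "i = e" using simple[of i e u v] i assms by (auto simp: star_iff)
  then show ?thesis using i that by blast
qed

text \<open>The short segment cutting off the corner \<open>e\<close> from the polygon meets no spoke except the one
  from the centre of this polygon to \<open>e\<close>.\<close>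

lemma parity_jump:
  assumes z: "z \<in> even_subgraphs V K ends" and e1: "adj 1 v e e1" and e2: "adj (- 1) v e e2"
  shows "parity z (near e e1) \<noteq> parity z (near e e2) \<longleftrightarrow> e \<in> z"
proof -
  have e: "e \<in> star v" "e1 \<in> star v" "e2 \<in> star v" "e \<noteq> e1" "e \<noteq> e2"
    using e1 e2 by (auto simp: adj_def)
  have e12: "e1 \<noteq> e2" using adj_opposite[OF e1 e2] .
  define D where "D = det3 (w e) (w e1) (w e2)"
  have D: "D \<noteq> 0" unfolding D_def using star_independent[OF e(1-3)] e e12 by auto
  obtain t l m where tlm: "t > 0" "l > 0" "m > 0" "centre v + t *\<^sub>R w e = l *\<^sub>R near e e1 + m *\<^sub>R near e e2"
    using eps_cross[OF e1 e2] unfolding near_def by blast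
  have qqe: "det3 (near e e1) (near e e2) (w e) = \<epsilon>\<^sup>2 * D"
    unfolding near_def D_def by (simp add: det3_expand power2_eq_square algebra_simps)
  have cross: "cross3 (near e e1) (near e e2) \<noteq> 0"
  proof
    assume "cross3 (near e e1) (near e e2) = 0"
    then have "det3 (w e) (near e e1) (near e e2) = 0" by (simp add: det3_def)
    then show False using qqe D eps det3_swap[of "near e e1" "w e" "near e e2"] det3_swap[of "near e e1" "near e e2" "w e"] by simp
  qed
  have "det3 (near e e1) (near e e2) (centre v) = det3 (near e e1) (near e e2) (l *\<^sub>R near e e1 + m *\<^sub>R near e e2 - t *\<^sub>R w e)"
    unfolding tlm(4)[symmetric] by simp
  also have "\<dots> = det3 (near e e1) (near e e2) (l *\<^sub>R near e e1 + m *\<^sub>R near e e2 + (- t) *\<^sub>R w e)" by simp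
  also have "\<dots> = - t * (\<epsilon>\<^sup>2 * D)" unfolding det3_linear qqe by simp
  also have "\<dots> \<noteq> 0" using D eps tlm by simp
  finally have detc: "det3 (near e e1) (near e e2) (centre v) \<noteq> 0" .
  let ?i = "(e, v)"
  have "parity z (near e e1) \<noteq> parity z (near e e2) \<longleftrightarrow> ?i \<in> spokes z"
    unfolding parity_def
  proof (rule winding_parity_jump[OF spokes_closed[OF z] gen near_generic[OF e(1,2)] near_generic[OF e(1,3)], where s = 1 and t = t and l = l and m = m])
    fix j assume j: "j \<in> spokes z"
    note tr = spoke_transversal[OF z j]
    show "cross3 (centre (snd j)) (near e e1) \<noteq> 0" "cross3 (w (fst j)) (near e e1) \<noteq> 0" using tr(3,4) e by blast+
    show "cross3 (centre (snd j)) (near e e2) \<noteq> 0" "cross3 (w (fst j)) (near e e2) \<noteq> 0" using tr(3,4) e by blast+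
    show "cross3 (centre (snd j)) (w (fst j)) \<noteq> 0" by (rule tr(5))
    show "centre (snd j) \<in> all_points \<and> w (fst j) \<in> all_points" by (rule tr(6))
    assume ji: "j \<noteq> ?i"
    show "\<not> arcs_meet (near e e1) (near e e2) (centre (snd j)) (w (fst j))"
    proof (cases "fst j = e")
      case False
      then show ?thesis using eps_avoid tr(1) e unfolding near_def star_iff by blast
    next
      case True
      then have uv: "snd j \<noteq> v" using ji by (metis prod.collapse)
      show ?thesis
      proof
        assume "arcs_meet (near e e1) (near e e2) (centre (snd j)) (w (fst j))"
        then obtain \<alpha> \<beta> l m where *: "\<alpha> \<ge> 0" "\<beta> \<ge> 0" "l \<ge> 0" "m \<ge> 0" "\<alpha> + \<beta> > 0"
          "\<alpha> *\<^sub>R centre (snd j) + \<beta> *\<^sub>R w e = l *\<^sub>R near e e1 + m *\<^sub>R near e e2" unfolding arcs_meet_def True by blast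
        define P where "P = l *\<^sub>R near e e1 + m *\<^sub>R near e e2"
        have eu: "e \<in> star (snd j)" using tr(1) True by simp
        have Pu: "P \<in> cell (snd j)" unfolding P_def *(6)[symmetric] using eu * by (intro spoke_in_cell)
        have P0: "P \<noteq> 0" unfolding P_def *(6)[symmetric] using eu * by (intro spoke_nonzero)
        have Pv: "P \<in> cell v" unfolding P_def using * e by (intro cell_add cell_scale near_in_cell)
        have "l + m > 0" using P0 * unfolding P_def by (cases "l = 0"; cases "m = 0") auto
        obtain k where "P = k *\<^sub>R w e" by (rule common_contact[OF Pu Pv eu e(1) uv P0])
        then show False using near_not_on_ray[OF e(1,2) _ e(3) _ *(3,4) \<open>l + m > 0\<close>] e unfolding P_def by auto
      qed
    qed
  qed (use cross detc tlm in simp_all)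
  also have "?i \<in> spokes z \<longleftrightarrow> e \<in> z" using e by (auto simp: star_iff)
  finally show ?thesis .
qed

text \<open>At the contact \<open>e\<close> the directions \<open>x\<close> and \<open>y\<close> both lie strictly inside the angle, at most a
  half turn, from \<open>centre v\<close> to \<open>centre u\<close>. So the segment between the two test points meets
  neither of the spokes at \<open>e\<close>.\<close>

lemma parity_across_aux:
  assumes z: "z \<in> even_subgraphs V K ends" and \<sigma>: "\<sigma> = 1 \<or> \<sigma> = - 1"
    and x: "adj (- \<sigma>) v e x" and y: "adj \<sigma> u e y" and uv: "u \<noteq> v"
    and ab: "\<sigma> * det3 (w e) (centre v) (centre u) \<ge> 0"
  shows "parity z (near e x) = parity z (near e y)"
proof -
  have ex: "e \<in> star v" "x \<in> star v" "e \<noteq> x" and ey: "e \<in> star u" "y \<in> star u" "e \<noteq> y"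
    using x y by (auto simp: adj_def)
  let ?d = "\<lambda>p q. \<sigma> * det3 (w e) p q"
  have ax: "?d (centre v) (w x) > 0" using adj_centre[OF x] by (simp add: det3_swap(2)[of "w e" "w x"])
  have yb: "?d (w y) (centre u) > 0" using adj_centre[OF y] .
  have xb: "?d (w x) (centre u) > 0" by (rule other_side[OF ex(1) ey(1) uv ex(2) ax ab])
  have "- \<sigma> * det3 (w e) (w y) (centre v) > 0"
    by (rule other_side[OF ey(1) ex(1) uv[symmetric] ey(2)])
      (use yb ab in \<open>simp_all add: det3_swap(2)[of "w e" "w y"] det3_swap(2)[of "w e" "centre v" "centre u"]\<close>)
  then have ay: "?d (centre v) (w y) > 0" by (simp add: det3_swap(2)[of "w e" "w y"])
  have left: "?d (centre v) (l *\<^sub>R near e x + m *\<^sub>R near e y) = \<epsilon> * (l * ?d (centre v) (w x) + m * ?d (centre v) (w y))" for l m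
    unfolding near_def by (simp add: det3_linear algebra_simps)
  have right: "?d (l *\<^sub>R near e x + m *\<^sub>R near e y) (centre u) = \<epsilon> * (l * ?d (w x) (centre u) + m * ?d (w y) (centre u))" for l m
    unfolding near_def by (simp add: det3_linear algebra_simps)
  have near0: "near e x \<noteq> 0"
    using near_not_on_ray[OF ex(1,2) ex(3)[symmetric] ex(2) ex(3)[symmetric], of 1 0 0] by auto
  show ?thesis
  proof (rule parity_eqI[OF z ex ey])
    show "cross3 (near e x) (near e y) \<noteq> 0"
    proof
      assume c: "cross3 (near e x) (near e y) = 0"
      define N where "N = near e x \<bullet> near e x"
      define M where "M = near e x \<bullet> near e y"
      have N: "N > 0" unfolding N_def using near0 by simp
      have "cross3 (near e x) (cross3 (near e x) (near e y)) = M *\<^sub>R near e x - N *\<^sub>R near e y"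
        unfolding N_def M_def by (rule Lagrange)
      then have eq: "M *\<^sub>R near e x = N *\<^sub>R near e y" using c by simp
      have d: "?d (centre v) (M *\<^sub>R near e x) = M * (\<epsilon> * ?d (centre v) (w x))"
        "?d (centre v) (N *\<^sub>R near e y) = N * (\<epsilon> * ?d (centre v) (w y))"
        by (simp_all add: det3_linear near_def mult_ac)
      have "M * (\<epsilon> * ?d (centre v) (w x)) = N * (\<epsilon> * ?d (centre v) (w y))" unfolding d[symmetric] eq ..
      also have "\<dots> > 0" by (rule mult_pos_pos[OF N mult_pos_pos[OF eps(1) ay]])
      finally have M: "M > 0" using mult_pos_pos[OF eps(1) ax] zero_less_mult_pos2 by blast
      define P where "P = M *\<^sub>R near e x"
      have Pv: "P \<in> cell v" unfolding P_def using M ex by (intro cell_scale near_in_cell) auto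
      have Pu: "P \<in> cell u" unfolding P_def eq using N ey by (intro cell_scale near_in_cell) auto
      have P0: "P \<noteq> 0" unfolding P_def using M near0 by simp
      obtain k where "P = k *\<^sub>R w e" by (rule common_contact[OF Pu Pv ey(1) ex(1) uv P0])
      then show False using near_not_on_ray[OF ex(1,2) ex(3)[symmetric] ex(2) ex(3)[symmetric], of M 0 k] M unfolding P_def by auto
    qed
  next
    fix f u' assume f: "f \<in> star u'"
    show "\<not> arcs_meet (near e x) (near e y) (centre u') (w f)"
    proof (cases "f = e")
      case False
      then show ?thesis using eps_avoid f ex ey unfolding near_def star_iff by blast
    next
      case True
      have "u' = v \<or> u' = u"
      proof -
        have "card (ends e) = 2" "u \<in> ends e" "v \<in> ends e" "u' \<in> ends e" using ends ex ey f True by (auto simp: star_iff)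
        then show ?thesis using uv by (auto simp: card_2_iff)
      qed
      show ?thesis
      proof
        assume "arcs_meet (near e x) (near e y) (centre u') (w f)"
        then obtain \<alpha> \<beta> l m where *: "\<alpha> \<ge> 0" "\<beta> \<ge> 0" "l \<ge> 0" "m \<ge> 0" "\<alpha> + \<beta> > 0"
          "\<alpha> *\<^sub>R centre u' + \<beta> *\<^sub>R w e = l *\<^sub>R near e x + m *\<^sub>R near e y" unfolding arcs_meet_def True by blast
        define P where "P = l *\<^sub>R near e x + m *\<^sub>R near e y"
        have P0: "P \<noteq> 0" unfolding P_def *(6)[symmetric] using f True * by (intro spoke_nonzero) auto
        have lm: "l > 0 \<or> m > 0" using P0 * unfolding P_def by (cases "l = 0"; cases "m = 0") auto
        have pos: "\<epsilon> * (l * p + m * q) > 0" if "p > 0" "q > 0" for p q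
          using that lm * eps by (intro mult_pos_pos) (auto intro: add_pos_nonneg add_nonneg_pos)
        show False using \<open>u' = v \<or> u' = u\<close>
        proof
          assume u': "u' = v"
          have "?d (centre v) P = 0" unfolding P_def *(6)[symmetric] u' by (simp add: det3_linear)
          then show False using pos[OF ax ay] left[of l m] unfolding P_def by linarith
        next
          assume u': "u' = u"
          have "?d P (centre u) = 0" unfolding P_def *(6)[symmetric] u' by (simp add: det3_linear)
          then show False using pos[OF xb yb] right[of l m] unfolding P_def by linarith
        qed
      qed
    qed
  qed
qed

text \<open>Of the two gaps between the cells at \<open>e\<close>, one is covered by the previous lemma. The other
  follows, since both parities jump by the same amount at \<open>e\<close>.\<close>

lemma parity_across:
  assumes z: "z \<in> even_subgraphs V K ends" and uv: "u \<noteq> v" and \<sigma>: "\<sigma> = 1 \<or> \<sigma> = - 1"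
    and x: "adj (- \<sigma>) v e x" and y: "adj \<sigma> u e y"
  shows "parity z (near e x) = parity z (near e y)"
proof -
  have ex: "e \<in> star v" and ey: "e \<in> star u" using x y by (auto simp: adj_def)
  obtain x' where x': "adj \<sigma> v e x'" using ex_adj[OF ex \<sigma>] by blast
  obtain y' where y': "adj (- \<sigma>) u e y'" using ex_adj[OF ey, of "- \<sigma>"] \<sigma> by auto
  consider "\<sigma> * det3 (w e) (centre v) (centre u) \<ge> 0" | "- \<sigma> * det3 (w e) (centre v) (centre u) \<ge> 0" by linarith
  then show ?thesis
  proof cases
    case 1
    show ?thesis by (rule parity_across_aux[OF z \<sigma> x y uv 1])
  next
    case 2
    have "parity z (near e x') = parity z (near e y')"
      by (rule parity_across_aux[OF z _ _ _ uv 2]) (use x' y' \<sigma> in auto)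
    moreover have "parity z (near e x) \<noteq> parity z (near e x') \<longleftrightarrow> e \<in> z"
      using \<sigma> parity_jump[OF z, of v e x x'] parity_jump[OF z, of v e x' x] x x' by auto
    moreover have "parity z (near e y) \<noteq> parity z (near e y') \<longleftrightarrow> e \<in> z"
      using \<sigma> parity_jump[OF z, of u e y y'] parity_jump[OF z, of u e y' y] y y' by auto
    ultimately show ?thesis by blast
  qed
qed

lemma card_contacts_le_drawn:
  assumes K: "K \<noteq> {}"
    and bip: "\<And>e u v. e \<in> K \<Longrightarrow> u \<noteq> v \<Longrightarrow> u \<in> ends e \<Longrightarrow> v \<in> ends e \<Longrightarrow> col u \<noteq> (col v :: bool)"
  shows "card K + 4 \<le> 2 * card V"
proof -
  define sg where "sg b = (if b then 1 else - 1 :: real)" for b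
  have sg: "sg b = 1 \<or> sg b = - 1" "sg (\<not> b) = - sg b" for b by (auto simp: sg_def)
  define nb where "nb v e b = (SOME e'. adj (sg b) v e e')" for v e b
  have nb: "adj (sg b) v e (nb v e b)" if "e \<in> star v" for v e b
    unfolding nb_def by (rule someI_ex) (rule ex_adj[OF that sg(1)])
  define val where "val z = (\<lambda>(v, e, b). parity z (near e (nb v e b)))" for z
  show ?thesis
  proof (rule euler_bound[OF finite_V finite_K K ends simple bip, where val = val])
    fix v e b assume "e \<in> K" "v \<in> ends e"
    then have e: "e \<in> star v" by (simp add: star_iff)
    let ?e' = "nb v e b"
    have e': "?e' \<in> star v" "?e' \<noteq> e" using nb[OF e, of b] by (auto simp: adj_def)
    have "nb v ?e' (\<not> b) = e"
      using adj_unique[OF nb[OF e'(1), of "\<not> b", unfolded sg(2)] adj_sym[OF nb[OF e]]] .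
    then have "val z (v, e, b) = val z (v, ?e', \<not> b)" if "z \<in> even_subgraphs V K ends" for z
      using parity_along_side[OF that nb[OF e, of b]] by (simp add: val_def)
    then show "\<exists>e'\<in>K. v \<in> ends e' \<and> e' \<noteq> e \<and> (\<forall>z\<in>even_subgraphs V K ends. val z (v, e, b) = val z (v, e', \<not> b))"
      using e' unfolding star_iff by blast
  next
    fix u v e b z assume *: "e \<in> K" "u \<noteq> v" "u \<in> ends e" "v \<in> ends e" "z \<in> even_subgraphs V K ends"
    then have "e \<in> star v" "e \<in> star u" by (auto simp: star_iff)
    then have "adj (- sg (\<not> b)) v e (nb v e b)" "adj (sg (\<not> b)) u e (nb u e (\<not> b))"
      using nb[of e v b] nb[of e u "\<not> b"] by (auto simp: sg(2))
    then show "val z (v, e, b) = val z (u, e, \<not> b)"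
      using parity_across[OF *(5,2) sg(1)] by (simp add: val_def)
  next
    fix v e z assume *: "e \<in> K" "v \<in> ends e" "z \<in> even_subgraphs V K ends"
    then have e: "e \<in> star v" by (simp add: star_iff)
    show "val z (v, e, True) \<noteq> val z (v, e, False) \<longleftrightarrow> e \<in> z"
      using parity_jump[OF *(3)] nb[OF e, of True] nb[OF e, of False] by (simp add: val_def sg_def)
  qed
qed

end

context touching_cells_deg3
begin

lemma eventually_crosses_spoke:
  assumes e1: "adj 1 v e e1" and e2: "adj (- 1) v e e2"
  shows "\<forall>\<^sub>F \<epsilon> in at_right 0. \<exists>t>0. \<exists>l>0. \<exists>m>0.
    centre v + t *\<^sub>R w e = l *\<^sub>R (w e + \<epsilon> *\<^sub>R w e1) + m *\<^sub>R (w e + \<epsilon> *\<^sub>R w e2)"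
proof -
  have e: "e \<in> star v" "e1 \<in> star v" "e2 \<in> star v" "e \<noteq> e1" "e \<noteq> e2" using e1 e2 by (auto simp: adj_def)
  have e12: "e1 \<noteq> e2" using adj_opposite[OF e1 e2] .
  have "1 * det3 (w e) (w e1) (w e2) > 0" using e1 e e12 unfolding adj_def by metis
  then have D: "det3 (w e) (w e1) (w e2) > 0" by simp
  then have "det3 (w e) (w e1) (w e2) \<noteq> 0" by simp
  from coordinates_exist[OF this, of "centre v"] obtain x y z where c: "centre v = x *\<^sub>R w e + y *\<^sub>R w e1 + z *\<^sub>R w e2"
    and yz: "y = - det3 (centre v) (w e) (w e2) / det3 (w e) (w e1) (w e2)" "z = det3 (w e) (w e1) (centre v) / det3 (w e) (w e1) (w e2)"
    by metis
  have "- det3 (centre v) (w e) (w e2) > 0"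
    using adj_centre[OF e2] det3_swap(1)[of "w e" "centre v" "w e2"] det3_swap(2)[of "w e" "centre v" "w e2"] by simp
  then have y: "y > 0" unfolding yz using D by (simp add: divide_neg_pos)
  have "z > 0" unfolding yz using adj_centre[OF e1] D by simp
  then have yz0: "y + z > 0" using y by simp
  have "((\<lambda>\<epsilon>. \<epsilon> * x) \<longlongrightarrow> 0 * x) (at_right 0)" by (intro tendsto_intros)
  then have "((\<lambda>\<epsilon>. \<epsilon> * x) \<longlongrightarrow> 0) (at_right 0)" by simp
  then have "\<forall>\<^sub>F \<epsilon> in at_right 0. \<epsilon> * x < y + z" using yz0 by (rule order_tendstoD(2))
  then show ?thesis using eventually_at_right_less[of "0 :: real"]
  proof eventually_elim
    case (elim \<epsilon>)
    have "(y + z) / \<epsilon> - x > 0" using elim by (simp add: field_simps)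
    moreover have "y / \<epsilon> > 0" "z / \<epsilon> > 0" using y \<open>z > 0\<close> elim by simp_all
    moreover have "centre v + ((y + z) / \<epsilon> - x) *\<^sub>R w e = (y / \<epsilon>) *\<^sub>R (w e + \<epsilon> *\<^sub>R w e1) + (z / \<epsilon>) *\<^sub>R (w e + \<epsilon> *\<^sub>R w e2)"
      unfolding c using elim by (simp add: algebra_simps add_divide_distrib)
    ultimately show ?case by blast
  qed
qed

text \<open>All conditions on \<open>\<epsilon>\<close> hold for small positive values, and the point \<open>g\<close> is chosen afterwards
  in general position to the finitely many points of the drawing and of the tests.\<close>

theorem card_contacts_le:
  assumes bip: "\<And>e u v. e \<in> K \<Longrightarrow> u \<noteq> v \<Longrightarrow> u \<in> ends e \<Longrightarrow> v \<in> ends e \<Longrightarrow> col u \<noteq> (col v :: bool)"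
    and K: "K \<noteq> {}"
  shows "card K + 4 \<le> 2 * card V"
proof -
  let ?A = "w ` K \<union> centre ` V"
  let ?P1 = "\<lambda>\<epsilon>. \<forall>v\<in>V. \<forall>e\<in>star v. \<forall>f\<in>star v. \<forall>s\<in>?A. e \<noteq> f \<longrightarrow> cross3 s (w e + \<epsilon> *\<^sub>R w f) \<noteq> 0"
  let ?P2 = "\<lambda>\<epsilon>. \<forall>u\<in>V. \<forall>f\<in>star u. \<forall>e\<in>K. \<forall>s\<in>K. \<forall>t\<in>K. f \<noteq> e \<longrightarrow>
      \<not> arcs_meet (w e + \<epsilon> *\<^sub>R w s) (w e + \<epsilon> *\<^sub>R w t) (centre u) (w f)"
  let ?P3 = "\<lambda>\<epsilon>. \<forall>v\<in>V. \<forall>e\<in>star v. \<forall>e1\<in>star v. \<forall>e2\<in>star v. adj 1 v e e1 \<longrightarrow> adj (- 1) v e e2 \<longrightarrow>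
      (\<exists>t>0. \<exists>l>0. \<exists>m>0. centre v + t *\<^sub>R w e = l *\<^sub>R (w e + \<epsilon> *\<^sub>R w e1) + m *\<^sub>R (w e + \<epsilon> *\<^sub>R w e2))"
  have finA: "finite ?A" using finite_K finite_V by simp
  have A0: "s \<noteq> 0" if "s \<in> ?A" for s using that nonzero centre_nonzero by auto
  have 1: "\<forall>\<^sub>F \<epsilon> in at_right 0. ?P1 \<epsilon>"
  proof (intro eventually_ball_finite finite_V finite_star finA ballI)
    fix v e f s assume *: "v \<in> V" "e \<in> star v" "f \<in> star v" "s \<in> ?A"
    show "\<forall>\<^sub>F \<epsilon> in at_right 0. e \<noteq> f \<longrightarrow> cross3 s (w e + \<epsilon> *\<^sub>R w f) \<noteq> 0"
    proof (cases "e = f")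
      case False
      have "\<forall>\<^sub>F \<epsilon> in at_right 0. cross3 s (w e + \<epsilon> *\<^sub>R w f) \<noteq> 0"
        using star_not_parallel[OF *(2,3)] False A0[OF *(4)] by (intro eventually_not_parallel) auto
      then show ?thesis by (rule eventually_mono) simp
    qed simp
  qed
  have 2: "\<forall>\<^sub>F \<epsilon> in at_right 0. ?P2 \<epsilon>"
  proof (intro eventually_ball_finite finite_V finite_star finite_K ballI)
    fix u f e s t assume *: "u \<in> V" "f \<in> star u" "e \<in> K" "s \<in> K" "t \<in> K"
    show "\<forall>\<^sub>F \<epsilon> in at_right 0. f \<noteq> e \<longrightarrow> \<not> arcs_meet (w e + \<epsilon> *\<^sub>R w s) (w e + \<epsilon> *\<^sub>R w t) (centre u) (w f)"
    proof (cases "f = e")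
      case False
      have "\<forall>\<^sub>F \<epsilon> in at_right 0. \<not> arcs_meet (w e + \<epsilon> *\<^sub>R w s) (w e + \<epsilon> *\<^sub>R w t) (centre u) (w f)"
        by (intro eventually_arcs_disjoint contact_not_on_spoke[OF *(3,2) False] spoke_nonzero[OF *(2)])
      then show ?thesis by (rule eventually_mono) simp
    qed simp
  qed
  have 3: "\<forall>\<^sub>F \<epsilon> in at_right 0. ?P3 \<epsilon>"
  proof (intro eventually_ball_finite finite_V finite_star ballI)
    fix v e e1 e2
    show "\<forall>\<^sub>F \<epsilon> in at_right 0. adj 1 v e e1 \<longrightarrow> adj (- 1) v e e2 \<longrightarrow>
      (\<exists>t>0. \<exists>l>0. \<exists>m>0. centre v + t *\<^sub>R w e = l *\<^sub>R (w e + \<epsilon> *\<^sub>R w e1) + m *\<^sub>R (w e + \<epsilon> *\<^sub>R w e2))"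
    proof (cases "adj 1 v e e1 \<and> adj (- 1) v e e2")
      case True
      then show ?thesis using eventually_crosses_spoke[of v e e1 e2] by (simp add: eventually_mono)
    qed auto
  qed
  have 4: "\<forall>\<^sub>F \<epsilon> in at_right (0 :: real). 0 < \<epsilon> \<and> \<epsilon> < 1"
    using eventually_at_right_real[of "0 :: real" 1] by (auto elim: eventually_mono)
  have "\<exists>\<epsilon>. ?P1 \<epsilon> \<and> ?P2 \<epsilon> \<and> ?P3 \<epsilon> \<and> 0 < \<epsilon> \<and> \<epsilon> < 1"
    by (rule eventually_happens'[OF _ eventually_conj[OF 1 eventually_conj[OF 2 eventually_conj[OF 3 4]]]])
      (rule trivial_limit_at_right_real)
  then obtain \<epsilon> where E: "?P1 \<epsilon>" "?P2 \<epsilon>" "?P3 \<epsilon>" "0 < \<epsilon>" "\<epsilon> < 1"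
    by (elim exE conjE) (rule that)
  have "finite (?A \<union> (\<lambda>(e, f). w e + \<epsilon> *\<^sub>R w f) ` (K \<times> K))" using finA finite_K by simp
  from ex_generic[OF this] obtain g where g: "generic g (?A \<union> (\<lambda>(e, f). w e + \<epsilon> *\<^sub>R w f) ` (K \<times> K))" .
  interpret drawing V K ends w \<epsilon> g
  proof
    show "cross3 s (w e + \<epsilon> *\<^sub>R w f) \<noteq> 0" if "e \<in> star v" "f \<in> star v" "e \<noteq> f" "s \<in> ?A" for e v f s
      using E(1) star_in_V[OF that(1)] that by blast
    show "\<not> arcs_meet (w e + \<epsilon> *\<^sub>R w s) (w e + \<epsilon> *\<^sub>R w t) (centre u) (w f)"
      if "e \<in> K" "s \<in> K" "t \<in> K" "f \<in> star u" "f \<noteq> e" for e s t f u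
      using E(2) star_in_V[OF that(4)] that by blast
    show "\<exists>t>0. \<exists>l>0. \<exists>m>0. centre v + t *\<^sub>R w e = l *\<^sub>R (w e + \<epsilon> *\<^sub>R w e1) + m *\<^sub>R (w e + \<epsilon> *\<^sub>R w e2)"
      if "adj 1 v e e1" "adj (- 1) v e e2" for v e e1 e2
    proof -
      have "e \<in> star v" "e1 \<in> star v" "e2 \<in> star v" using that by (auto simp: adj_def)
      then show ?thesis using E(3) star_in_V that by blast
    qed
  qed (rule E(4) E(5) g)+
  show ?thesis by (rule card_contacts_le_drawn[OF K bip])
qed

end

section \<open>Antipodal closed curves\<close>

context touching_cells
begin

text \<open>The contacts \<open>e k\<close> form a closed curve of arcs inside the cells, which is its own antipode,
  and so do the contacts \<open>e' k\<close>. If the cells are distinct the curves are disjoint, so the winding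
  parity of the first is constant along the second, contrary to its change between antipodal
  points.\<close>

lemma no_disjoint_antipodal_cycles:
  fixes e e' :: "nat \<Rightarrow> 'e" and v v' :: "nat \<Rightarrow> 'v"
  assumes e: "\<And>k. e k \<in> star (v k)" "\<And>k. e k \<in> star (v (Suc k))" "\<And>k. e k \<noteq> e (Suc k)"
    and e': "\<And>k. e' k \<in> star (v' k)" "\<And>k. e' k \<in> star (v' (Suc k))" "\<And>k. e' k \<noteq> e' (Suc k)"
    and v: "\<And>k. v k \<noteq> v (Suc k)"
    and disj: "\<And>k l. v k \<noteq> v' l"
    and anti: "\<And>k. w (e (k + m)) = - w (e k)" and anti': "\<And>k. w (e' (k + m')) = - w (e' k)"
  shows False
proof -
  have shared: "i \<noteq> e k" if "i \<in> star (v' l)" for i k l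
  proof
    assume "i = e k"
    then have "v' l \<in> ends (e k)" "v k \<in> ends (e k)" "v (Suc k) \<in> ends (e k)" "card (ends (e k)) = 2"
      using that e ends by (auto simp: star_iff)
    then show False using disj[of k l] disj[of "Suc k" l] v[of k] by (auto simp: card_2_iff)
  qed
  have arc: "\<alpha> *\<^sub>R w (e k) + \<beta> *\<^sub>R w (e (Suc k)) \<notin> cell (v' l)" if ab: "\<alpha> \<ge> 0" "\<beta> \<ge> 0" "\<alpha> + \<beta> > 0" and l: "v' l \<in> V" for \<alpha> \<beta> k l
  proof
    define P where "P = \<alpha> *\<^sub>R w (e k) + \<beta> *\<^sub>R w (e (Suc k))"
    assume "\<alpha> *\<^sub>R w (e k) + \<beta> *\<^sub>R w (e (Suc k)) \<in> cell (v' l)"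
    then have Pl: "P \<in> cell (v' l)" by (simp add: P_def)
    have Pk: "P \<in> cell (v (Suc k))" unfolding P_def using e ab by (intro cell_add cell_scale contact_in_cell)
    have off: "P \<noteq> s *\<^sub>R w i" if i: "i \<in> star (v (Suc k))" "(i \<noteq> e k \<and> i \<noteq> e (Suc k)) \<or> s = 0" for i s
    proof -
      have *: "P \<noteq> s *\<^sub>R w j" if j: "j \<in> star (v (Suc k))" "j \<noteq> e k" "\<alpha> > 0" for j s
      proof -
        have "\<beta> *\<^sub>R w (e (Suc k)) \<in> cell (v (Suc k))" using e ab by (intro cell_scale contact_in_cell)
        from not_on_ray[OF j(1) e(2) j(2)[symmetric] this j(3)] show ?thesis by (simp add: P_def add.commute)
      qed
      have **: "P \<noteq> s *\<^sub>R w j" if j: "j \<in> star (v (Suc k))" "j \<noteq> e (Suc k)" "\<beta> > 0" for j s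
      proof -
        have "\<alpha> *\<^sub>R w (e k) \<in> cell (v (Suc k))" using e ab by (intro cell_scale contact_in_cell)
        from not_on_ray[OF j(1) e(1) j(2)[symmetric] this j(3)] show ?thesis by (simp add: P_def)
      qed
      consider "\<alpha> > 0" | "\<beta> > 0" using ab by linarith
      then show ?thesis
      proof cases
        case 1
        show ?thesis using i(2)
        proof
          assume "s = 0"
          then show ?thesis using *[OF e(1)[of "Suc k"] e(3)[of k, symmetric] 1, of 0] by simp
        qed (use *[OF i(1) _ 1] in blast)
      next
        case 2
        show ?thesis using i(2)
        proof
          assume "s = 0"
          then show ?thesis using **[OF e(2)[of k] e(3)[of k] 2, of 0] by simp
        qed (use **[OF i(1) _ 2] in blast)
      qed
    qed
    have P0: "P \<noteq> 0" using off[OF e(2)[of k], of 0] by simp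
    obtain i s where i: "i \<in> star (v (Suc k))" "i \<in> star (v' l)" "P = s *\<^sub>R w i"
      by (rule cells_touch[OF Pk Pl star_in_V[OF e(2)] l disj P0])
    then show False using off[OF i(1)] shared[OF i(2)] by blast
  qed
  have V': "v' l \<in> V" for l using star_in_V[OF e'(1)] .
  have np: "cross3 (w (e k)) (w (e' l)) \<noteq> 0" for k l
  proof
    assume z: "cross3 (w (e k)) (w (e' l)) = 0"
    define N where "N = w (e k) \<bullet> w (e k)"
    define M where "M = w (e k) \<bullet> w (e' l)"
    have wk: "w (e k) \<noteq> 0" and wl: "w (e' l) \<noteq> 0" using nonzero e e' by (auto simp: star_iff)
    then have N: "N > 0" by (simp add: N_def)
    have "cross3 (w (e k)) (cross3 (w (e k)) (w (e' l))) = M *\<^sub>R w (e k) - N *\<^sub>R w (e' l)"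
      unfolding M_def N_def by (rule Lagrange)
    then have eq: "M *\<^sub>R w (e k) = N *\<^sub>R w (e' l)" using z by simp
    \<comment> \<open>a negative factor turns positive at the opposite contact, \<open>m\<close> steps later\<close>
    have pos: False if "s *\<^sub>R w (e j) = N *\<^sub>R w (e' l)" "s > 0" for s j
    proof -
      have "N *\<^sub>R w (e' l) \<in> cell (v' l)" using N e' by (intro cell_scale contact_in_cell) auto
      then show False using arc[of s 0 l j] that V' by simp
    qed
    have "M \<noteq> 0" using eq N wl by auto
    then consider "M > 0" | "- M > 0" by linarith
    then show False
    proof cases
      case 1
      then show False using pos eq by blast
    next
      case 2
      have "(- M) *\<^sub>R w (e (k + m)) = N *\<^sub>R w (e' l)" using eq by (simp add: anti)
      then show False using pos 2 by blast
    qed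
  qed
  obtain g where g: "generic g (w ` K)" using ex_generic[of "w ` K"] finite_K by blast
  have inK: "w (e k) \<in> w ` K" "w (e' k) \<in> w ` K" for k using e e' by (auto simp: star_iff)
  have gen: "det3 s t g \<noteq> 0" if "s \<in> w ` K" "t \<in> w ` K" "cross3 s t \<noteq> 0" for s t
    using g that unfolding generic_def by blast
  define u where "u k = w (e k)" for k
  have up: "u (k + m + m) = u k" for k unfolding u_def anti by simp
  have closed: "closed_chain {..<2 * m} u (\<lambda>k. u (Suc k))" unfolding closed_chain_def
  proof (intro conjI allI)
    fix P
    have "(\<Sum>k<2 * m. of_bool (P (u (Suc k)))) + of_bool (P (u 0)) = (\<Sum>k<2 * m. of_bool (P (u k))) + (of_bool (P (u (2 * m))) :: nat)"
      using sum.lessThan_Suc_shift[of "\<lambda>k. of_bool (P (u k)) :: nat" "2 * m"]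
      by (simp only: sum.lessThan_Suc add.commute)
    moreover have "u (2 * m) = u 0" using up[of 0] by (simp add: mult_2)
    ultimately have "(\<Sum>k<2 * m. of_bool (P (u (Suc k)))) = (\<Sum>k<2 * m. of_bool (P (u k)) :: nat)" by simp
    then show "even (\<Sum>k<2 * m. of_bool (P (u k)) + of_bool (P (u (Suc k))) :: nat)" by (simp add: sum.distrib)
  qed simp
  let ?I = "winding_parity g {..<2 * m} u (\<lambda>k. u (Suc k))"
  have step: "?I (w (e' l)) = ?I (w (e' (Suc l)))" for l
  proof (rule winding_parity_eq[OF closed g inK(2) inK(2)])
    show "cross3 (w (e' l)) (w (e' (Suc l))) \<noteq> 0" using star_not_parallel[OF e'(2) e'(1) e'(3)[symmetric]] .
    fix k
    show "u k \<in> w ` K \<and> u (Suc k) \<in> w ` K" unfolding u_def using inK by blast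
    show "cross3 (u k) (u (Suc k)) \<noteq> 0" unfolding u_def using star_not_parallel[OF e(2) e(1) e(3)[symmetric]] .
    show "cross3 (u k) (w (e' l)) \<noteq> 0" "cross3 (u k) (w (e' (Suc l))) \<noteq> 0"
      "cross3 (u (Suc k)) (w (e' l)) \<noteq> 0" "cross3 (u (Suc k)) (w (e' (Suc l))) \<noteq> 0"
      unfolding u_def by (rule np)+
    show "\<not> arcs_meet (w (e' l)) (w (e' (Suc l))) (u k) (u (Suc k))"
    proof
      assume "arcs_meet (w (e' l)) (w (e' (Suc l))) (u k) (u (Suc k))"
      then obtain \<alpha> \<beta> s t where *: "\<alpha> \<ge> 0" "\<beta> \<ge> 0" "s \<ge> 0" "t \<ge> 0" "\<alpha> + \<beta> > 0"
        "\<alpha> *\<^sub>R u k + \<beta> *\<^sub>R u (Suc k) = s *\<^sub>R w (e' l) + t *\<^sub>R w (e' (Suc l))" unfolding arcs_meet_def by blast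
      have "s *\<^sub>R w (e' l) + t *\<^sub>R w (e' (Suc l)) \<in> cell (v' (Suc l))"
        using e' * by (intro cell_add cell_scale contact_in_cell)
      then show False using arc[OF *(1,2,5) V'] *(6) unfolding u_def by metis
    qed
  qed
  have "?I (w (e' l)) = ?I (w (e' 0))" for l
    by (induction l) (use step in auto)
  then have "?I (w (e' 0)) = ?I (- w (e' 0))" using anti'[of 0] by metis
  moreover have "?I (w (e' 0)) \<noteq> ?I (- w (e' 0))"
  proof (rule antipodal_winding_parity)
    fix k and \<alpha> \<beta> :: real
    show "u (k + m) = - u k" unfolding u_def by (rule anti)
    have "cross3 (w (e' 0)) (u k) \<noteq> 0" using np[of k 0] cross_skew[of "w (e' 0)" "u k"] by (simp add: u_def)
    then show "det3 (w (e' 0)) (u k) g \<noteq> 0" unfolding u_def by (rule gen[OF inK(2) inK(1)])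
    have "cross3 (u k) (u (Suc k)) \<noteq> 0" unfolding u_def using star_not_parallel[OF e(2) e(1) e(3)[symmetric]] .
    then show "det3 (u k) (u (Suc k)) g \<noteq> 0" unfolding u_def by (rule gen[OF inK(1) inK(1)])
    assume ab: "\<alpha> \<ge> 0" "\<beta> \<ge> 0"
    show "\<alpha> *\<^sub>R u k + \<beta> *\<^sub>R u (Suc k) \<noteq> w (e' 0)"
    proof
      assume eq: "\<alpha> *\<^sub>R u k + \<beta> *\<^sub>R u (Suc k) = w (e' 0)"
      have "w (e' 0) \<noteq> 0" using nonzero e' by (auto simp: star_iff)
      then have "\<alpha> \<noteq> 0 \<or> \<beta> \<noteq> 0" using eq by auto
      then have "\<alpha> + \<beta> > 0" using ab by linarith
      from arc[OF ab this V'[of 0], of k] show False using eq contact_in_cell[OF e'(1)[of 0]] unfolding u_def by metis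
    qed
  qed
  ultimately show False by blast
qed

end

section \<open>Sets on a sphere with bounded distances\<close>

lemma unit_inner_le:
  fixes x y :: "'a::real_inner"
  assumes "x \<bullet> x = 1" "y \<bullet> y = 1"
  shows "x \<bullet> y \<le> 1"
proof -
  have "(x - y) \<bullet> (x - y) \<ge> 0" by simp
  then show ?thesis using assms by (simp add: inner_diff_left inner_diff_right inner_commute)
qed

lemma unit_inner_eq_1:
  fixes x y :: "'a::real_inner"
  assumes "x \<bullet> x = 1" "y \<bullet> y = 1" "x \<bullet> y = 1"
  shows "x = y"
proof -
  have "(x - y) \<bullet> (x - y) = 0" using assms by (simp add: inner_diff_left inner_diff_right inner_commute)
  then show ?thesis by simp
qed

lemma unit_inner_less:
  fixes x y :: "'a::real_inner"
  assumes "x \<bullet> x = 1" "y \<bullet> y = 1" "x \<noteq> y"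
  shows "x \<bullet> y < 1"
  using unit_inner_le[OF assms(1,2)] unit_inner_eq_1[OF assms(1,2)] assms(3) by fastforce

text \<open>The bound \<open>t\<close> on inner products is an upper bound on distances. It being positive is what
  remains of the bound on the radius of the sphere.\<close>
locale spherical_cluster =
  fixes Y :: "'a::euclidean_space set" and t :: real
  assumes finite_Y: "finite Y" and unit: "x \<in> Y \<Longrightarrow> x \<bullet> x = 1"
    and close: "x \<in> Y \<Longrightarrow> y \<in> Y \<Longrightarrow> t \<le> x \<bullet> y"
    and t: "0 < t" "t < 1"
begin

definition nbrs :: "'a \<Rightarrow> 'a set" where
  "nbrs x = {y \<in> Y. x \<bullet> y = t}"

lemma finite_nbrs [simp]: "finite (nbrs x)"
  using finite_Y by (simp add: nbrs_def)

lemma nbrs_sym: "x \<in> Y \<Longrightarrow> y \<in> nbrs x \<Longrightarrow> x \<in> nbrs y"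
  by (auto simp: nbrs_def inner_commute)

lemma sum_inner_ge:
  assumes "\<And>y. y \<in> nbrs x \<Longrightarrow> c y \<ge> 0" "\<And>y. y \<in> nbrs x \<Longrightarrow> t \<le> z \<bullet> y"
  shows "t * (\<Sum>y\<in>nbrs x. c y) \<le> (\<Sum>y\<in>nbrs x. c y *\<^sub>R y) \<bullet> z"
proof -
  have "(\<Sum>y\<in>nbrs x. t * c y) \<le> (\<Sum>y\<in>nbrs x. c y * (y \<bullet> z))"
  proof (rule sum_mono)
    fix y assume y: "y \<in> nbrs x"
    have "c y * t \<le> c y * (y \<bullet> z)"
      using assms y by (intro mult_left_mono) (auto simp: inner_commute)
    then show "t * c y \<le> c y * (y \<bullet> z)" by (simp add: mult.commute)
  qed
  then show ?thesis by (simp add: sum_distrib_left inner_sum_left)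
qed

lemma sum_inner_le:
  assumes "\<And>y. y \<in> nbrs x \<Longrightarrow> c y \<ge> 0" "z \<bullet> z = 1"
  shows "(\<Sum>y\<in>nbrs x. c y *\<^sub>R y) \<bullet> z \<le> (\<Sum>y\<in>nbrs x. c y)"
proof -
  have "(\<Sum>y\<in>nbrs x. c y * (y \<bullet> z)) \<le> (\<Sum>y\<in>nbrs x. c y * 1)"
    by (intro sum_mono mult_left_mono unit_inner_le) (use assms unit in \<open>auto simp: nbrs_def\<close>)
  then show ?thesis by (simp add: inner_sum_left)
qed

lemma sum_inner_eq: "(\<Sum>y\<in>nbrs x. c y *\<^sub>R y) \<bullet> x = t * (\<Sum>y\<in>nbrs x. c y)"
proof -
  have "(\<Sum>y\<in>nbrs x. c y *\<^sub>R y) \<bullet> x = (\<Sum>y\<in>nbrs x. c y * (y \<bullet> x))" by (simp add: inner_sum_left)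
  also have "\<dots> = (\<Sum>y\<in>nbrs x. t * c y)" by (intro sum.cong) (auto simp: nbrs_def inner_commute)
  finally show ?thesis by (simp add: sum_distrib_left)
qed

text \<open>The point \<open>P\<close> of the sphere is the point at the neighbour distance from \<open>x\<close> in the direction
  of the given combination of neighbours. It behaves like a new point of the set: a point that is
  close to all neighbours of \<open>x\<close> is close to \<open>P\<close>, because replacing the combination by \<open>P\<close> removes
  a nonnegative multiple of \<open>x\<close>.\<close>

lemma hull_point:
  assumes x: "x \<in> Y" and c: "\<And>y. y \<in> nbrs x \<Longrightarrow> c y \<ge> 0" and pos: "(\<Sum>y\<in>nbrs x. c y) > 0"
  obtains P \<kappa> \<gamma> where "\<kappa> > 0" "P \<bullet> P = 1" "P \<bullet> x = t" "(\<Sum>y\<in>nbrs x. c y *\<^sub>R y) = \<kappa> *\<^sub>R P + \<gamma> *\<^sub>R x"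
    "\<And>z. z \<bullet> z = 1 \<Longrightarrow> (\<And>y. y \<in> nbrs x \<Longrightarrow> t \<le> z \<bullet> y) \<Longrightarrow> t \<le> P \<bullet> z"
proof -
  define A where "A = (\<Sum>y\<in>nbrs x. c y *\<^sub>R y)"
  define a where "a = (\<Sum>y\<in>nbrs x. c y)"
  have a: "a > 0" using pos by (simp add: a_def)
  have xx: "x \<bullet> x = 1" using unit x by simp
  have Ax: "A \<bullet> x = t * a" unfolding A_def a_def by (rule sum_inner_eq)
  have Ay: "t * a \<le> A \<bullet> y" if "y \<in> nbrs x" for y
    unfolding A_def a_def using c that close by (intro sum_inner_ge) (auto simp: nbrs_def)
  have AA: "A \<bullet> A = (\<Sum>y\<in>nbrs x. c y * (A \<bullet> y))" 
  proof -
    have "A \<bullet> (\<Sum>y\<in>nbrs x. c y *\<^sub>R y) = (\<Sum>y\<in>nbrs x. c y * (A \<bullet> y))" by (simp add: inner_sum_right)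
    then show ?thesis unfolding A_def[symmetric] .
  qed
  have "(\<Sum>y\<in>nbrs x. c y * (t * a)) \<le> A \<bullet> A" unfolding AA using c Ay by (intro sum_mono mult_left_mono)
  then have AAge: "t * a\<^sup>2 \<le> A \<bullet> A" unfolding sum_distrib_right[symmetric] a_def[symmetric] by (simp add: power2_eq_square mult_ac)
  have Ayle: "A \<bullet> y \<le> a" if "y \<in> nbrs x" for y
    unfolding A_def a_def using c that unit by (intro sum_inner_le) (auto simp: nbrs_def)
  have "A \<bullet> A \<le> (\<Sum>y\<in>nbrs x. c y * a)" unfolding AA using c Ayle by (intro sum_mono mult_left_mono)
  then have AAle: "A \<bullet> A \<le> a\<^sup>2" unfolding sum_distrib_right[symmetric] a_def[symmetric] by (simp add: power2_eq_square)
  define B where "B = A - (t * a) *\<^sub>R x"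
  have Bx: "B \<bullet> x = 0" unfolding B_def by (simp add: inner_diff_left Ax xx)
  have BB: "B \<bullet> B = A \<bullet> A - t\<^sup>2 * a\<^sup>2"
    unfolding B_def by (simp add: inner_diff_left inner_diff_right inner_commute[of x A] Ax xx power2_eq_square algebra_simps)
  have t2: "t\<^sup>2 < t" using t by (simp add: power2_eq_square)
  have t1: "1 - t\<^sup>2 > 0" using t t2 by linarith
  have "t\<^sup>2 * a\<^sup>2 < t * a\<^sup>2" using t2 a by simp
  then have Bpos: "B \<bullet> B > 0" using AAge BB by linarith
  have Ble: "B \<bullet> B \<le> a\<^sup>2 * (1 - t\<^sup>2)" using AAle BB by (simp add: algebra_simps)
  \<comment> \<open>chosen so that \<open>P\<close> is a unit vector at the neighbour distance from \<open>x\<close>\<close>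
  define k where "k = sqrt (B \<bullet> B / (1 - t\<^sup>2))"
  have k: "k > 0" unfolding k_def using Bpos t1 by simp
  have k2: "k\<^sup>2 = B \<bullet> B / (1 - t\<^sup>2)" unfolding k_def using Bpos t1 by simp
  have "k\<^sup>2 \<le> a\<^sup>2" unfolding k2 using Ble t1 by (simp add: divide_le_eq)
  then have ka: "k \<le> a" using a k by (simp add: power2_le_iff_abs_le)
  define P where "P = t *\<^sub>R x + (1 / k) *\<^sub>R B"
  have "B \<bullet> B = k\<^sup>2 * (1 - t\<^sup>2)" using k2 t1 by simp
  then have PP: "P \<bullet> P = 1" unfolding P_def using k
    by (simp add: inner_add_left inner_add_right Bx inner_commute[of x B] xx power2_eq_square)
  have Px: "P \<bullet> x = t" unfolding P_def by (simp add: inner_add_left Bx xx)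
  have A: "A = k *\<^sub>R P + (t * (a - k)) *\<^sub>R x" unfolding P_def B_def using k by (simp add: algebra_simps)
  have "t \<le> P \<bullet> z" if z: "z \<bullet> z = 1" "\<And>y. y \<in> nbrs x \<Longrightarrow> t \<le> z \<bullet> y" for z
  proof -
    have "t * a \<le> A \<bullet> z" unfolding A_def a_def using c z(2) by (intro sum_inner_ge)
    also have "A \<bullet> z = k * (P \<bullet> z) + t * (a - k) * (x \<bullet> z)" unfolding A by (simp add: inner_add_left)
    also have "t * (a - k) * (x \<bullet> z) \<le> t * (a - k) * 1"
      using t ka by (intro mult_left_mono unit_inner_le[OF xx z(1)]) simp
    finally have "k * t \<le> k * (P \<bullet> z)" by (simp add: algebra_simps)
    then show ?thesis using k by simp
  qed
  then show ?thesis using that[OF k PP Px A[unfolded A_def]] by blast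
qed

text \<open>Otherwise the great circles from \<open>x\<close> through \<open>P\<close> and from \<open>x'\<close> through \<open>Q\<close> would meet beyond
  \<open>P\<close> and \<open>Q\<close>. But \<open>P\<close> is at least as far from \<open>x\<close> as from \<open>x'\<close>, and \<open>Q\<close> at least as far from \<open>x'\<close>
  as from \<open>x\<close>; the inner products with \<open>x\<close> and \<open>x'\<close> make this a contradiction.\<close>

lemma hulls_disjoint:
  assumes x: "x \<in> Y" "x' \<in> Y" "x \<noteq> x'" and PQ: "P \<bullet> x = t" "Q \<bullet> x' = t" "t \<le> P \<bullet> x'" "t \<le> Q \<bullet> x"
    and pos: "\<kappa> > 0" "l > 0" "\<alpha> > 0" "\<beta> > 0"
    and eq: "\<kappa> *\<^sub>R P - \<alpha> *\<^sub>R x = l *\<^sub>R Q - \<beta> *\<^sub>R x'"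
  shows False
proof -
  have s: "x \<bullet> x' < 1" using unit_inner_less unit x by blast
  have "(\<kappa> *\<^sub>R P - \<alpha> *\<^sub>R x) \<bullet> x = (l *\<^sub>R Q - \<beta> *\<^sub>R x') \<bullet> x" "(\<kappa> *\<^sub>R P - \<alpha> *\<^sub>R x) \<bullet> x' = (l *\<^sub>R Q - \<beta> *\<^sub>R x') \<bullet> x'"
    unfolding eq by simp_all
  then have 1: "\<kappa> * t - \<alpha> = l * (Q \<bullet> x) - \<beta> * (x \<bullet> x')" "\<kappa> * (P \<bullet> x') - \<alpha> * (x \<bullet> x') = l * t - \<beta>"
    using PQ unit x by (simp_all add: inner_diff_left inner_commute[of x' x])
  have "l * t \<le> l * (Q \<bullet> x)" "\<kappa> * t \<le> \<kappa> * (P \<bullet> x')" using pos PQ by simp_all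
  then have "(\<alpha> + \<beta>) * (1 - x \<bullet> x') \<le> 0" using 1 by (simp add: algebra_simps)
  moreover have "(\<alpha> + \<beta>) * (1 - x \<bullet> x') > 0" using s pos by (intro mult_pos_pos) auto
  ultimately show False by simp
qed

text \<open>The segments \<open>PQ\<close> and \<open>xx'\<close> are the diagonals of a spherical quadrilateral with opposite
  sides \<open>Px\<close> and \<open>Qx'\<close> of the greatest allowed length. Diagonals have at least the sum of two
  opposite sides, with equality only in the degenerate case. The proof is the algebraic form of
  this inequality, obtained from the inner products with \<open>P - x\<close> and \<open>Q - x'\<close>.\<close>

lemma crossing_quadrilateral:
  fixes x x' P Q :: 'a
  assumes x: "x \<bullet> x = 1" "x' \<bullet> x' = 1" and P: "P \<bullet> P = 1" "P \<bullet> x = t" "t \<le> P \<bullet> x'" and Q: "Q \<bullet> Q = 1" "Q \<bullet> x' = t" "t \<le> Q \<bullet> x"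
    and PQ: "t \<le> P \<bullet> Q" and s: "t \<le> x \<bullet> x'"
    and pos: "\<kappa> > 0" "l > 0" "\<alpha> > 0" "\<beta> > 0"
    and eq: "\<kappa> *\<^sub>R P + l *\<^sub>R Q = \<alpha> *\<^sub>R x + \<beta> *\<^sub>R x'"
  shows "P = x'" "Q = x"
proof -
  have "(\<kappa> *\<^sub>R P + l *\<^sub>R Q) \<bullet> (P - x) = (\<alpha> *\<^sub>R x + \<beta> *\<^sub>R x') \<bullet> (P - x)"
    "(\<kappa> *\<^sub>R P + l *\<^sub>R Q) \<bullet> (Q - x') = (\<alpha> *\<^sub>R x + \<beta> *\<^sub>R x') \<bullet> (Q - x')" unfolding eq by simp_all
  then have 1: "\<kappa> * (1 - t) + l * (P \<bullet> Q - Q \<bullet> x) = \<alpha> * (t - 1) + \<beta> * (P \<bullet> x' - x \<bullet> x')"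
    and 2: "\<kappa> * (P \<bullet> Q - P \<bullet> x') + l * (1 - t) = \<alpha> * (Q \<bullet> x - x \<bullet> x') + \<beta> * (t - 1)"
    using x P Q by (simp_all add: inner_diff_right inner_add_left inner_commute algebra_simps)
  define T where "T = 1 - t"
  define M where "M = Q \<bullet> x - t"
  define M' where "M' = P \<bullet> x' - t"
  have T: "T > 0" using t by (simp add: T_def)
  have M: "M \<le> T" using unit_inner_le[OF Q(1) x(1)] by (simp add: M_def T_def)
  have M': "M' \<le> T" using unit_inner_le[OF P(1) x(2)] by (simp add: M'_def T_def)
  have "l * (t - Q \<bullet> x) \<le> l * (P \<bullet> Q - Q \<bullet> x)" "\<beta> * (P \<bullet> x' - x \<bullet> x') \<le> \<beta> * (P \<bullet> x' - t)"
    "\<kappa> * (t - P \<bullet> x') \<le> \<kappa> * (P \<bullet> Q - P \<bullet> x')" "\<alpha> * (Q \<bullet> x - x \<bullet> x') \<le> \<alpha> * (Q \<bullet> x - t)"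
    using pos PQ s by (intro mult_left_mono; simp)+
  then have 3: "(\<kappa> + \<alpha>) * T \<le> l * M + \<beta> * M'" and 4: "(l + \<beta>) * T \<le> \<kappa> * M' + \<alpha> * M"
    using 1 2 unfolding T_def M_def M'_def by (simp_all add: algebra_simps)
  have 5: "0 \<le> l * (T - M)" "0 \<le> \<beta> * (T - M')" "0 \<le> \<kappa> * (T - M')" "0 \<le> \<alpha> * (T - M)" using pos M M' by simp_all
  have "l * (T - M) + \<beta> * (T - M') + \<kappa> * (T - M') + \<alpha> * (T - M) \<le> 0" using 3 4 by (simp add: algebra_simps)
  then have "l * (T - M) = 0" "\<beta> * (T - M') = 0" using 5 by linarith+
  then have "M = T" "M' = T" using pos by auto
  then have "Q \<bullet> x = 1" "P \<bullet> x' = 1" by (simp_all add: M_def M'_def T_def)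
  then show "P = x'" "Q = x" using unit_inner_eq_1 x P Q by blast+
qed

text \<open>The second neighbour \<open>z\<close> of \<open>y0\<close> shows that \<open>y0\<close> is not a combination of neighbours of \<open>x\<close>
  with larger total weight, and the norm shows that it is not one with smaller total weight. With
  equal weights, equality holds in the triangle inequality.\<close>

lemma neighbour_extreme:
  assumes x: "x \<in> Y" and y0: "y0 \<in> nbrs x" and z: "z \<in> nbrs y0" "z \<noteq> x" and c: "\<And>y. y \<in> nbrs x \<Longrightarrow> c y \<ge> 0"
    and eq: "(\<Sum>y\<in>nbrs x. c y *\<^sub>R y) = l *\<^sub>R y0 + \<mu> *\<^sub>R x"
    and y: "y \<in> nbrs x" "y \<noteq> y0"
  shows "c y = 0"
proof -
  define A where "A = (\<Sum>y\<in>nbrs x. c y *\<^sub>R y)"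
  define a where "a = (\<Sum>y\<in>nbrs x. c y)"
  have A: "A = l *\<^sub>R y0 + \<mu> *\<^sub>R x" using eq by (simp add: A_def)
  have xx: "x \<bullet> x = 1" and yy: "y0 \<bullet> y0 = 1" and zz: "z \<bullet> z = 1" and zY: "z \<in> Y" and y0Y: "y0 \<in> Y"
    using unit x y0 z by (auto simp: nbrs_def)
  have i: "y0 \<bullet> x = t" "x \<bullet> y0 = t" "y0 \<bullet> z = t" using y0 z by (auto simp: nbrs_def inner_commute)
  have "A \<bullet> x = t * a" unfolding A_def a_def by (rule sum_inner_eq)
  then have mu: "\<mu> = t * (a - l)" unfolding A by (simp add: inner_add_left i xx algebra_simps)
  have al: "a \<le> l"
  proof (rule ccontr)
    assume n: "\<not> ?thesis"
    have "t * a \<le> A \<bullet> z" unfolding A_def a_def using c zY close by (intro sum_inner_ge) (auto simp: nbrs_def)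
    also have "A \<bullet> z = l * t + t * (a - l) * (x \<bullet> z)" unfolding A mu by (simp add: inner_add_left i)
    also have "t * (a - l) * (x \<bullet> z) < t * (a - l) * 1"
      using t n unit_inner_less[OF xx zz z(2)[symmetric]] by (intro mult_strict_left_mono mult_pos_pos) auto
    finally show False by (simp add: algebra_simps)
  qed
  have Ay: "A \<bullet> y0 = l + t\<^sup>2 * (a - l)" unfolding A mu by (simp add: inner_add_left i yy power2_eq_square)
  have "A \<bullet> y0 \<le> a" unfolding A_def a_def using c yy by (intro sum_inner_le)
  then have "(l - a) * (1 - t\<^sup>2) \<le> 0" unfolding Ay by (simp add: algebra_simps)
  moreover have "t * t < 1 * 1" using t by (intro mult_strict_mono) auto
  ultimately have "l - a \<le> 0" by (simp add: mult_le_0_iff power2_eq_square)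
  then have la: "l = a" using al by simp
  have "(\<Sum>y\<in>nbrs x. c y * (1 - y \<bullet> y0)) = a - A \<bullet> y0"
    unfolding a_def A_def by (simp add: inner_sum_left right_diff_distrib sum_subtractf)
  also have "\<dots> = 0" unfolding Ay la by simp
  finally have s0: "(\<Sum>y\<in>nbrs x. c y * (1 - y \<bullet> y0)) = 0" .
  have nn: "0 \<le> c y * (1 - y \<bullet> y0)" if "y \<in> nbrs x" for y
    using c[OF that] unit_inner_le[OF unit yy, of y] that by (auto simp: nbrs_def)
  have "c y * (1 - y \<bullet> y0) = 0" using s0 nn y(1) by (simp add: sum_nonneg_eq_0_iff)
  moreover have "y \<bullet> y0 < 1" using unit_inner_less[OF unit yy y(2)] y by (auto simp: nbrs_def)
  ultimately show ?thesis by simp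
qed

end

section \<open>The cells of a cluster\<close>

lemma hyperplane_coordinates:
  fixes p :: "real^4"
  assumes "p \<noteq> 0"
  obtains L :: "real^4 \<Rightarrow> real^3" where "linear L" "\<And>x. p \<bullet> x = 0 \<Longrightarrow> L x = 0 \<Longrightarrow> x = 0"
proof -
  have "dim {x. p \<bullet> x = 0} = dim (UNIV :: (real^3) set)" using dim_hyperplane[OF assms] by simp
  then obtain f :: "real^4 \<Rightarrow> real^3" and g where f: "linear f" "\<And>x. x \<in> {x. p \<bullet> x = 0} \<Longrightarrow> norm (f x) = norm x"
    using isometries_subspaces[OF subspace_hyperplane subspace_UNIV] by metis
  have "x = 0" if "p \<bullet> x = 0" "f x = 0" for x
    using f(2)[of x] that by simp
  then show ?thesis using that f(1) by blast
qed

text \<open>The space \<open>\<real>\<^sup>3\<close> stands for the hyperplane orthogonal to \<open>p\<close>, via the map \<open>L\<close>, which is an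
  isomorphism there.\<close>
locale projected_cluster = spherical_cluster Y t for Y :: "(real^4) set" and t +
  fixes p :: "real^4" and L :: "real^4 \<Rightarrow> real^3"
  assumes p: "p \<in> Y" and L: "linear L" "\<And>x. p \<bullet> x = 0 \<Longrightarrow> L x = 0 \<Longrightarrow> x = 0"
    and deg2: "x \<in> Y \<Longrightarrow> y \<in> nbrs x \<Longrightarrow> \<exists>z\<in>nbrs y. z \<noteq> x"
begin

text \<open>A positive multiple of the difference of \<open>y\<close> and \<open>x\<close> after central projection to the tangent
  hyperplane at \<open>p\<close>.\<close>

definition direction :: "real^4 \<Rightarrow> real^4 \<Rightarrow> real^4" where
  "direction x y = (p \<bullet> x) *\<^sub>R y - (p \<bullet> y) *\<^sub>R x"

definition contacts :: "((real^4) \<times> (real^4)) set" where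
  "contacts = {(x, y). x \<in> Y \<and> y \<in> nbrs x}"

text \<open>The edge \<open>(x, y)\<close> of the double cover is the contact of the red cell \<open>(x, True)\<close> with the
  blue cell \<open>(y, False)\<close>.\<close>

definition cells_at :: "(real^4) \<times> (real^4) \<Rightarrow> ((real^4) \<times> bool) set" where
  "cells_at e = {(fst e, True), (snd e, False)}"

definition dir :: "(real^4) \<times> (real^4) \<Rightarrow> real^3" where
  "dir e = L (direction (fst e) (snd e))"

text \<open>The contact of the cell \<open>(x, b)\<close> with the cell of the opposite colour at \<open>y\<close>.\<close>

definition contact :: "real^4 \<Rightarrow> bool \<Rightarrow> real^4 \<Rightarrow> (real^4) \<times> (real^4)" where
  "contact x b y = (if b then (x, y) else (y, x))"

definition colour_sign :: "bool \<Rightarrow> real" where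
  "colour_sign b = (if b then 1 else - 1)"

lemma direction_swap: "direction y x = - direction x y"
  by (simp add: direction_def)

lemma p_direction: "p \<bullet> direction x y = 0"
  by (simp add: direction_def inner_diff_right)

lemma p_pos: "x \<in> Y \<Longrightarrow> p \<bullet> x > 0"
  using close[OF p, of x] t by linarith

lemma contact_iff: "x \<in> Y \<Longrightarrow> {f \<in> contacts. (x, b) \<in> cells_at f} = contact x b ` nbrs x"
proof -
  assume x: "x \<in> Y"
  have "f \<in> contact x b ` nbrs x" if "f \<in> contacts" "(x, b) \<in> cells_at f" for f
  proof (cases b)
    case True
    then show ?thesis using that by (auto simp: contacts_def cells_at_def contact_def)
  next
    case False
    have "snd f = x \<and> fst f \<in> Y \<and> x \<in> nbrs (fst f)" using that False by (auto simp: contacts_def cells_at_def)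
    then obtain z where z: "f = (z, x)" "z \<in> Y" "x \<in> nbrs z" by (cases f) (auto simp: contacts_def cells_at_def)
    have "f = contact x b z" using z False by (simp add: contact_def)
    then show ?thesis using nbrs_sym[OF z(2,3)] by (rule image_eqI)
  qed
  moreover have "contact x b y \<in> contacts \<and> (x, b) \<in> cells_at (contact x b y)" if "y \<in> nbrs x" for y
    using that x nbrs_sym[OF x that] by (auto simp: contacts_def cells_at_def contact_def nbrs_def)
  ultimately show ?thesis by blast
qed

lemma contact_inj: "inj_on (contact x b) A"
  by (auto simp: contact_def inj_on_def)

lemma dir_contact: "dir (contact x b y) = colour_sign b *\<^sub>R L (direction x y)"
  using linear_neg[OF L(1)] by (auto simp: dir_def contact_def colour_sign_def direction_swap[of y x])

lemma cell_sum:
  assumes "x \<in> Y"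
  shows "(\<Sum>f\<in>{f \<in> contacts. (x, b) \<in> cells_at f}. c f *\<^sub>R dir f) =
    colour_sign b *\<^sub>R L (\<Sum>y\<in>nbrs x. c (contact x b y) *\<^sub>R direction x y)"
proof -
  have "(\<Sum>f\<in>{f \<in> contacts. (x, b) \<in> cells_at f}. c f *\<^sub>R dir f) = (\<Sum>y\<in>nbrs x. c (contact x b y) *\<^sub>R dir (contact x b y))"
    unfolding contact_iff[OF assms] by (subst sum.reindex[OF contact_inj]) simp
  also have "\<dots> = (\<Sum>y\<in>nbrs x. colour_sign b *\<^sub>R L (c (contact x b y) *\<^sub>R direction x y))"
    by (intro sum.cong refl) (simp add: dir_contact linear_cmul[OF L(1)])
  finally show ?thesis by (simp add: scaleR_sum_right[symmetric] linear_sum[OF L(1)])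
qed

lemma direction_sum:
  "(\<Sum>y\<in>A. c y *\<^sub>R direction x y) = (p \<bullet> x) *\<^sub>R (\<Sum>y\<in>A. c y *\<^sub>R y) - (\<Sum>y\<in>A. c y * (p \<bullet> y)) *\<^sub>R x"
  by (simp add: direction_def scaleR_diff_right sum_subtractf scaleR_sum_right scaleR_sum_left mult.commute)

lemma p_direction_sum: "p \<bullet> (\<Sum>y\<in>A. c y *\<^sub>R direction x y) = 0"
  by (simp add: inner_sum_right p_direction)

lemma L_inj:
  assumes "p \<bullet> x = 0" "p \<bullet> y = 0" "L x = L y"
  shows "x = y"
proof -
  have "x - y = 0" by (rule L(2)) (use assms in \<open>simp_all add: inner_diff_right linear_diff[OF L(1)]\<close>)
  then show ?thesis by simp
qed

text \<open>As \<open>p\<close> belongs to the set, \<open>P \<bullet> p\<close> is positive. So the multiple of \<open>x\<close> to be subtracted for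
  orthogonality to \<open>p\<close> is positive.\<close>

lemma cell_point:
  assumes x: "x \<in> Y" and c: "\<And>y. c y \<ge> 0" and nz: "(\<Sum>y\<in>nbrs x. c y *\<^sub>R direction x y) \<noteq> 0"
  obtains P \<kappa> \<alpha> where "\<kappa> > 0" "\<alpha> > 0" "P \<bullet> P = 1" "P \<bullet> x = t" "(\<Sum>y\<in>nbrs x. c y *\<^sub>R direction x y) = \<kappa> *\<^sub>R P - \<alpha> *\<^sub>R x"
    "\<And>z. z \<bullet> z = 1 \<Longrightarrow> (\<And>y. y \<in> Y \<Longrightarrow> t \<le> z \<bullet> y) \<Longrightarrow> t \<le> P \<bullet> z"
proof -
  have "(\<Sum>y\<in>nbrs x. c y) \<noteq> 0"
  proof
    assume "(\<Sum>y\<in>nbrs x. c y) = 0"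
    then have "\<forall>y\<in>nbrs x. c y = 0" using c by (simp add: sum_nonneg_eq_0_iff)
    then show False using nz by simp
  qed
  then have pos: "(\<Sum>y\<in>nbrs x. c y) > 0" using c by (simp add: less_le sum_nonneg)
  obtain P \<kappa> \<gamma> where P: "\<kappa> > 0" "P \<bullet> P = 1" "P \<bullet> x = t" "(\<Sum>y\<in>nbrs x. c y *\<^sub>R y) = \<kappa> *\<^sub>R P + \<gamma> *\<^sub>R x"
    and hull: "\<And>z. z \<bullet> z = 1 \<Longrightarrow> (\<And>y. y \<in> nbrs x \<Longrightarrow> t \<le> z \<bullet> y) \<Longrightarrow> t \<le> P \<bullet> z"
    by (rule hull_point[OF x c pos]) (rule that; blast)
  define S where "S = (\<Sum>y\<in>nbrs x. c y *\<^sub>R direction x y)"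
  define \<alpha> where "\<alpha> = (\<Sum>y\<in>nbrs x. c y * (p \<bullet> y)) - (p \<bullet> x) * \<gamma>"
  have S: "S = ((p \<bullet> x) * \<kappa>) *\<^sub>R P - \<alpha> *\<^sub>R x"
    unfolding S_def direction_sum P(4) \<alpha>_def by (simp add: algebra_simps)
  have px: "p \<bullet> x > 0" using p_pos[OF x] .
  have pP: "t \<le> P \<bullet> p" using hull[of p] unit[OF p] close[OF p] by (auto simp: nbrs_def)
  have "p \<bullet> S = 0" unfolding S_def by (rule p_direction_sum)
  then have "(p \<bullet> x) * \<kappa> * (p \<bullet> P) = \<alpha> * (p \<bullet> x)" unfolding S by (simp add: inner_diff_right)
  then have "\<alpha> = \<kappa> * (p \<bullet> P)" using px by simp
  then have a: "\<alpha> > 0" using P(1) pP t by (simp add: inner_commute)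
  have hull': "t \<le> P \<bullet> z" if "z \<bullet> z = 1" "\<And>y. y \<in> Y \<Longrightarrow> t \<le> z \<bullet> y" for z
    using hull[OF that(1)] that(2) by (auto simp: nbrs_def)
  show ?thesis
    by (rule that[OF _ a P(2,3) S[unfolded S_def] hull']) (use px P(1) in simp_all)
qed

text \<open>Cells of equal colour lead to \<open>hulls_disjoint\<close>, cells of different colours to
  \<open>crossing_quadrilateral\<close>.\<close>

lemma cells_touch_only_at_contacts:
  assumes x: "x \<in> Y" "x' \<in> Y" "(x, b) \<noteq> (x', b')" and c: "\<And>y. c y \<ge> 0" "\<And>y. d y \<ge> 0"
    and S: "S = (\<Sum>y\<in>nbrs x. c y *\<^sub>R direction x y)" "S' = (\<Sum>y\<in>nbrs x'. d y *\<^sub>R direction x' y)"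
    and eq: "colour_sign b *\<^sub>R S = colour_sign b' *\<^sub>R S'" and nz: "S \<noteq> 0"
  shows "b' = (\<not> b) \<and> x' \<in> nbrs x \<and> (\<exists>k. S = k *\<^sub>R direction x x')"
proof -
  have nz': "S' \<noteq> 0" using eq nz by (auto simp: colour_sign_def split: if_splits)
  obtain P \<kappa> \<alpha> where P: "\<kappa> > 0" "\<alpha> > 0" "P \<bullet> P = 1" "P \<bullet> x = t" "S = \<kappa> *\<^sub>R P - \<alpha> *\<^sub>R x"
    "\<And>z. z \<bullet> z = 1 \<Longrightarrow> (\<And>y. y \<in> Y \<Longrightarrow> t \<le> z \<bullet> y) \<Longrightarrow> t \<le> P \<bullet> z"
    by (rule cell_point[OF x(1) c(1) nz[unfolded S], folded S]) (rule that; blast)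
  obtain Q l \<beta> where Q: "l > 0" "\<beta> > 0" "Q \<bullet> Q = 1" "Q \<bullet> x' = t" "S' = l *\<^sub>R Q - \<beta> *\<^sub>R x'"
    "\<And>z. z \<bullet> z = 1 \<Longrightarrow> (\<And>y. y \<in> Y \<Longrightarrow> t \<le> z \<bullet> y) \<Longrightarrow> t \<le> Q \<bullet> z"
    by (rule cell_point[OF x(2) c(2) nz'[unfolded S], folded S]) (rule that; blast)
  have Py: "t \<le> P \<bullet> y" and Qy: "t \<le> Q \<bullet> y" if "y \<in> Y" for y
    using P(6)[OF unit[OF that] close[OF that]] Q(6)[OF unit[OF that] close[OF that]] by auto
  have PQ: "t \<le> P \<bullet> Q" using P(6)[OF Q(3) Qy] .
  show ?thesis
  proof (cases "b = b'")
    case True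
    then have "S = S'" using eq by (auto simp: colour_sign_def split: if_splits)
    then have "\<kappa> *\<^sub>R P - \<alpha> *\<^sub>R x = l *\<^sub>R Q - \<beta> *\<^sub>R x'" using P(5) Q(5) by simp
    then have False
      using hulls_disjoint[OF x(1,2) _ P(4) Q(4) Py[OF x(2)] Qy[OF x(1)] P(1) Q(1) P(2) Q(2)] x(3) True by blast
    then show ?thesis ..
  next
    case False
    then have "S = - S'" using eq by (auto simp: colour_sign_def split: if_splits)
    then have "\<kappa> *\<^sub>R P + l *\<^sub>R Q = \<alpha> *\<^sub>R x + \<beta> *\<^sub>R x'" using P(5) Q(5) by (simp add: algebra_simps)
    from crossing_quadrilateral[OF unit[OF x(1)] unit[OF x(2)] P(3,4) Py[OF x(2)] Q(3,4) Qy[OF x(1)] PQ close[OF x(1,2)] P(1) Q(1) P(2) Q(2) this]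
    have PQ: "P = x'" "Q = x" by auto
    have nb: "x' \<in> nbrs x" using P(4) x(2) unfolding PQ(1) by (simp add: nbrs_def inner_commute)
    have "p \<bullet> S = 0" unfolding S by (rule p_direction_sum)
    then have "\<kappa> * (p \<bullet> x') = \<alpha> * (p \<bullet> x)" unfolding P(5) PQ by (simp add: inner_diff_right)
    then have "\<alpha> = \<kappa> / (p \<bullet> x) * (p \<bullet> x')" using p_pos[OF x(1)] by (simp add: field_simps)
    then have "S = (\<kappa> / (p \<bullet> x)) *\<^sub>R direction x x'" unfolding P(5) PQ direction_def using p_pos[OF x(1)] by (simp add: scaleR_diff_right)
    then show ?thesis using False nb by blast
  qed
qed

sublocale touching_cells "Y \<times> UNIV" contacts cells_at dir
proof
  show "finite (Y \<times> (UNIV :: bool set))" using finite_Y by simp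
  have "contacts \<subseteq> Y \<times> Y" by (auto simp: contacts_def nbrs_def)
  then show "finite contacts" using finite_Y finite_subset by blast
  show "cells_at e \<subseteq> Y \<times> UNIV \<and> card (cells_at e) = 2" if "e \<in> contacts" for e
    using that by (auto simp: contacts_def cells_at_def nbrs_def)
  show "e = e'" if "e \<in> contacts" "e' \<in> contacts" "u \<noteq> v" "u \<in> cells_at e" "v \<in> cells_at e" "u \<in> cells_at e'" "v \<in> cells_at e'" for e e' u v
    using that by (cases e; cases e') (auto simp: cells_at_def)
  show "dir e \<noteq> 0" if e: "e \<in> contacts" for e
  proof
    assume "dir e = 0"
    obtain x y where xy: "e = (x, y)" "x \<in> Y" "y \<in> nbrs x" using e by (auto simp: contacts_def)
    have "direction x y = 0" using L(2)[OF p_direction] \<open>dir e = 0\<close> by (simp add: dir_def xy)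
    then have eq: "(p \<bullet> x) *\<^sub>R y = (p \<bullet> y) *\<^sub>R x" by (simp add: direction_def)
    have y: "y \<in> Y" "x \<bullet> y = t" "y \<bullet> x = t" using xy by (auto simp: nbrs_def inner_commute)
    have "((p \<bullet> x) *\<^sub>R y) \<bullet> x = ((p \<bullet> y) *\<^sub>R x) \<bullet> x" "((p \<bullet> x) *\<^sub>R y) \<bullet> y = ((p \<bullet> y) *\<^sub>R x) \<bullet> y" unfolding eq by simp_all
    then have "(p \<bullet> x) * t = p \<bullet> y" "p \<bullet> x = (p \<bullet> y) * t" using y unit[OF y(1)] unit[OF xy(2)] by simp_all
    then have "(p \<bullet> x) * (1 - t * t) = 0" by (simp add: algebra_simps)
    moreover have "t * t < 1 * 1" using t by (intro mult_strict_mono) auto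
    ultimately show False using p_pos[OF xy(2)] by simp
  qed
  show "c f = 0" if e: "e \<in> contacts" "v \<in> cells_at e" and c: "\<And>f. c f \<ge> 0"
    and eq: "(\<Sum>f\<in>{f \<in> contacts. v \<in> cells_at f}. c f *\<^sub>R dir f) = l *\<^sub>R dir e"
    and f: "f \<in> contacts" "v \<in> cells_at f" "f \<noteq> e" for e v c l f
  proof -
    obtain x b where v: "v = (x, b)" by (cases v)
    have x: "x \<in> Y" using e v by (auto simp: contacts_def cells_at_def nbrs_def)
    have "e \<in> contact x b ` nbrs x" "f \<in> contact x b ` nbrs x"
      using contact_iff[OF x, of b] e f v by blast+
    then obtain y0 y where y: "e = contact x b y0" "y0 \<in> nbrs x" "f = contact x b y" "y \<in> nbrs x" by blast
    have "colour_sign b *\<^sub>R L (\<Sum>y\<in>nbrs x. c (contact x b y) *\<^sub>R direction x y) = l *\<^sub>R (colour_sign b *\<^sub>R L (direction x y0))"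
      using eq unfolding v cell_sum[OF x] y(1) dir_contact .
    then have "L (\<Sum>y\<in>nbrs x. c (contact x b y) *\<^sub>R direction x y) = L (l *\<^sub>R direction x y0)"
      by (auto simp: colour_sign_def linear_cmul[OF L(1)] split: if_splits)
    then have "(\<Sum>y\<in>nbrs x. c (contact x b y) *\<^sub>R direction x y) = l *\<^sub>R direction x y0"
      by (intro L_inj) (simp_all add: p_direction_sum p_direction)
    moreover define A where "A = (\<Sum>y\<in>nbrs x. c (contact x b y) *\<^sub>R y)"
    moreover define s where "s = (\<Sum>y\<in>nbrs x. c (contact x b y) * (p \<bullet> y))"
    ultimately have "(p \<bullet> x) *\<^sub>R A - s *\<^sub>R x = l *\<^sub>R direction x y0" by (simp only: direction_sum)
    then have "(p \<bullet> x) *\<^sub>R A = (p \<bullet> x) *\<^sub>R (l *\<^sub>R y0) + (s - l * (p \<bullet> y0)) *\<^sub>R x"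
      unfolding direction_def by (simp add: algebra_simps)
    also have "\<dots> = (p \<bullet> x) *\<^sub>R (l *\<^sub>R y0 + ((s - l * (p \<bullet> y0)) / (p \<bullet> x)) *\<^sub>R x)"
      using p_pos[OF x] by (simp add: scaleR_add_right)
    finally have "A = l *\<^sub>R y0 + ((s - l * (p \<bullet> y0)) / (p \<bullet> x)) *\<^sub>R x"
      using p_pos[OF x] by simp
    then have "(\<Sum>y\<in>nbrs x. c (contact x b y) *\<^sub>R y) = l *\<^sub>R y0 + ((s - l * (p \<bullet> y0)) / (p \<bullet> x)) *\<^sub>R x"
      unfolding A_def .
    moreover obtain z where "z \<in> nbrs y0" "z \<noteq> x" using deg2[OF x y(2)] by blast
    moreover have "y \<noteq> y0" using f(3) y by auto
    ultimately show "c f = 0" using neighbour_extreme[OF x y(2), of z "\<lambda>y. c (contact x b y)"] c y by blast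
  qed
  show "\<exists>e\<in>contacts. u \<in> cells_at e \<and> v \<in> cells_at e \<and> (\<exists>l. q = l *\<^sub>R dir e)"
    if uv: "u \<in> Y \<times> UNIV" "v \<in> Y \<times> UNIV" "u \<noteq> v" and cd: "\<And>f. c f \<ge> 0" "\<And>f. d f \<ge> 0"
    and eq: "(\<Sum>f\<in>{f \<in> contacts. u \<in> cells_at f}. c f *\<^sub>R dir f) = q" "(\<Sum>f\<in>{f \<in> contacts. v \<in> cells_at f}. d f *\<^sub>R dir f) = q"
    and q: "q \<noteq> 0" for u v c d q
  proof -
    obtain x b x' b' where u: "u = (x, b)" and v: "v = (x', b')" by (cases u; cases v)
    have x: "x \<in> Y" "x' \<in> Y" using uv u v by auto
    define S where "S = (\<Sum>y\<in>nbrs x. c (contact x b y) *\<^sub>R direction x y)"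
    define S' where "S' = (\<Sum>y\<in>nbrs x'. d (contact x' b' y) *\<^sub>R direction x' y)"
    have qS: "q = colour_sign b *\<^sub>R L S" "q = colour_sign b' *\<^sub>R L S'"
      using eq unfolding u v cell_sum[OF x(1)] cell_sum[OF x(2)] S_def S'_def by auto
    have "colour_sign b *\<^sub>R S = colour_sign b' *\<^sub>R S'"
    proof (rule L_inj)
      show "p \<bullet> (colour_sign b *\<^sub>R S) = 0" "p \<bullet> (colour_sign b' *\<^sub>R S') = 0" by (simp_all add: S_def S'_def p_direction_sum)
      show "L (colour_sign b *\<^sub>R S) = L (colour_sign b' *\<^sub>R S')" using qS by (simp add: linear_cmul[OF L(1)])
    qed
    moreover have "S \<noteq> 0" using q qS(1) linear_0[OF L(1)] by auto
    ultimately have "b' = (\<not> b) \<and> x' \<in> nbrs x \<and> (\<exists>k. S = k *\<^sub>R direction x x')"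
      using cells_touch_only_at_contacts[OF x, of b b' "\<lambda>y. c (contact x b y)" "\<lambda>y. d (contact x' b' y)" S S'] uv(3) cd S_def S'_def u v by blast
    then obtain k where k: "b' = (\<not> b)" "x' \<in> nbrs x" "S = k *\<^sub>R direction x x'" by blast
    have "q = k *\<^sub>R dir (contact x b x')" unfolding qS(1) k(3) dir_contact by (simp add: linear_cmul[OF L(1)])
    moreover have "contact x b x' \<in> contacts" "u \<in> cells_at (contact x b x')"
      using contact_iff[OF x(1), of b] k(2) u by blast+
    moreover have "v \<in> cells_at (contact x b x')" unfolding v k(1) by (auto simp: cells_at_def contact_def)
    ultimately show ?thesis by blast
  qed
qed

end

section \<open>Edges, colourings and odd cycles\<close>

lemma spherical_cluster_subset:
  assumes "spherical_cluster Y t" "Z \<subseteq> Y"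
  shows "spherical_cluster Z t"
  using assms finite_subset unfolding spherical_cluster_def by blast

text \<open>The ordered edges, that is, the edges of the double cover.\<close>

definition pairs_at :: "'a::euclidean_space set \<Rightarrow> real \<Rightarrow> ('a \<times> 'a) set" where
  "pairs_at Y t = {(x, y). x \<in> Y \<and> y \<in> Y \<and> x \<bullet> y = t}"

text \<open>Removing a point with at most two neighbours costs at most four ordered edges, as much as the
  bound decreases. If there is none, the bound is Euler's inequality for the \<open>2 * card Y\<close> cells.\<close>

lemma card_pairs_at_le:
  fixes Y :: "(real^4) set"
  assumes "spherical_cluster Y t" "Y \<noteq> {}"
  shows "card (pairs_at Y t) + 4 \<le> 4 * card Y"
  using assms
proof (induction "card Y" arbitrary: Y rule: less_induct)
  case less
  interpret spherical_cluster Y t by (rule less.prems(1))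
  have nbrs_pairs: "(x, y) \<in> pairs_at Y t \<longleftrightarrow> x \<in> Y \<and> y \<in> nbrs x" for x y
    by (auto simp: pairs_at_def nbrs_def)
  show ?case
  proof (cases "\<exists>x\<in>Y. card (nbrs x) \<le> 2")
    case True
    then obtain x where x: "x \<in> Y" "card (nbrs x) \<le> 2" by blast
    define Z where "Z = Y - {x}"
    have cZ: "card Y = Suc (card Z)" unfolding Z_def by (rule card.remove[OF finite_Y x(1)])
    have Z: "spherical_cluster Z t" by (rule spherical_cluster_subset[OF less.prems(1)]) (auto simp: Z_def)
    show ?thesis
    proof (cases "Z = {}")
      case True
      then have "Y = {x}" using x by (auto simp: Z_def)
      then have "pairs_at Y t = {}" using unit t by (auto simp: pairs_at_def)
      then show ?thesis using cZ by simp
    next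
      case False
      have IH: "card (pairs_at Z t) + 4 \<le> 4 * card Z" using less.hyps[OF _ Z False] cZ by simp
      have fin: "finite (pairs_at Z t)"
        by (rule finite_subset[of _ "Y \<times> Y"]) (use finite_Y in \<open>auto simp: pairs_at_def Z_def\<close>)
      have "pairs_at Y t \<subseteq> pairs_at Z t \<union> (Pair x ` nbrs x \<union> (\<lambda>y. (y, x)) ` nbrs x)"
        by (auto simp: pairs_at_def Z_def nbrs_def inner_commute)
      then have "card (pairs_at Y t) \<le> card (pairs_at Z t \<union> (Pair x ` nbrs x \<union> (\<lambda>y. (y, x)) ` nbrs x))"
        using fin by (intro card_mono) auto
      also have "\<dots> \<le> card (pairs_at Z t) + (card (Pair x ` nbrs x) + card ((\<lambda>y. (y, x)) ` nbrs x))"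
        by (intro order_trans[OF card_Un_le] add_mono card_Un_le order_refl)
      also have "\<dots> \<le> card (pairs_at Z t) + (card (nbrs x) + card (nbrs x))"
        by (intro add_mono card_image_le order_refl) auto
      finally show ?thesis using x IH cZ by linarith
    qed
  next
    case False
    then have deg: "card (nbrs x) \<ge> 3" if "x \<in> Y" for x using that by force
    obtain p where p: "p \<in> Y" using less.prems by blast
    have "p \<noteq> 0" using unit[OF p] by auto
    then obtain L :: "real^4 \<Rightarrow> real^3" where L: "linear L" "\<And>x. p \<bullet> x = 0 \<Longrightarrow> L x = 0 \<Longrightarrow> x = 0"
      using hyperplane_coordinates by blast
    interpret projected_cluster Y t p L
    proof (intro projected_cluster.intro projected_cluster_axioms.intro)
      show "spherical_cluster Y t" by (rule less.prems(1))
      show "p \<in> Y" "linear L" by (rule p L)+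
      show "x = 0" if "p \<bullet> x = 0" "L x = 0" for x by (rule L(2)[OF that])
      show "\<exists>z\<in>nbrs y. z \<noteq> x" if "x \<in> Y" "y \<in> nbrs x" for x y
      proof (rule ccontr)
        assume "\<not> ?thesis"
        then have "nbrs y \<subseteq> {x}" by blast
        then have "card (nbrs y) \<le> 1" using card_mono[of "{x}" "nbrs y"] by simp
        then show False using deg[of y] that by (auto simp: nbrs_def)
      qed
    qed
    interpret touching_cells_deg3 "Y \<times> UNIV" contacts cells_at dir
    proof
      fix v :: "(real^4) \<times> bool"
      assume v: "v \<in> Y \<times> UNIV"
      obtain x b where xb: "v = (x, b)" "x \<in> Y" using v by (cases v) auto
      show "3 \<le> card {e \<in> contacts. v \<in> cells_at e}"
        unfolding xb(1) contact_iff[OF xb(2)] card_image[OF contact_inj] by (rule deg[OF xb(2)])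
    qed
    have "nbrs p \<noteq> {}" using deg[OF p] by auto
    then have ne: "contacts \<noteq> {}" using p by (auto simp: contacts_def)
    have bip: "snd u \<noteq> snd v" if "e \<in> contacts" "u \<noteq> v" "u \<in> cells_at e" "v \<in> cells_at e" for e u v
      using that by (auto simp: cells_at_def)
    have "contacts = pairs_at Y t" unfolding contacts_def using nbrs_pairs by auto
    then show ?thesis using card_contacts_le[of snd, OF bip ne] by (simp add: card_cartesian_product)
  qed
qed

text \<open>By the bound on the edges, some point has at most three neighbours. It is coloured last.\<close>

lemma ex_four_colouring:
  fixes Y :: "(real^4) set"
  assumes "spherical_cluster Y t"
  shows "\<exists>f :: real^4 \<Rightarrow> nat. f ` Y \<subseteq> {..<4} \<and> (\<forall>x\<in>Y. \<forall>y\<in>Y. x \<bullet> y = t \<longrightarrow> f x \<noteq> f y)"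
  using assms
proof (induction "card Y" arbitrary: Y rule: less_induct)
  case less
  interpret spherical_cluster Y t by (rule less.prems)
  show ?case
  proof (cases "Y = {}")
    case False
    have "\<exists>x\<in>Y. card (nbrs x) \<le> 3"
    proof (rule ccontr)
      assume "\<not> ?thesis"
      then have "(\<Sum>x\<in>Y. 4) \<le> (\<Sum>x\<in>Y. card (nbrs x))" by (intro sum_mono) force
      also have "\<dots> = card (SIGMA x:Y. nbrs x)" using finite_Y by simp
      also have "(SIGMA x:Y. nbrs x) = pairs_at Y t" by (auto simp: pairs_at_def nbrs_def)
      finally show False using card_pairs_at_le[OF less.prems False] by simp
    qed
    then obtain x where x: "x \<in> Y" "card (nbrs x) \<le> 3" by blast
    have "card (Y - {x}) < card Y" using x finite_Y by (intro psubset_card_mono) auto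
    then obtain f :: "real^4 \<Rightarrow> nat" where f: "f ` (Y - {x}) \<subseteq> {..<4}" "\<forall>u\<in>Y-{x}. \<forall>y\<in>Y-{x}. u \<bullet> y = t \<longrightarrow> f u \<noteq> f y"
      using less.hyps[OF _ spherical_cluster_subset[OF less.prems]] by blast
    \<comment> \<open>a colour is left for \<open>x\<close>\<close>
    have "\<not> {..<4} \<subseteq> f ` nbrs x"
    proof
      assume "{..<4} \<subseteq> f ` nbrs x"
      then have "card {..<4 :: nat} \<le> card (f ` nbrs x)" by (intro card_mono) auto
      also have "\<dots> \<le> 3" using card_image_le[of "nbrs x" f] x by simp
      finally show False by simp
    qed
    then obtain c where c: "c < 4" "c \<notin> f ` nbrs x" by blast
    have "x \<bullet> x \<noteq> t" using unit[OF x(1)] t by simp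
    then have "\<forall>u\<in>Y. \<forall>y\<in>Y. u \<bullet> y = t \<longrightarrow> (f(x := c)) u \<noteq> (f(x := c)) y"
      using f(2) c(2) by (auto simp: nbrs_def inner_commute)
    moreover have "(f(x := c)) ` Y \<subseteq> {..<4}" using f(1) c(1) by auto
    ultimately show ?thesis by blast
  qed simp
qed

text \<open>Contact \<open>k\<close> of the lifted walk joins the cell of \<open>x k\<close> to the cell of \<open>x (k + 1)\<close>, and red
  and blue alternate. After \<open>m\<close> steps, an odd number, the colours are exchanged, so the curve is
  its own antipode.\<close>

lemma odd_closed_walks_meet:
  fixes x x' :: "nat \<Rightarrow> real^4"
  assumes cluster: "spherical_cluster (range x \<union> range x') t"
    and m: "odd m" "odd m'"
    and x: "\<And>k. x (k + m) = x k" "\<And>k. x k \<bullet> x (Suc k) = t" "\<And>k. x k \<noteq> x (Suc (Suc k))"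
    and x': "\<And>k. x' (k + m') = x' k" "\<And>k. x' k \<bullet> x' (Suc k) = t" "\<And>k. x' k \<noteq> x' (Suc (Suc k))"
    and disj: "range x \<inter> range x' = {}"
  shows False
proof -
  let ?Y = "range x \<union> range x'"
  interpret spherical_cluster ?Y t by (rule cluster)
  have p: "x 0 \<in> ?Y" by simp
  have "x 0 \<noteq> 0" using unit[OF p] by auto
  then obtain L :: "real^4 \<Rightarrow> real^3" where L: "linear L" "\<And>y. x 0 \<bullet> y = 0 \<Longrightarrow> L y = 0 \<Longrightarrow> y = 0"
    using hyperplane_coordinates by blast
  have two: "\<exists>z\<in>nbrs (y k). z \<noteq> u"
    if y: "\<And>k. y (k + n) = y k" "\<And>k. y k \<bullet> y (Suc k) = t" "\<And>k. y k \<noteq> y (Suc (Suc k))" "range y \<subseteq> ?Y" and n: "odd n"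
    for y u n k
  proof -
    obtain j where j: "n = Suc j" using n by (cases n) auto
    have Y: "y k \<in> ?Y" for k using y(4) by blast
    have 1: "y (Suc k) \<in> nbrs (y k)" using y(2) Y by (simp add: nbrs_def)
    have "y (k + j) \<bullet> y (Suc (k + j)) = t" by (rule y(2))
    then have 2: "y (k + j) \<in> nbrs (y k)" using y(1)[of k] Y[of "k + j"] by (simp add: nbrs_def j inner_commute)
    have "y (Suc (Suc (k + j))) = y (Suc k)" using y(1)[of "Suc k"] by (simp add: j)
    then have "y (k + j) \<noteq> y (Suc k)" using y(3)[of "k + j"] by simp
    then show ?thesis using 1 2 by metis
  qed
  interpret projected_cluster ?Y t "x 0" L
  proof (intro projected_cluster.intro projected_cluster_axioms.intro)
    show "spherical_cluster ?Y t" by (rule cluster)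
    show "x 0 \<in> ?Y" "linear L" by (rule p L)+
    show "y = 0" if "x 0 \<bullet> y = 0" "L y = 0" for y by (rule L(2)[OF that])
  next
    fix u y assume "y \<in> nbrs u"
    then have "y \<in> ?Y" by (simp add: nbrs_def)
    then show "\<exists>z\<in>nbrs y. z \<noteq> u" using two[of x m] two[of x' m'] x x' m by blast
  qed
  define e where "e y k = contact (y k) (even k) (y (Suc k))" for y :: "nat \<Rightarrow> real^4" and k
  define v where "v y k = (y k :: real^4, even k)" for y :: "nat \<Rightarrow> real^4" and k :: nat
  \<comment> \<open>each contact seen from its two cells\<close>
  have e_alt: "e y k = contact (y (Suc k)) (even (Suc k)) (y k)" for y k
    by (simp add: e_def contact_def)
  have nb: "y (Suc k) \<in> nbrs (y k)" "y k \<in> nbrs (y (Suc k))" "y k \<in> ?Y"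
    if "range y \<subseteq> ?Y" "\<And>k. y k \<bullet> y (Suc k) = t" for y k
  proof -
    have Y: "y k \<in> ?Y" for k using that(1) by blast
    show "y (Suc k) \<in> nbrs (y k)" "y k \<in> nbrs (y (Suc k))" "y k \<in> ?Y"
      using that(2)[of k] Y[of k] Y[of "Suc k"] by (simp_all add: nbrs_def inner_commute)
  qed
  have star1: "e y k \<in> star (v y k)" if "range y \<subseteq> ?Y" "\<And>k. y k \<bullet> y (Suc k) = t" for y k
    unfolding star_def v_def contact_iff[OF nb(3)[OF that]] e_def using nb(1)[OF that] by (rule imageI)
  have star2: "e y k \<in> star (v y (Suc k))" if "range y \<subseteq> ?Y" "\<And>k. y k \<bullet> y (Suc k) = t" for y k
    unfolding star_def v_def contact_iff[OF nb(3)[OF that]] e_alt using nb(2)[OF that] by (rule imageI)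
  have ne: "e y k \<noteq> e y (Suc k)" if "\<And>k. y k \<noteq> y (Suc (Suc k))" for y k
    using that[of k] unfolding e_alt[of y k] unfolding e_def by (auto simp: contact_def)
  have anti: "dir (e y (k + n)) = - dir (e y k)" if "\<And>k. y (k + n) = y k" "odd n" for y n k
    using that(1)[of k] that(1)[of "Suc k"] that(2) by (simp add: e_def dir_contact colour_sign_def)
  have rx: "range x \<subseteq> ?Y" "range x' \<subseteq> ?Y" by auto
  show False
  proof (rule no_disjoint_antipodal_cycles[of "e x" "v x" "e x'" "v x'" m m'])
    show "v x k \<noteq> v x (Suc k)" for k by (simp add: v_def)
    show "v x k \<noteq> v x' l" for k l using disj by (auto simp: v_def)
  qed (rule star1[where y = x, OF rx(1) x(2)] star2[where y = x, OF rx(1) x(2)] ne[where y = x, OF x(3)]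
      star1[where y = x', OF rx(2) x'(2)] star2[where y = x', OF rx(2) x'(2)] ne[where y = x', OF x'(3)]
      anti[where y = x and n = m, OF x(1) m(1)] anti[where y = x' and n = m', OF x'(1) m(2)])+
qed

lemma inner_of_normalised:
  fixes x y c :: "'a::euclidean_space"
  assumes "x \<in> sphere c r" "y \<in> sphere c r" "r > 0"
  shows "((1 / r) *\<^sub>R (x - c)) \<bullet> ((1 / r) *\<^sub>R (y - c)) = 1 - (dist x y)\<^sup>2 / (2 * r\<^sup>2)"
proof -
  have n: "(x - c) \<bullet> (x - c) = r\<^sup>2" "(y - c) \<bullet> (y - c) = r\<^sup>2"
    using assms by (auto simp: dist_norm norm_minus_commute power2_norm_eq_inner[symmetric])
  have "(dist x y)\<^sup>2 = ((x - c) - (y - c)) \<bullet> ((x - c) - (y - c))" by (simp add: dist_norm power2_norm_eq_inner)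
  also have "\<dots> = 2 * r\<^sup>2 - 2 * ((x - c) \<bullet> (y - c))"
    unfolding inner_diff_left[of "x - c" "y - c"] inner_diff_right[of _ "x - c" "y - c"] n
    by (simp add: inner_commute[of "y - c" "x - c"])
  finally have "(x - c) \<bullet> (y - c) = r\<^sup>2 - (dist x y)\<^sup>2 / 2" by linarith
  moreover have "((1 / r) *\<^sub>R (x - c)) \<bullet> ((1 / r) *\<^sub>R (y - c)) = ((x - c) \<bullet> (y - c)) / r\<^sup>2"
    by (simp add: power2_eq_square)
  ultimately show ?thesis using assms(3) by (simp add: diff_divide_distrib)
qed

lemma card_ordered_edges:
  assumes "finite X"
  shows "card {(x, y). x \<in> X \<and> y \<in> X \<and> dist x y = 1} = 2 * card (edges (diameter_graph X))"
proof -
  define D where "D = {(x, y). x \<in> X \<and> y \<in> X \<and> dist x y = 1}"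
  have fin: "finite D" by (rule finite_subset[of _ "X \<times> X"]) (use assms in \<open>auto simp: D_def\<close>)
  define h where "h = (\<lambda>(x :: 'a, y). {x, y})"
  have E: "edges (diameter_graph X) = h ` D" unfolding diameter_graph_def D_def h_def by force
  have two: "card {d \<in> D. h d = e} = 2" if "e \<in> h ` D" for e
  proof -
    have "\<exists>x y. e = {x, y} \<and> x \<in> X \<and> y \<in> X \<and> dist x y = 1"
      using that unfolding D_def h_def by auto
    then obtain x y where xy: "e = {x, y}" "x \<in> X" "y \<in> X" "dist x y = 1" by blast
    then have "x \<noteq> y" by auto
    have "d \<in> D \<and> h d = e \<longleftrightarrow> d = (x, y) \<or> d = (y, x)" for d
    proof (cases d)
      case (Pair a b)
      show ?thesis unfolding Pair D_def h_def xy(1) using xy(2-4) dist_commute[of x y] by (auto simp: doubleton_eq_iff)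
    qed
    then have "{d \<in> D. h d = e} = {(x, y), (y, x)}" by blast
    then show ?thesis using \<open>x \<noteq> y\<close> by simp
  qed
  have "card D = (\<Sum>e\<in>h ` D. card {d \<in> D. h d = e})"
    using sum.image_gen[OF fin, of "\<lambda>_. 1 :: nat" h] by simp
  also have "\<dots> = 2 * card (h ` D)" using two by simp
  finally show ?thesis unfolding E D_def .
qed

theorem theorem2:
  fixes r :: real and c :: "real ^ 4" and X :: "(real ^ 4) set" and n :: nat
  assumes "r > 1 / sqrt 2"
    and "X \<subseteq> sphere c r"
    and "finite X"
    and "diameter X = 1"
    and "card X = n"
  shows "card (edges (diameter_graph X)) \<le> 2 * n - 2 \<and>
    chromatic_number (diameter_graph X) \<le> 4 \<and>
    (\<forall>p q. is_odd_cycle (diameter_graph X) p \<and> is_odd_cycle (diameter_graph X) q \<longrightarrow>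
      set p \<inter> set q \<noteq> {})"
proof -
  have r: "r > 0" using assms(1) by (rule less_trans[rotated]) simp
  have "(1 / sqrt 2)\<^sup>2 < r\<^sup>2" using assms(1) by (intro power_strict_mono) auto
  then have r2: "1 < 2 * r\<^sup>2" by (simp add: power_divide)
  define \<phi> where "\<phi> x = (1 / r) *\<^sub>R (x - c)" for x
  define t where "t = 1 - 1 / (2 * r\<^sup>2)"
  have t: "0 < t" "t < 1" using r r2 by (simp_all add: t_def)
  have inner: "\<phi> x \<bullet> \<phi> y = 1 - (dist x y)\<^sup>2 / (2 * r\<^sup>2)" if "x \<in> X" "y \<in> X" for x y
    unfolding \<phi>_def using that assms(2) r by (intro inner_of_normalised) auto
  have inj: "inj_on \<phi> A" for A using r by (auto simp: inj_on_def \<phi>_def)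
  have dist: "dist x y \<le> 1" if "x \<in> X" "y \<in> X" for x y
    using diameter_bounded_bound[OF finite_imp_bounded[OF assms(3)] that] assms(4) by simp
  have adj: "\<phi> x \<bullet> \<phi> y = t \<longleftrightarrow> dist x y = 1" if "x \<in> X" "y \<in> X" for x y
  proof -
    have "\<phi> x \<bullet> \<phi> y = t \<longleftrightarrow> (dist x y)\<^sup>2 / (2 * r\<^sup>2) = 1 / (2 * r\<^sup>2)" unfolding inner[OF that] t_def by auto
    also have "\<dots> \<longleftrightarrow> (dist x y)\<^sup>2 = 1" using r by simp
    also have "\<dots> \<longleftrightarrow> dist x y = 1" unfolding power2_eq_1_iff using zero_le_dist[of x y] by linarith
    finally show ?thesis .
  qed
  have cluster: "spherical_cluster (\<phi> ` X) t"
  proof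
    show "finite (\<phi> ` X)" using assms(3) by simp
    show "x \<bullet> x = 1" if "x \<in> \<phi> ` X" for x using that inner by auto
    show "t \<le> x \<bullet> y" if "x \<in> \<phi> ` X" "y \<in> \<phi> ` X" for x y
    proof -
      from that obtain a b where ab: "x = \<phi> a" "y = \<phi> b" "a \<in> X" "b \<in> X" by blast
      have "(dist a b)\<^sup>2 \<le> 1" using dist[OF ab(3,4)] by (simp add: power_le_one)
      then have "(dist a b)\<^sup>2 / (2 * r\<^sup>2) \<le> 1 / (2 * r\<^sup>2)" by (intro divide_right_mono) auto
      then show ?thesis unfolding ab(1,2) inner[OF ab(3,4)] t_def by simp
    qed
  qed (rule t)+
  have "X \<noteq> {}" using assms(4) by auto

  have part1: "card (edges (diameter_graph X)) \<le> 2 * n - 2"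
  proof -
    have "pairs_at (\<phi> ` X) t = map_prod \<phi> \<phi> ` {(x, y). x \<in> X \<and> y \<in> X \<and> dist x y = 1}" (is "?P = map_prod \<phi> \<phi> ` ?D")
    proof (intro equalityI subsetI)
      fix z assume "z \<in> ?P"
      then obtain a b where ab: "a \<in> X" "b \<in> X" "z = (\<phi> a, \<phi> b)" "\<phi> a \<bullet> \<phi> b = t"
        unfolding pairs_at_def by blast
      then have "(a, b) \<in> ?D" using adj by simp
      then show "z \<in> map_prod \<phi> \<phi> ` ?D" unfolding ab(3) by (rule map_prod_imageI)
    next
      fix z assume "z \<in> map_prod \<phi> \<phi> ` ?D"
      then obtain a b where ab: "a \<in> X" "b \<in> X" "z = (\<phi> a, \<phi> b)" "dist a b = 1" by auto
      then show "z \<in> ?P" using adj[OF ab(1,2)] by (simp add: pairs_at_def)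
    qed
    then have "card (pairs_at (\<phi> ` X) t) = card {(x, y). x \<in> X \<and> y \<in> X \<and> dist x y = 1}"
      by (simp add: card_image[OF inj_on_subset[OF map_prod_inj_on[OF inj[of UNIV] inj[of UNIV]]]])
    then have "2 * card (edges (diameter_graph X)) + 4 \<le> 4 * card (\<phi> ` X)"
      using card_pairs_at_le[OF cluster] \<open>X \<noteq> {}\<close> card_ordered_edges[OF assms(3)] by simp
    then show ?thesis using card_image[OF inj] assms(5) by simp
  qed

  have part2: "chromatic_number (diameter_graph X) \<le> 4"
  proof -
    obtain f :: "real^4 \<Rightarrow> nat" where f: "f ` \<phi> ` X \<subseteq> {..<4}"
      "\<forall>x\<in>\<phi> ` X. \<forall>y\<in>\<phi> ` X. x \<bullet> y = t \<longrightarrow> f x \<noteq> f y"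
      using ex_four_colouring[OF cluster] by blast
    have "proper_colouring (diameter_graph X) 4 (f \<circ> \<phi>)"
      unfolding proper_colouring_def edge_diameter_graph_iff
      using f adj by (auto simp: diameter_graph_def)
    then show ?thesis unfolding chromatic_number_def by (intro Least_le exI)
  qed

  have part3: "set p \<inter> set q \<noteq> {}"
    if pq: "is_odd_cycle (diameter_graph X) p" "is_odd_cycle (diameter_graph X) q" for p q
  proof
    assume disj: "set p \<inter> set q = {}"
    define x where "x p k = \<phi> (p ! (k mod length p))" for p :: "(real^4) list" and k
    have walk: "x p (k + length p) = x p k" "x p k \<bullet> x p (Suc k) = t" "x p k \<noteq> x p (Suc (Suc k))"
      "range (x p) \<subseteq> \<phi> ` set p" "set p \<subseteq> X" "odd (length p)"
      if "is_odd_cycle (diameter_graph X) p" for p k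
    proof -
      have len: "length p \<ge> 3" and dst: "distinct p" and sub: "set p \<subseteq> X" and odd: "odd (length p)"
        and ed: "\<And>i. i < length p \<Longrightarrow> {p ! i, p ! (Suc i mod length p)} \<in> edges (diameter_graph X)"
        using that by (auto simp: is_odd_cycle_def is_cycle_def diameter_graph_def)
      have lt: "k mod length p < length p" for k using len by (intro mod_less_divisor) linarith
      show "x p (k + length p) = x p k" by (simp add: x_def)
      have "{p ! (k mod length p), p ! (Suc k mod length p)} \<in> edges (diameter_graph X)"
        using ed[OF lt[of k]] by (simp add: mod_Suc_eq)
      then show "x p k \<bullet> x p (Suc k) = t" unfolding x_def edge_diameter_graph_iff using adj by blast
      have "k mod length p \<noteq> Suc (Suc k) mod length p"
      proof
        assume "k mod length p = Suc (Suc k) mod length p"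
        then have "length p dvd Suc (Suc k) - k" by (subst mod_eq_dvd_iff_nat[symmetric]) auto
        then have "length p \<le> 2" by (intro dvd_imp_le) auto
        then show False using len by simp
      qed
      then have "p ! (k mod length p) \<noteq> p ! (Suc (Suc k) mod length p)"
        using nth_eq_iff_index_eq[OF dst lt lt] by blast
      then show "x p k \<noteq> x p (Suc (Suc k))" unfolding x_def using inj[of UNIV] by (auto dest: injD)
      show "range (x p) \<subseteq> \<phi> ` set p" unfolding x_def using lt by auto
      show "set p \<subseteq> X" "odd (length p)" by (rule sub odd)+
    qed
    note wp = walk[OF pq(1)] and wq = walk[OF pq(2)]
    have sub: "range (x p) \<union> range (x q) \<subseteq> \<phi> ` X" using wp(4,5) wq(4,5) by blast
    have "\<phi> ` set p \<inter> \<phi> ` set q = {}" using disj inj[of UNIV] by (auto dest: injD)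
    then have "range (x p) \<inter> range (x q) = {}" using wp(4) wq(4) by blast
    then show False
      by (rule odd_closed_walks_meet[OF spherical_cluster_subset[OF cluster sub] wp(6) wq(6) wp(1-3) wq(1-3)])
  qed
  show ?thesis using part1 part2 part3 by blast
qed

end
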